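(* Let $(\lambda_N)_{N}$ be a sequence of non-trivial conjugacy classes $\lambda_N\subset\mathfrak{S}(N)$ which converges and is evanescent, with limiting data $(\lambda(i))_{i\ge2}$, and for each $N$ let $(S^N_t)_{t\ge 0}$ be a $\lambda_N$-random walk on $\mathfrak{S}(N)$. For $n\ge1$ and $t\ge0$ let $m_{n^c}(t)=\lim_{N\to\infty}\mathbb{E}\,m_{(1,\dots,n)^c}[S^N_t]$. Then $$m_{n^{c}}(t) = e^{-nt} \sum_{k=0}^{n-1} t^{k} \frac{n^{k-1}}{k!} \sum_{\substack{(i_1,\dots,i_k)\in (\mathbb{N}^{*})^k\\ i_1+\dots+i_k = n-1}}\ \prod_{j=1}^{k} \lambda(i_j+1),$$ with the usual conventions for empty products and sums (thus $m_{1^c}(t)=e^{-t}$). As a consequence, for any $n\ge1$ and $t\ge0$, $$\int_{\mathbb{U}} z^{n}\, d\overline{\mu}_{t}^{\lambda}(z) = \sum_{d| n} e^{-dt} \sum_{k=0}^{d-1} t^{k} \frac{d^{k-1}}{k!} \sum_{\substack{(i_1,\dots,i_k)\in (\mathbb{N}^{*})^k\\ i_1+\dots+i_k = d-1}}\ \prod_{j=1}^{k} \lambda(i_j+1),$$ where $\overline{\mu}^\lambda_t$ is the limit, as $N\to\infty$, of the mean eigenvalue distribution of $S^N_t$, a probability measure on the unit circle $\mathbb{U}$.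
   Context: Random walks. $\mathfrak{S}(N)$ is the symmetric group; permutations $S$ are identified with $N\times N$ permutation matrices. For a permutation $\sigma$, the period of $j$ in $\sigma$ is the smallest $n\ge1$ with $\sigma^n(j)=j$. For a conjugacy class $\lambda_N$ of $\mathfrak{S}(N)$, $\lambda_N(i)$ is the number of $j\in\{1,\dots,N\}$ whose period in $\sigma$ equals $i$ (any $\sigma\in\lambda_N$), and $\lambda_N(1^c)=N-\lambda_N(1)$. Classes are assumed non-trivial: $\lambda_N\neq\{id_N\}$ ($N\ge2$). The $\lambda_N$-random walk $(S^N_t)_{t\ge0}$ is the Markov process on $\mathfrak{S}(N)$ with $S^N_0=id_N$ and generator $$H_Nf(\sigma_0)=\frac{N}{\lambda_N(1^c)}\frac{1}{\#\lambda_N}\sum_{\sigma\in\lambda_N}[f(\sigma\sigma_0)-f(\sigma_0)].$$ The sequence $(\lambda_N)_N$ converges if there are $\lambda(i)\ge0$ ($i\ge2$) with $\sum_{i\ge2}\lambda(i)\le1$ and $\lambda_N(i)/\lambda_N(1^c)\to\lambda(i)$ for every $i\ge2$, and there is $\alpha\in[0,1]$ with $\lambda_N(1)/N\to1-\alpha$. It is evanescent if $\alpha=0$. For a permutation $S\in\mathfrak{S}(N)$, $m_{(1,\dots,n)^c}(S)=\frac1N\#\{j\in\{1,\dots,N\}: j\text{ has period }n\text{ in }S\}$, and $\mathbb{E}m_{(1,\dots,n)^c}[S]$ is its expectation for random $S$. (The limit $m_{n^c}(t)$ exists.) The mean eigenvalue distribution is the expectation of the empirical eigenvalue distribution $\frac1N\sum\delta_{\text{eigenvalue}}$.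 $\mathbb{N}^*=\{1,2,\dots\}$. *)

theory Defs
  imports
    "HOL-Algebra.Sym_Groups"
    "HOL-Probability.Probability"
    "HOL-Computational_Algebra.Computational_Algebra"
    "Jordan_Normal_Form.Char_Poly"
begin

subsection \<open>Conjugacy classes of the symmetric group\<close>

definition conj_class :: "('a, 'b) monoid_scheme \<Rightarrow> 'a set \<Rightarrow> bool" where
  "conj_class G C \<longleftrightarrow>
     (\<exists>g\<in>carrier G. C = {h \<otimes>\<^bsub>G\<^esub> g \<otimes>\<^bsub>G\<^esub> inv\<^bsub>G\<^esub> h | h. h \<in> carrier G})"

text \<open>\<^const>\<open>least_power\<close> \<open>p j\<close> is the period of \<open>j\<close> in \<open>p\<close>: the least \<open>n > 0\<close>
  with \<open>(p ^^ n) j = j\<close>. The elements of \<open>sym_group N\<close> permute \<open>{1..N}\<close>.\<close>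

definition num_period :: "nat \<Rightarrow> (nat \<Rightarrow> nat) \<Rightarrow> nat \<Rightarrow> nat" where
  "num_period N p i = card {j\<in>{1..N}. least_power p j = i}"

text \<open>The number is the same for all elements of a conjugacy class.\<close>

definition class_period :: "nat \<Rightarrow> (nat \<Rightarrow> nat) set \<Rightarrow> nat \<Rightarrow> real" where
  "class_period N C i = real (num_period N (SOME p. p \<in> C) i)"

definition class_support :: "nat \<Rightarrow> (nat \<Rightarrow> nat) set \<Rightarrow> real" where
  "class_support N C = real N - class_period N C 1"

text \<open>Only the values \<open>lam i\<close> with \<open>i \<ge> 2\<close> are meaningful. The sequence is evanescent
  if it converges with \<open>\<alpha> = 0\<close>.\<close>

definition class_seq_converges ::
    "(nat \<Rightarrow> (nat \<Rightarrow> nat) set) \<Rightarrow> (nat \<Rightarrow> real) \<Rightarrow> real \<Rightarrow> bool" where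
  "class_seq_converges C lam \<alpha> \<longleftrightarrow>
     (\<forall>i\<ge>2. 0 \<le> lam i) \<and>
     lam summable_on {2..} \<and> infsum lam {2..} \<le> 1 \<and>
     (\<forall>i\<ge>2. (\<lambda>N. class_period N (C N) i / class_support N (C N)) \<longlonglongrightarrow> lam i) \<and>
     0 \<le> \<alpha> \<and> \<alpha> \<le> 1 \<and>
     (\<lambda>N. class_period N (C N) 1 / real N) \<longlonglongrightarrow> 1 - \<alpha>"


subsection \<open>The random walk\<close>

definition walk_generator ::
    "nat \<Rightarrow> (nat \<Rightarrow> nat) set \<Rightarrow> ((nat \<Rightarrow> nat) \<Rightarrow> real) \<Rightarrow> (nat \<Rightarrow> nat) \<Rightarrow> real" where
  "walk_generator N C f p0 =
     real N / class_support N C * (1 / real (card C)) * (\<Sum>p\<in>C. f (p \<circ> p0) - f p0)"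

text \<open>A Markov semigroup on a finite state space \<open>E\<close>; only the values \<open>K t x\<close> with
  \<open>t \<ge> 0\<close> and \<open>x \<in> E\<close> are meaningful.\<close>

definition markov_semigroup :: "'s set \<Rightarrow> (real \<Rightarrow> 's \<Rightarrow> 's pmf) \<Rightarrow> bool" where
  "markov_semigroup E K \<longleftrightarrow>
     (\<forall>x\<in>E. K 0 x = return_pmf x \<and> (\<forall>t\<ge>0. set_pmf (K t x) \<subseteq> E) \<and>
        (\<forall>s\<ge>0. \<forall>t\<ge>0. K (s + t) x = bind_pmf (K s x) (K t)))"

definition has_generator ::
    "'s set \<Rightarrow> (real \<Rightarrow> 's \<Rightarrow> 's pmf) \<Rightarrow> (('s \<Rightarrow> real) \<Rightarrow> 's \<Rightarrow> real) \<Rightarrow> bool" where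
  "has_generator E K H \<longleftrightarrow>
     (\<forall>f. \<forall>x\<in>E. ((\<lambda>t. (measure_pmf.expectation (K t x) f - f x) / t) \<longlongrightarrow> H f x) (at_right 0))"

text \<open>The Markov property with respect to the natural filtration. As \<open>E\<close> is finite, it
  suffices to condition on the values of the process at finitely many past times.\<close>

definition markov_process ::
    "'s set \<Rightarrow> (('s \<Rightarrow> real) \<Rightarrow> 's \<Rightarrow> real) \<Rightarrow> 'w measure \<Rightarrow> (real \<Rightarrow> 'w \<Rightarrow> 's) \<Rightarrow> bool" where
  "markov_process E H M X \<longleftrightarrow>
     prob_space M \<and>
     (\<forall>t\<ge>0. X t \<in> M \<rightarrow>\<^sub>M count_space E) \<and>
     (\<exists>K. markov_semigroup E K \<and> has_generator E K H \<and>
        (\<forall>s\<ge>0. \<forall>t\<ge>0. \<forall>J. finite J \<and> J \<subseteq> {0..s} \<longrightarrow> (\<forall>x. \<forall>a\<in>E. \<forall>b\<in>E.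
           measure M {\<omega>\<in>space M. (\<forall>u\<in>J. X u \<omega> = x u) \<and> X s \<omega> = a \<and> X (s + t) \<omega> = b}
           = measure M {\<omega>\<in>space M. (\<forall>u\<in>J. X u \<omega> = x u) \<and> X s \<omega> = a} * pmf (K t a) b)))"

definition random_walk ::
    "nat \<Rightarrow> (nat \<Rightarrow> nat) set \<Rightarrow> 'w measure \<Rightarrow> (real \<Rightarrow> 'w \<Rightarrow> nat \<Rightarrow> nat) \<Rightarrow> bool" where
  "random_walk N C M X \<longleftrightarrow>
     markov_process (carrier (sym_group N)) (walk_generator N C) M X \<and>
     (AE \<omega> in M. X 0 \<omega> = id)"


subsection \<open>Period statistics and eigenvalue distributions\<close>

definition period_density :: "nat \<Rightarrow> nat \<Rightarrow> (nat \<Rightarrow> nat) \<Rightarrow> real" where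
  "period_density N n p = real (num_period N p n) / real N"

text \<open>Row and column \<open>i\<close> (counted from \<open>0\<close>) correspond to the point \<open>i + 1\<close>.\<close>

definition perm_matrix :: "nat \<Rightarrow> (nat \<Rightarrow> nat) \<Rightarrow> complex mat" where
  "perm_matrix N p = Matrix.mat N N (\<lambda>(i, j). if p (j + 1) = i + 1 then 1 else 0)"

text \<open>\<^const>\<open>proots\<close> lists the eigenvalues with their algebraic multiplicities.\<close>

definition empirical_eigenvalue_dist :: "nat \<Rightarrow> (nat \<Rightarrow> nat) \<Rightarrow> complex measure" where
  "empirical_eigenvalue_dist N p =
     distr (measure_pmf (pmf_of_multiset (proots (char_poly (perm_matrix N p))))) borel (\<lambda>z. z)"

text \<open>The expectation of a random measure is the Giry bind: the mass of a Borel set is the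
  expectation of its random mass.\<close>

definition mean_eigenvalue_dist ::
    "nat \<Rightarrow> 'w measure \<Rightarrow> ('w \<Rightarrow> nat \<Rightarrow> nat) \<Rightarrow> complex measure" where
  "mean_eigenvalue_dist N M X = M \<bind> (\<lambda>\<omega>. empirical_eigenvalue_dist N (X \<omega>))"

definition circle_prob :: "complex measure \<Rightarrow> bool" where
  "circle_prob \<mu> \<longleftrightarrow> prob_space \<mu> \<and> sets \<mu> = sets borel \<and> emeasure \<mu> (sphere 0 1) = 1"

text \<open>The library's \<^const>\<open>weak_conv_m\<close> is restricted to measures on the real line.\<close>

definition weakly_converges ::
    "(nat \<Rightarrow> 'a::topological_space measure) \<Rightarrow> 'a measure \<Rightarrow> bool" where
  "weakly_converges \<nu> \<mu> \<longleftrightarrow>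
     (\<forall>f :: 'a \<Rightarrow> real. continuous_on UNIV f \<and> bounded (range f) \<longrightarrow>
        (\<lambda>N. \<integral>x. f x \<partial>\<nu> N) \<longlonglongrightarrow> (\<integral>x. f x \<partial>\<mu>))"

text \<open>The exponent \<open>k - 1\<close> is an integer, equal to \<open>-1\<close> for \<open>k = 0\<close>. For \<open>k = 0\<close> the
  inner sum is over the empty list, which satisfies the constraint exactly when \<open>n = 1\<close>.\<close>

definition limit_density :: "(nat \<Rightarrow> real) \<Rightarrow> nat \<Rightarrow> real \<Rightarrow> real" where
  "limit_density lam n t =
     exp (- real n * t) *
     (\<Sum>k=0..n - 1. t ^ k * (real n powi (int k - 1) / fact k) *
        (\<Sum>is | length is = k \<and> (\<forall>i\<in>set is. 1 \<le> i) \<and> sum_list is = n - 1.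
           \<Prod>j<k. lam (is ! j + 1)))"

end

theory Submission
  imports Defs "Jordan_Normal_Form.Schur_Decomposition"
begin

text \<open>
  A point of a finite cycle is moved by a step at total rate one. In the evanescent regime a step
  \<open>s\<close> with an \<open>i\<close>-cycle meets a bounded number of short cycles in at most one point each, so it
  glues \<open>i\<close> distinct cycles into one; two moved points on a short stretch of one cycle
  are negligible. Up to an error of order \<open>|supp s| / N\<close> the generator therefore acts on the vector
  of period densities \<open>m\<^sub>1, m\<^sub>2, \<dots>\<close> as the vector field
  \<open>- n m\<^sub>n + (\<Sum>i. \<lambda>(i) (n / i) (\<Sum>n\<^sub>1 + \<dots> + n\<^sub>i = n. m\<^sub>n\<^sub>1 \<cdots> m\<^sub>n\<^sub>i))\<close>, and the quadratic fluctuations vanish.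
  Gronwall's inequality for the mean squared deviation shows that the densities follow the solution
  of this triangular system. Its generating function \<open>X\<close> satisfies \<open>X = z exp(t (\<Lambda>(X) - 1))\<close> with
  \<open>\<Lambda>(w) = (\<Sum>i. \<lambda>(i + 1) w\<^sup>i)\<close>, so Lagrange inversion gives the stated formula.

  The \<open>n\<close>-th moment of the empirical eigenvalue distribution is the proportion of points whose
  period divides \<open>n\<close>. On the circle, convergence of moments is weak convergence, and the limit is
  the mixture of the uniform distributions on the \<open>d\<close>-th roots of unity with weights \<open>m\<^sub>d(t)\<close>, the
  remaining mass being Haar measure.
\<close>

section \<open>Lagrange inversion and the limiting differential equation\<close>

text \<open>Let m be the number of points moved by a step, so that steps come at rate
  \<open>N / m\<close>. A step produces about \<open>m^2 / N\<close> coincidences of two moved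
  points on a short stretch of a cycle, which after division by \<open>N\<close> cost
  \<open>m / N\<close> in the generator. A density jumps by at most order \<open>m / N\<close>, so
  its squared jumps accumulate at rate of order \<open>m / N\<close> as well. Evanescence says that
  this ratio tends to 0. The average over a class is also an average over all relabellings of a
  fixed step; the points of one of its cycles then form a sample without replacement, and comparing
  it with independent uniform points yields the products in the limiting equation. Since that
  equation is nonlinear, the densities cannot be followed one expectation at a time; by
  triangularity the first n of them form a closed system, whose squared deviations are summed. That
  the limits have sum at most 1 is not visible in the formula: it is inherited from finite
  \<open>N\<close> after convergence, and the comparison itself works with a bound obtained from
  continuity in time. The limiting measure is then built explicitly, without compactness.\<close>

definition compositions :: "nat \<Rightarrow> nat \<Rightarrow> nat list set" where
  "compositions k m = {is. length is = k \<and> (\<forall>i\<in>set is. 1 \<le> i) \<and> sum_list is = m}"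

text \<open>Deleting the constant term does two jobs: powers see only tuples with positive parts,
  and the series may be substituted into another one.\<close>

definition shifted_fps :: "(nat \<Rightarrow> real) \<Rightarrow> real fps" where
  "shifted_fps f = Abs_fps (\<lambda>n. if n = 0 then 0 else f n)"

lemma shifted_fps_nth [simp]: "fps_nth (shifted_fps f) n = (if n = 0 then 0 else f n)"
  by (simp add: shifted_fps_def)

lemma compositions_subset: "compositions k m \<subseteq> natpermute m k"
  by (auto simp: compositions_def natpermute_def)

lemma finite_compositions [simp]: "finite (compositions k m)"
  by (rule finite_subset[OF compositions_subset natpermute_finite])

abbreviation composition_sum :: "nat \<Rightarrow> nat \<Rightarrow> (nat \<Rightarrow> real) \<Rightarrow> real" where
  "composition_sum i n x \<equiv> \<Sum>is\<in>compositions i n. \<Prod>k<i. x (is ! k)"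

lemma shifted_fps_power_nth:
  "fps_nth (shifted_fps f ^ k) m = (\<Sum>is\<in>compositions k m. \<Prod>j<k. f (is ! j))"
proof (cases "k = 0")
  case True
  have "compositions 0 m = (if m = 0 then {[]} else {})"
    by (auto simp: compositions_def)
  with True show ?thesis by simp
next
  case False
  have "fps_nth (shifted_fps f ^ k) m =
      (\<Sum>v\<in>natpermute m k. \<Prod>j<k. fps_nth (shifted_fps f) (v ! j))"
    using False by (simp add: fps_power_nth atLeast0AtMost lessThan_Suc_atMost [symmetric])
  also have "\<dots> = (\<Sum>v\<in>compositions k m. \<Prod>j<k. fps_nth (shifted_fps f) (v ! j))"
  proof (rule sum.mono_neutral_right[OF natpermute_finite compositions_subset], intro ballI)
    fix v assume v: "v \<in> natpermute m k - compositions k m"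
    then have l: "length v = k" by (simp add: natpermute_def)
    from v obtain i where "i \<in> set v" "i = 0"
      by (auto simp: natpermute_def compositions_def not_le Suc_le_eq)
    then obtain j where "j < k" "v ! j = 0" using l by (auto simp: in_set_conv_nth)
    then show "(\<Prod>j<k. fps_nth (shifted_fps f) (v ! j)) = 0"
      by (intro prod_zero) (auto intro!: bexI[of _ j])
  qed
  also have "\<dots> = (\<Sum>is\<in>compositions k m. \<Prod>j<k. f (is ! j))"
  proof (intro sum.cong prod.cong refl)
    fix v j assume "v \<in> compositions k m" "j \<in> {..<k}"
    then have "v ! j \<in> set v" "\<forall>i\<in>set v. 1 \<le> i" by (auto simp: compositions_def)
    then have "v ! j \<noteq> 0" by force
    then show "fps_nth (shifted_fps f) (v ! j) = f (v ! j)" by simp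
  qed
  finally show ?thesis .
qed

text \<open>The classical residue argument without Laurent series: since
  \<open>\<phi> * g = fps_X\<close>, the power \<open>\<phi> ^ r\<close> plays the role of
  \<open>(fps_X / g) ^ r\<close>. Differentiating \<open>X ^ i oo g = fps_X ^ i\<close>, multiplying
  by \<open>\<phi> ^ n\<close> and reading coefficient \<open>n - 1\<close> leaves a single
  coefficient of the derivative of \<open>X ^ i\<close>, because the residue of
  \<open>g' / g ^ (r + 1)\<close> vanishes unless \<open>r = 0\<close>.\<close>

lemma lagrange_inversion:
  fixes \<phi> g X :: "real fps"
  assumes \<phi>0: "fps_nth \<phi> 0 \<noteq> 0" and g: "g = fps_X * inverse \<phi>" and X: "X = fps_inv g"
    and "1 \<le> i" "i \<le> n"
  shows "real n * fps_nth (X ^ i) n = real i * fps_nth (\<phi> ^ n) (n - i)"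
proof -
  have g\<phi>: "\<phi> * g = fps_X"
    using \<phi>0 by (simp add: g mult.left_commute mult.commute[of \<phi>] inverse_mult_eq_1)
  have g0: "fps_nth g 0 = 0" by (simp add: g)
  have g1: "fps_nth g 1 \<noteq> 0" using \<phi>0 by (simp add: g)
  have Xg: "X oo g = fps_X" unfolding X by (rule fps_inv[OF g0 g1])
  have gpow: "\<phi> ^ r * g ^ r = fps_X ^ r" for r
    by (simp add: power_mult_distrib [symmetric] g\<phi>)
  \<comment> \<open>the residue of \<open>g' / g\<^sup>r\<^sup>+\<^sup>1\<close>\<close>
  have res: "fps_nth (\<phi> ^ Suc r * fps_deriv g) r = (if r = 0 then 1 else 0)" for r
  proof -
    have "fps_deriv (\<phi> * g) = 1" by (simp add: g\<phi>)
    then have d: "\<phi> * fps_deriv g = 1 - fps_deriv \<phi> * g"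
      by (simp add: algebra_simps)
    show ?thesis
    proof (cases r)
      case 0
      then show ?thesis using d g0 by simp
    next
      case (Suc k)
      have "\<phi> ^ Suc r * fps_deriv g = \<phi> ^ r * (\<phi> * fps_deriv g)"
        by (simp add: algebra_simps)
      also have "\<dots> = \<phi> ^ r - fps_deriv \<phi> * \<phi> ^ k * (\<phi> * g)"
        unfolding d by (simp add: Suc algebra_simps)
      also have "\<dots> = \<phi> ^ r - fps_X * (fps_deriv \<phi> * \<phi> ^ k)"
        by (simp add: g\<phi> algebra_simps)
      finally have e: "\<phi> ^ Suc r * fps_deriv g = \<phi> ^ r - fps_X * (fps_deriv \<phi> * \<phi> ^ k)" .
      have "fps_deriv (\<phi> ^ r) = fps_const (real r) * (fps_deriv \<phi> * \<phi> ^ k)"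
        by (simp only: fps_deriv_power' fps_of_nat [symmetric]) (simp add: Suc mult_ac del: of_nat_Suc)
      then have "fps_nth (fps_deriv (\<phi> ^ r)) k = real r * fps_nth (fps_deriv \<phi> * \<phi> ^ k) k"
        by simp
      moreover have "fps_nth (fps_deriv (\<phi> ^ r)) k = real r * fps_nth (\<phi> ^ r) r"
        by (simp only: fps_deriv_nth Suc Suc_eq_plus1)
      ultimately have "real r * fps_nth (\<phi> ^ r) r = real r * fps_nth (fps_deriv \<phi> * \<phi> ^ k) k"
        by (simp only:)
      then have "fps_nth (\<phi> ^ r) r = fps_nth (fps_deriv \<phi> * \<phi> ^ k) k"
        using Suc by (simp only: mult_cancel_left) auto
      then show ?thesis unfolding e using Suc by simp
    qed
  qed
  obtain n' where n: "n = Suc n'" using assms by (cases n) auto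
  define a where "a = fps_deriv (X ^ i)"
  have "fps_deriv (X ^ i oo g) = (a oo g) * fps_deriv g"
    unfolding a_def by (rule fps_compose_deriv[OF g0])
  moreover have "X ^ i oo g = fps_X ^ i"
    by (simp add: fps_compose_power[OF g0, symmetric] Xg)
  ultimately have ag: "(a oo g) * fps_deriv g = fps_const (real i) * fps_X ^ (i - 1)"
    by (simp add: fps_deriv_power)
  \<comment> \<open>\<open>g ^ m\<close> starts at order \<open>m\<close>, so up to coefficient
    \<open>n'\<close> the substitution is a finite sum that can be multiplied out termwise.\<close>
  have trunc: "fps_nth (a oo g) k = fps_nth (\<Sum>m\<le>n'. fps_const (fps_nth a m) * g ^ m) k"
    if "k \<le> n'" for k
  proof -
    have "fps_nth (a oo g) k = (\<Sum>m=0..k. fps_nth a m * fps_nth (g ^ m) k)"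
      by (rule fps_compose_nth)
    also have "\<dots> = (\<Sum>m\<le>n'. fps_nth a m * fps_nth (g ^ m) k)"
      using that g0 by (intro sum.mono_neutral_left) (auto simp: startsby_zero_power_prefix)
    finally show ?thesis by (simp add: fps_sum_nth)
  qed
  have "fps_nth (\<phi> ^ n * ((a oo g) * fps_deriv g)) n' = fps_nth ((a oo g) * (\<phi> ^ n * fps_deriv g)) n'"
    by (simp only: mult_ac)
  also have "\<dots> = fps_nth ((\<Sum>m\<le>n'. fps_const (fps_nth a m) * g ^ m) * (\<phi> ^ n * fps_deriv g)) n'"
    unfolding fps_mult_nth by (intro sum.cong refl arg_cong2[of _ _ _ _ "(*)"] trunc) auto
  also have "\<dots> = (\<Sum>m\<le>n'. fps_nth a m * fps_nth (g ^ m * (\<phi> ^ n * fps_deriv g)) n')"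
    by (simp add: sum_distrib_right fps_sum_nth mult.assoc)
  also have "\<dots> = (\<Sum>m\<le>n'. if m = n' then fps_nth a m else 0)"
  proof (intro sum.cong refl)
    fix m assume "m \<in> {..n'}"
    then have m: "m \<le> n'" by simp
    \<comment> \<open>The factor \<open>\<phi> ^ m\<close> turns \<open>g ^ m\<close> into
      \<open>fps_X ^ m\<close>, which lowers the coefficient index to \<open>n' - m\<close>; what
      remains is \<open>res\<close> with \<open>r = n' - m\<close>.\<close>
    have "\<phi> ^ n = \<phi> ^ m * \<phi> ^ Suc (n' - m)"
      using m by (simp add: n power_add [symmetric] flip: power_Suc)
    then have "g ^ m * (\<phi> ^ n * fps_deriv g) = (\<phi> ^ m * g ^ m) * (\<phi> ^ Suc (n' - m) * fps_deriv g)"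
      by (simp only: mult_ac)
    then have "fps_nth (g ^ m * (\<phi> ^ n * fps_deriv g)) n' = fps_nth (\<phi> ^ Suc (n' - m) * fps_deriv g) (n' - m)"
      unfolding gpow using m by (simp only: mult.assoc fps_X_power_mult_nth) auto
    then show "fps_nth a m * fps_nth (g ^ m * (\<phi> ^ n * fps_deriv g)) n' = (if m = n' then fps_nth a m else 0)"
      unfolding res using m by auto
  qed
  also have "\<dots> = real n * fps_nth (X ^ i) n"
    by (simp add: a_def n)
  finally have "real n * fps_nth (X ^ i) n = fps_nth (\<phi> ^ n * (fps_const (real i) * fps_X ^ (i - 1))) n'"
    unfolding ag ..
  also have "\<phi> ^ n * (fps_const (real i) * fps_X ^ (i - 1)) = fps_const (real i) * (fps_X ^ (i - 1) * \<phi> ^ n)"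
    by (simp only: mult_ac)
  also have "fps_nth \<dots> n' = real i * fps_nth (\<phi> ^ n) (n - i)"
    using assms n by (simp add: fps_X_power_mult_nth)
  finally show ?thesis .
qed

text \<open>This is \<open>exp (t * (\<Lambda> - 1))\<close> as a power series, with
  \<open>\<Lambda>\<close> the series with coefficients \<open>lam (i + 1)\<close>. The constant
  \<open>exp (- t)\<close> is split off because only a series without constant term may be
  substituted into \<open>fps_exp t\<close>.\<close>

definition exp_fps :: "(nat \<Rightarrow> real) \<Rightarrow> real \<Rightarrow> real fps" where
  "exp_fps lam t = fps_const (exp (- t)) * (fps_exp t oo shifted_fps (\<lambda>i. lam (i + 1)))"

lemma exp_fps_power:
  "exp_fps lam t ^ n = fps_const (exp (- real n * t)) * (fps_exp (real n * t) oo shifted_fps (\<lambda>i. lam (i + 1)))"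
proof -
  have "fps_nth (shifted_fps (\<lambda>i. lam (i + 1))) 0 = 0" by simp
  from fps_compose_power[OF this, of "fps_exp t" n]
  show ?thesis
    by (simp add: exp_fps_def power_mult_distrib fps_exp_power_mult exp_of_nat_mult [symmetric] mult.commute)
qed

lemma exp_fps_power_nth:
  "fps_nth (exp_fps lam t ^ n) m =
     exp (- real n * t) * (\<Sum>k=0..m. (real n * t) ^ k / fact k * fps_nth (shifted_fps (\<lambda>i. lam (i + 1)) ^ k) m)"
  unfolding exp_fps_power by (simp add: fps_compose_nth)

text \<open>This recognises the stated formula as Lagrange's coefficient for the inverse series
  itself, the case of exponent 1. Multiplication by \<open>n\<close> raises the exponent
  \<open>k - 1\<close> of \<open>n\<close> to \<open>k\<close>, so that \<open>n\<close> and
  \<open>t\<close> enter through their product.\<close>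

lemma limit_density_eq_exp_fps:
  assumes "1 \<le> n"
  shows "real n * limit_density lam n t = fps_nth (exp_fps lam t ^ n) (n - 1)"
proof -
  \<comment> \<open>For \<open>k = 0\<close> the integer power is \<open>1 / n\<close>, which the
    factor \<open>n\<close> cancels; \<open>n\<close> has to be nonzero here.\<close>
  have *: "real n * (t ^ k * (real n powi (int k - 1) / fact k)) = (real n * t) ^ k / fact k" for k
  proof (cases k)
    case 0
    then show ?thesis using assms by (simp add: power_int_minus)
  next
    case (Suc j)
    then have "int k - 1 = int j" by simp
    then show ?thesis by (simp add: Suc power_mult_distrib)
  qed
  have "real n * limit_density lam n t = exp (- real n * t) *
      (\<Sum>k=0..n - 1. (real n * (t ^ k * (real n powi (int k - 1) / fact k))) *
        fps_nth (shifted_fps (\<lambda>i. lam (i + 1)) ^ k) (n - 1))"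
    unfolding limit_density_def shifted_fps_power_nth compositions_def
    by (simp add: sum_distrib_left mult_ac)
  then show ?thesis unfolding * exp_fps_power_nth .
qed

text \<open>Exponent 1 identifies the generating function of the limit densities with the
  compositional inverse of \<open>fps_X * inverse \<phi>\<close>. The other exponents then turn its
  powers, which are the sums over compositions in the differential equation, into coefficients of
  powers of \<open>exp_fps\<close>.\<close>

lemma limit_density_power_nth:
  assumes "1 \<le> i" "i \<le> n"
  shows "real n * fps_nth (shifted_fps (\<lambda>n. limit_density lam n t) ^ i) n
       = real i * fps_nth (exp_fps lam t ^ n) (n - i)"
proof -
  define \<phi> where "\<phi> = exp_fps lam t"
  define X where "X = fps_inv (fps_X * inverse \<phi>)"
  have \<phi>0: "fps_nth \<phi> 0 \<noteq> 0" by (simp add: \<phi>_def exp_fps_def)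
  note L = lagrange_inversion[OF \<phi>0 refl X_def]
  have "X = shifted_fps (\<lambda>n. limit_density lam n t)"
  proof (rule fps_ext)
    fix m
    show "fps_nth X m = fps_nth (shifted_fps (\<lambda>n. limit_density lam n t)) m"
    proof (cases "m = 0")
      case True
      then show ?thesis by (simp add: X_def fps_inv_def)
    next
      case False
      then have "real m * fps_nth X m = real m * limit_density lam m t"
        using L[of 1 m] by (simp add: limit_density_eq_exp_fps \<phi>_def)
      then show ?thesis using False by simp
    qed
  qed
  then show ?thesis using L[OF assms] by (simp add: \<phi>_def)
qed

text \<open>Coefficientwise form of
  \<open>d/dt \<phi> ^ n = n * (\<Lambda> - 1) * \<phi> ^ n\<close> for
  \<open>\<phi> = exp_fps lam t\<close>. Each coefficient is a finite sum of elementary functions of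
  \<open>t\<close>, so no infinite series is differentiated.\<close>

lemma exp_fps_power_nth_deriv:
  "((\<lambda>t. fps_nth (exp_fps lam t ^ n) m) has_real_derivative
     real n * (fps_nth (shifted_fps (\<lambda>i. lam (i + 1)) * exp_fps lam t ^ n) m - fps_nth (exp_fps lam t ^ n) m)) (at t)"
proof -
  define \<Lambda> where "\<Lambda> = shifted_fps (\<lambda>i. lam (i + 1))"
  have *: "fps_nth (\<Lambda> * exp_fps lam t ^ n) m =
     exp (- real n * t) * (\<Sum>k=0..m. (of_nat k * (real n * t) ^ (k - 1)) / fact k * fps_nth (\<Lambda> ^ k) m)"
  proof -
    have L0: "fps_nth \<Lambda> 0 = 0" by (simp add: \<Lambda>_def)
    have "\<Lambda> * exp_fps lam t ^ n = fps_const (exp (- real n * t)) * ((fps_X * fps_exp (real n * t)) oo \<Lambda>)"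
      unfolding exp_fps_power \<Lambda>_def [symmetric]
      by (simp add: fps_compose_mult_distrib[OF L0] L0 mult_ac)
    then have "fps_nth (\<Lambda> * exp_fps lam t ^ n) m = exp (- real n * t) *
       (\<Sum>k=0..m. fps_nth (fps_X * fps_exp (real n * t)) k * fps_nth (\<Lambda> ^ k) m)"
      by (simp add: fps_compose_nth)
    \<comment> \<open>Multiplying the exponential series by the variable gives the terms
      differentiated in \<open>n * t\<close>; at \<open>k = 0\<close> the truncated
      \<open>k - 1\<close> is masked by the factor 0.\<close>
    moreover have "fps_nth (fps_X * fps_exp (real n * t)) k = (of_nat k * (real n * t) ^ (k - 1)) / fact k" for k
      by (cases k) (simp_all add: field_simps del: of_nat_Suc)
    ultimately show ?thesis by (simp only:)
  qed
  have "((\<lambda>t. exp (- real n * t) * (\<Sum>k=0..m. (real n * t) ^ k / fact k * fps_nth (\<Lambda> ^ k) m)) has_real_derivative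
      (- real n * exp (- real n * t)) * (\<Sum>k=0..m. (real n * t) ^ k / fact k * fps_nth (\<Lambda> ^ k) m)
      + exp (- real n * t) * (\<Sum>k=0..m. (of_nat k * (real n * t) ^ (k - 1) * real n) / fact k * fps_nth (\<Lambda> ^ k) m)) (at t)"
    by (auto intro!: derivative_eq_intros sum.cong simp: mult_ac)
  also have "(\<Sum>k=0..m. (of_nat k * (real n * t) ^ (k - 1) * real n) / fact k * fps_nth (\<Lambda> ^ k) m)
     = real n * (\<Sum>k=0..m. (of_nat k * (real n * t) ^ (k - 1)) / fact k * fps_nth (\<Lambda> ^ k) m)"
    by (simp add: sum_distrib_left mult_ac)
  also have "(- real n * exp (- real n * t)) * (\<Sum>k=0..m. (real n * t) ^ k / fact k * fps_nth (\<Lambda> ^ k) m)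
      + exp (- real n * t) * (real n * (\<Sum>k=0..m. (of_nat k * (real n * t) ^ (k - 1)) / fact k * fps_nth (\<Lambda> ^ k) m))
    = real n * (fps_nth (\<Lambda> * exp_fps lam t ^ n) m - fps_nth (exp_fps lam t ^ n) m)"
    unfolding * exp_fps_power_nth \<Lambda>_def [symmetric] by (simp add: algebra_simps)
  finally show ?thesis unfolding exp_fps_power_nth \<Lambda>_def .
qed

text \<open>The coefficients are a parameter because the same field is used with the class ratios at
  finite \<open>N\<close> and with \<open>lam\<close> in the limit. Parts of a composition are
  positive, so only \<open>x 1\<close>, ..., \<open>x n\<close> enter. The factor
  \<open>n / i\<close> has its origin in \<open>sum_compositions_hd\<close>.\<close>

definition merge_rate :: "(nat \<Rightarrow> real) \<Rightarrow> (nat \<Rightarrow> real) \<Rightarrow> nat \<Rightarrow> real" where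
  "merge_rate c x n = (\<Sum>i=2..n. c i * (real n / real i) * composition_sum i n x) - real n * x n"

text \<open>After division by \<open>n\<close>, the derivative of coefficient \<open>n - 1\<close>
  of \<open>exp_fps lam t ^ n\<close> is a convolution of \<open>lam\<close> with coefficients of
  the same power, and \<open>limit_density_power_nth\<close> turns coefficient \<open>n - i\<close>
  into \<open>n / i\<close> times a sum over compositions.\<close>

lemma limit_density_has_derivative:
  assumes "1 \<le> n"
  shows "(limit_density lam n has_real_derivative merge_rate lam (\<lambda>n. limit_density lam n t) n) (at t)"
proof -
  have eq: "limit_density lam n = (\<lambda>t. fps_nth (exp_fps lam t ^ n) (n - 1) / real n)"
    using limit_density_eq_exp_fps[OF assms] assms by (auto simp: field_simps)
  have "((\<lambda>t. fps_nth (exp_fps lam t ^ n) (n - 1) / real n) has_real_derivative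
     real n * (fps_nth (shifted_fps (\<lambda>i. lam (i + 1)) * exp_fps lam t ^ n) (n - 1) - fps_nth (exp_fps lam t ^ n) (n - 1)) / real n) (at t)"
    by (intro DERIV_cdivide exp_fps_power_nth_deriv)
  then have D: "(limit_density lam n has_real_derivative
     fps_nth (shifted_fps (\<lambda>i. lam (i + 1)) * exp_fps lam t ^ n) (n - 1) - fps_nth (exp_fps lam t ^ n) (n - 1)) (at t)"
    using assms by (subst eq) simp
  have "fps_nth (shifted_fps (\<lambda>i. lam (i + 1)) * exp_fps lam t ^ n) (n - 1)
    = (\<Sum>i=2..n. lam i * (real n / real i) * composition_sum i n (\<lambda>n. limit_density lam n t))"
  proof -
    have "fps_nth (shifted_fps (\<lambda>i. lam (i + 1)) * exp_fps lam t ^ n) (n - 1)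
       = (\<Sum>i=0..n-1. (if i = 0 then 0 else lam (i + 1)) * fps_nth (exp_fps lam t ^ n) (n - 1 - i))"
      unfolding fps_mult_nth shifted_fps_nth ..
    also have "\<dots> = (\<Sum>i=1..n-1. lam (i + 1) * fps_nth (exp_fps lam t ^ n) (n - 1 - i))"
      by (rule sum.mono_neutral_cong_right) auto
    also have "\<dots> = (\<Sum>i=2..n. lam i * fps_nth (exp_fps lam t ^ n) (n - i))"
      by (rule sum.reindex_bij_witness[where i="\<lambda>i. i - 1" and j="\<lambda>i. i + 1"]) auto
    also have "\<dots> = (\<Sum>i=2..n. lam i * (real n / real i) * composition_sum i n (\<lambda>n. limit_density lam n t))"
    proof (intro sum.cong refl)
      fix i assume i: "i \<in> {2..n}"
      have "real i * fps_nth (exp_fps lam t ^ n) (n - i) =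
          real n * composition_sum i n (\<lambda>n. limit_density lam n t)"
        using limit_density_power_nth[of i n lam t] i by (simp add: shifted_fps_power_nth)
      then show "lam i * fps_nth (exp_fps lam t ^ n) (n - i) =
          lam i * (real n / real i) * composition_sum i n (\<lambda>n. limit_density lam n t)"
        using i by (simp add: field_simps)
    qed
    finally show ?thesis .
  qed
  with D show ?thesis
    unfolding merge_rate_def by (simp only: limit_density_eq_exp_fps[OF assms])
qed

lemma limit_density_0: "1 \<le> n \<Longrightarrow> limit_density lam n 0 = (if n = 1 then 1 else 0)"
proof -
  assume n: "1 \<le> n"
  have "real n * limit_density lam n 0 = (\<Sum>k=0..n-1. if k = 0 then (if n = 1 then 1 else 0) else 0)"
    unfolding limit_density_eq_exp_fps[OF n] exp_fps_power_nth
    using n by (auto intro!: sum.cong sum.neutral simp: power_0_left)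
  then show ?thesis using n by (auto split: if_splits)
qed

section \<open>Cycles of a product of two permutations\<close>

lemma funpow_add_apply: "(f ^^ (m + n)) x = (f ^^ m) ((f ^^ n) x)"
  by (simp add: funpow_add)

lemma least_power_funpow:
  assumes "permutation f"
  shows "least_power f ((f ^^ k) x) = least_power f x"
proof -
  have "inj (f ^^ k)" using assms by (simp add: bij_is_inj inj_fn permutation_bijective)
  then have "(f ^^ n) ((f ^^ k) x) = (f ^^ k) x \<longleftrightarrow> (f ^^ n) x = x" for n
    by (metis add.commute funpow_add_apply injD)
  then show ?thesis by (simp add: least_power_def)
qed

lemma funpow_mod_least_power:
  assumes "permutation f"
  shows "(f ^^ (k mod least_power f x)) x = (f ^^ k) x"
  by (rule funpow_mod_eq) (rule least_power_of_permutation(1)[OF assms])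

lemma funpow_orbit_return:
  assumes f: "permutation f" and y: "y = (f ^^ k) x"
  obtains l where "l < least_power f x" "x = (f ^^ l) y"
proof -
  let ?n = "least_power f x"
  have n: "?n > 0" by (rule least_power_of_permutation(2)[OF f])
  have "(f ^^ (?n - k mod ?n)) y = (f ^^ (?n - k mod ?n)) ((f ^^ (k mod ?n)) x)"
    unfolding y funpow_mod_least_power[OF f] ..
  also have "\<dots> = (f ^^ (?n - k mod ?n + k mod ?n)) x"
    by (simp only: funpow_add comp_apply)
  also have "\<dots> = (f ^^ ?n) x" using n by (simp add: less_imp_le)
  also have "\<dots> = x" by (rule least_power_of_permutation(1)[OF f])
  finally have "x = (f ^^ ((?n - k mod ?n) mod ?n)) y"
    using funpow_mod_least_power[OF f, of "?n - k mod ?n" y]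
    by (simp add: y least_power_funpow[OF f])
  then show ?thesis using n by (intro that[of "(?n - k mod ?n) mod ?n"]) auto
qed

lemma least_power_eqI:
  assumes "(f ^^ n) x = x" "0 < n" "\<And>m. 0 < m \<Longrightarrow> m < n \<Longrightarrow> (f ^^ m) x \<noteq> x"
  shows "least_power f x = n"
  unfolding least_power_def using assms by (intro Least_equality) (auto simp: not_less[symmetric])

lemma inj_on_funpow_orbit:
  assumes "permutation f"
  shows "inj_on (\<lambda>i. (f ^^ i) x) {..<least_power f x}"
proof (rule linorder_inj_onI')
  fix i j assume ij: "i \<in> {..<least_power f x}" "j \<in> {..<least_power f x}" "i < j"
  show "(f ^^ i) x \<noteq> (f ^^ j) x"
  proof
    assume "(f ^^ i) x = (f ^^ j) x"
    then have "(f ^^ (j - i)) x = x"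
      using funpow_diff[of f i j x] ij assms by (simp add: permutation bij_is_inj)
    then have "least_power f x \<le> j - i" using ij by (intro least_power_le) auto
    then show False using ij by auto
  qed
qed

text \<open>Such a \<open>j\<close> is reached from a point of \<open>A\<close> in fewer than
  \<open>n\<close> steps, hence is determined by that point and the number of steps.\<close>

lemma card_orbits_meeting_le:
  assumes f: "permutation f" and A: "finite A"
  shows "finite {j. least_power f j = n \<and> (\<exists>k. (f ^^ k) j \<in> A)}"
    and "card {j. least_power f j = n \<and> (\<exists>k. (f ^^ k) j \<in> A)} \<le> n * card A"
proof -
  let ?J = "{j. least_power f j = n \<and> (\<exists>k. (f ^^ k) j \<in> A)}"
  have sub: "?J \<subseteq> (\<lambda>(l, y). (f ^^ l) y) ` ({..<n} \<times> A)"
  proof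
    fix j assume "j \<in> ?J"
    then obtain k where n: "least_power f j = n" and k: "(f ^^ k) j \<in> A" by auto
    obtain l where "l < n" "j = (f ^^ l) ((f ^^ k) j)"
      by (rule funpow_orbit_return[OF f refl, of j k]) (auto simp: n)
    then show "j \<in> (\<lambda>(l, y). (f ^^ l) y) ` ({..<n} \<times> A)"
      using k by (intro image_eqI[of _ _ "(l, (f ^^ k) j)"]) auto
  qed
  show "finite ?J" by (rule finite_subset[OF sub]) (use A in auto)
  have "card ?J \<le> card ((\<lambda>(l, y). (f ^^ l) y) ` ({..<n} \<times> A))"
    by (rule card_mono[OF _ sub]) (use A in auto)
  also have "\<dots> \<le> card ({..<n} \<times> A)" by (rule card_image_le) (use A in auto)
  finally show "card ?J \<le> n * card A" by (simp add: card_cartesian_product)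
qed

text \<open>The exceptional set: unless a cycle of \<open>s \<circ> p\<close> meets it, that cycle is obtained by gluing
  the cycles of \<open>p\<close> through the points of one cycle of \<open>s\<close>.\<close>

definition close_moved :: "('a \<Rightarrow> 'a) \<Rightarrow> ('a \<Rightarrow> 'a) \<Rightarrow> nat \<Rightarrow> 'a set" where
  "close_moved p s n = {z. s z \<noteq> z \<and> (\<exists>k\<in>{1..n}. s ((p ^^ k) z) \<noteq> (p ^^ k) z \<and> (p ^^ k) z \<noteq> z)}"

text \<open>A prediction for the period of \<open>y\<close> under \<open>s \<circ> p\<close>: it is
  right if the \<open>p\<close>-cycles through the \<open>s\<close>-cycle of \<open>y\<close> are
  distinct and carry no further moved point.\<close>

definition merged_length :: "('a \<Rightarrow> 'a) \<Rightarrow> ('a \<Rightarrow> 'a) \<Rightarrow> 'a \<Rightarrow> nat" where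
  "merged_length p s y = (\<Sum>k<least_power s y. least_power p ((s ^^ k) y))"

text \<open>A moved point is weighted by its own \<open>p\<close>-cycle only. All points of one
  \<open>s\<close>-cycle have the same merged length, and their weights add up to it, so a glued
  cycle is counted with exactly its \<open>n\<close> points.\<close>

abbreviation merged_size :: "('a \<Rightarrow> 'a) \<Rightarrow> ('a \<Rightarrow> 'a) \<Rightarrow> nat \<Rightarrow> nat" where
  "merged_size p s n \<equiv> \<Sum>y | s y \<noteq> y \<and> merged_length p s y = n. least_power p y"

lemma less_sum_decomp:
  fixes a :: "nat \<Rightarrow> nat"
  assumes "m < (\<Sum>k<i. a k)"
  obtains k l where "k < i" "l < a k" "m = (\<Sum>j<k. a j) + l"
proof -
  have "\<exists>k<i. \<exists>l<a k. m = (\<Sum>j<k. a j) + l" using assms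
  proof (induction i)
    case (Suc i)
    show ?case
    proof (cases "m < (\<Sum>k<i. a k)")
      case True
      then show ?thesis using Suc by (meson less_SucI)
    next
      case False
      then have "m - (\<Sum>k<i. a k) < a i" "m = (\<Sum>j<i. a j) + (m - (\<Sum>k<i. a k))"
        using Suc.prems by auto
      then show ?thesis by blast
    qed
  qed simp
  then show ?thesis using that by blast
qed

section \<open>Gluing of cycles when a permutation is multiplied from the left\<close>

locale two_permutations =
  fixes p s :: "'a \<Rightarrow> 'a"
  assumes p: "permutation p" and s: "permutation s"
begin

abbreviation "q \<equiv> s \<circ> p"

lemma q: "permutation q"
  using p s by (rule permutation_compose[rotated])

lemma s_inj: "s x = s y \<longleftrightarrow> x = y"
  using s by (meson injD bij_is_inj permutation_bijective)

lemma funpow_p_eq_q_iff_avoid: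
  assumes "(\<forall>k. s ((p ^^ k) j) = (p ^^ k) j) \<or> (\<forall>k. s ((q ^^ k) j) = (q ^^ k) j)"
  shows "(q ^^ k) j = (p ^^ k) j"
proof (induction k)
  case (Suc k)
  from assms show ?case
  proof
    assume "\<forall>k. s ((p ^^ k) j) = (p ^^ k) j"
    then have "s ((p ^^ Suc k) j) = (p ^^ Suc k) j" by blast
    then show ?thesis using Suc by simp
  next
    assume "\<forall>k. s ((q ^^ k) j) = (q ^^ k) j"
    then have "s ((q ^^ Suc k) j) = (q ^^ Suc k) j" by blast
    then have "s (p ((q ^^ k) j)) = p ((q ^^ k) j)" by (simp add: s_inj)
    then show ?thesis using Suc by simp
  qed
qed simp

lemma avoid_iff:
  "(\<forall>k. s ((p ^^ k) j) = (p ^^ k) j) \<longleftrightarrow> (\<forall>k. s ((q ^^ k) j) = (q ^^ k) j)"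
proof (intro iffI allI)
  fix k assume *: "\<forall>k. s ((p ^^ k) j) = (p ^^ k) j"
  then have "(q ^^ k) j = (p ^^ k) j" by (rule funpow_p_eq_q_iff_avoid[OF disjI1])
  with * show "s ((q ^^ k) j) = (q ^^ k) j" by (simp only:)
next
  fix k assume *: "\<forall>k. s ((q ^^ k) j) = (q ^^ k) j"
  then have "(q ^^ k) j = (p ^^ k) j" by (rule funpow_p_eq_q_iff_avoid[OF disjI2])
  with *[rule_format, of k] show "s ((p ^^ k) j) = (p ^^ k) j" by (simp only:)
qed

lemma avoid_least_power:
  assumes "\<forall>k. s ((p ^^ k) j) = (p ^^ k) j"
  shows "least_power q j = least_power p j"
  using funpow_p_eq_q_iff_avoid[of j] assms by (simp add: least_power_def)

text \<open>Outside \<open>close_moved\<close> no moved point other than \<open>y\<close> is met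
  within \<open>n\<close> steps of \<open>p\<close>, and the bound on the period makes these steps
  cover the whole cycle. So \<open>q\<close> follows \<open>p\<close> until \<open>p\<close> comes
  back to \<open>y\<close>, where \<open>s\<close> diverts the path to \<open>s y\<close>.\<close>

lemma segment:
  assumes y: "s y \<noteq> y" "y \<notin> close_moved p s n" and a: "least_power p y \<le> n"
  shows "l < least_power p y \<Longrightarrow> (q ^^ l) y = (p ^^ l) y"
    and "(q ^^ least_power p y) y = s y"
    and "0 < l \<Longrightarrow> l < least_power p y \<Longrightarrow> s ((p ^^ l) y) = (p ^^ l) y"
proof -
  show fixed: "s ((p ^^ l) y) = (p ^^ l) y" if "0 < l" "l < least_power p y" for l
  proof (rule ccontr)
    assume "s ((p ^^ l) y) \<noteq> (p ^^ l) y"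
    moreover have "(p ^^ l) y \<noteq> y"
      using that least_power_le[of l p y] by (metis not_less)
    moreover have "l \<in> {1..n}" using that a by simp
    ultimately show False using y unfolding close_moved_def by blast
  qed
  show *: "(q ^^ l) y = (p ^^ l) y" if "l < least_power p y" for l
    using that
  proof (induction l)
    case (Suc l)
    then show ?case using fixed[of "Suc l"] by simp
  qed simp
  obtain a' where a': "least_power p y = Suc a'"
    using least_power_of_permutation(2)[OF p, of y] by (cases "least_power p y") auto
  have "(q ^^ least_power p y) y = s ((p ^^ least_power p y) y)"
    using *[of a'] by (simp add: a')
  then show "(q ^^ least_power p y) y = s y"
    by (simp add: least_power_of_permutation(1)[OF p])
qed

lemma s_funpow_moved: "s y \<noteq> y \<Longrightarrow> s ((s ^^ k) y) \<noteq> (s ^^ k) y"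
  by (induction k) (auto simp: s_inj)

context
  fixes y n
  assumes y: "s y \<noteq> y"
    and good: "\<And>k. (s ^^ k) y \<notin> close_moved p s n"
    and short: "\<And>k. least_power p ((s ^^ k) y) \<le> n"
begin

text \<open>Segments are concatenated: each step of \<open>s\<close> costs one full turn around the
  current \<open>p\<close>-cycle. The assumptions of this context concern the \<open>s\<close>-orbit
  of \<open>y\<close>; assumptions on the \<open>q\<close>-orbit are reduced to them by
  \<open>q_orbit_contains_s_orbit\<close>.\<close>

lemma q_funpow_segments:
  "(q ^^ (\<Sum>j<k. least_power p ((s ^^ j) y))) y = (s ^^ k) y"
proof (induction k)
  case (Suc k)
  have "(q ^^ (\<Sum>j<Suc k. least_power p ((s ^^ j) y))) y =
      (q ^^ least_power p ((s ^^ k) y)) ((q ^^ (\<Sum>j<k. least_power p ((s ^^ j) y))) y)"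
    by (subst funpow_add_apply [symmetric]) (simp add: add.commute)
  also have "\<dots> = s ((s ^^ k) y)"
    unfolding Suc by (rule segment[OF s_funpow_moved[OF y] good short])
  finally show ?case by (simp only: funpow.simps comp_apply [of s "s ^^ k"])
qed simp

lemma q_funpow_segments_add:
  assumes "l < least_power p ((s ^^ k) y)"
  shows "(q ^^ ((\<Sum>j<k. least_power p ((s ^^ j) y)) + l)) y = (p ^^ l) ((s ^^ k) y)"
proof -
  have "(q ^^ ((\<Sum>j<k. least_power p ((s ^^ j) y)) + l)) y =
     (q ^^ l) ((q ^^ (\<Sum>j<k. least_power p ((s ^^ j) y))) y)"
    by (subst funpow_add_apply [symmetric]) (simp only: add.commute)
  then show ?thesis
    unfolding q_funpow_segments
    using segment(1)[OF s_funpow_moved[OF y] good short assms] by simp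
qed

lemma least_power_q_eq_merged_length: "least_power q y = merged_length p s y"
  unfolding merged_length_def
proof (rule least_power_eqI)
  show "(q ^^ (\<Sum>k<least_power s y. least_power p ((s ^^ k) y))) y = y"
    unfolding q_funpow_segments by (rule least_power_of_permutation(1)[OF s])
  have "0 < least_power s y" by (rule least_power_of_permutation(2)[OF s])
  then show "0 < (\<Sum>k<least_power s y. least_power p ((s ^^ k) y))"
    by (intro sum_pos) (auto simp: least_power_of_permutation(2)[OF p] lessThan_empty_iff)
next
  fix m assume m: "0 < m" "m < (\<Sum>k<least_power s y. least_power p ((s ^^ k) y))"
  from m(2) obtain k l where k: "k < least_power s y" and l: "l < least_power p ((s ^^ k) y)"
    and meq: "m = (\<Sum>j<k. least_power p ((s ^^ j) y)) + l"
    by (rule less_sum_decomp)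
  have qm: "(q ^^ m) y = (p ^^ l) ((s ^^ k) y)"
    unfolding meq by (rule q_funpow_segments_add[OF l])
  \<comment> \<open>At the start of a block the path sits at another point of the
    \<open>s\<close>-cycle, since \<open>k\<close> is below its length; inside a block it sits at a
    point fixed by \<open>s\<close>, while \<open>y\<close> is moved.\<close>
  show "(q ^^ m) y \<noteq> y"
  proof (cases "l = 0")
    case True
    then have "k \<noteq> 0" using m meq by (intro notI) simp
    then have "(s ^^ k) y \<noteq> y" using k least_power_le[of k s y] by (metis neq0_conv not_less)
    then show ?thesis using qm True by simp
  next
    case False
    then have "s ((q ^^ m) y) = (q ^^ m) y"
      unfolding qm using segment(3)[OF s_funpow_moved[OF y] good short _ l] by simp
    then show ?thesis using y by metis
  qed
qed

lemma q_orbit_decomp: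
  obtains k l where "l < least_power p ((s ^^ k) y)" "(q ^^ m) y = (p ^^ l) ((s ^^ k) y)"
proof -
  have "m mod least_power q y < merged_length p s y"
    using least_power_of_permutation(2)[OF q, of y] by (simp flip: least_power_q_eq_merged_length)
  then obtain k l where kl: "l < least_power p ((s ^^ k) y)"
    "m mod least_power q y = (\<Sum>j<k. least_power p ((s ^^ j) y)) + l"
    unfolding merged_length_def by (rule less_sum_decomp)
  have "(q ^^ m) y = (q ^^ (m mod least_power q y)) y"
    by (rule funpow_mod_least_power[OF q, symmetric])
  also have "\<dots> = (p ^^ l) ((s ^^ k) y)"
    unfolding kl(2) by (rule q_funpow_segments_add[OF kl(1)])
  finally show ?thesis using that kl(1) by blast
qed

end

text \<open>If \<open>s\<close> fixed the first \<open>n\<close> iterates under \<open>p\<close>,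
  then \<open>q\<close> and \<open>p\<close> would agree that far and the \<open>n\<close>-th
  iterate would be the moved point \<open>z\<close>. So some iterate up to \<open>n\<close> is
  moved, and outside \<open>close_moved\<close> it can only be \<open>z\<close> itself.\<close>

lemma q_orbit_short:
  assumes z: "s z \<noteq> z" "z \<notin> close_moved p s n" and n: "least_power q z = n"
  shows "least_power p z \<le> n"
proof -
  have "\<exists>k\<in>{1..n}. s ((p ^^ k) z) \<noteq> (p ^^ k) z"
  proof (rule ccontr)
    assume *: "\<not> ?thesis"
    have "(q ^^ k) z = (p ^^ k) z" if "k \<le> n" for k
      using that
    proof (induction k)
      case (Suc k)
      then have "s ((p ^^ Suc k) z) = (p ^^ Suc k) z"
        using * by (auto simp del: funpow.simps)
      moreover have "(q ^^ k) z = (p ^^ k) z" by (rule Suc.IH) (use Suc.prems in simp)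
      moreover have "(q ^^ Suc k) z = s (p ((q ^^ k) z))" by simp
      ultimately show ?case by (simp only: funpow.simps comp_apply [of p "p ^^ k"])
    qed simp
    from this[of n] have "(p ^^ n) z = z" using least_power_of_permutation(1)[OF q, of z] n by simp
    moreover have "1 \<le> n" using least_power_of_permutation(2)[OF q, of z] n by simp
    moreover from this have "s ((p ^^ n) z) = (p ^^ n) z" using * by auto
    ultimately show False using z by simp
  qed
  then obtain k where k: "k \<in> {1..n}" "s ((p ^^ k) z) \<noteq> (p ^^ k) z" by blast
  then have "(p ^^ k) z = z" using z unfolding close_moved_def by blast
  then have "least_power p z \<le> k" using k by (intro least_power_le) auto
  then show ?thesis using k by simp
qed

text \<open>A short \<open>p\<close>-cycle at one point of the \<open>s\<close>-orbit lets
  \<open>segment\<close> carry the \<open>q\<close>-path to the next one; that point has the same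
  \<open>q\<close>-period and is again outside \<open>close_moved\<close>, so
  \<open>q_orbit_short\<close> applies to it. The induction therefore needs both conjuncts
  together.\<close>

lemma q_orbit_contains_s_orbit:
  assumes y: "s y \<noteq> y" and n: "least_power q y = n" and good: "\<And>k. (q ^^ k) y \<notin> close_moved p s n"
  shows "(\<exists>m. (s ^^ k) y = (q ^^ m) y) \<and> least_power p ((s ^^ k) y) \<le> n"
proof (induction k)
  case 0
  have "y \<notin> close_moved p s n" using good[of 0] by simp
  from q_orbit_short[OF y this n]
  have "least_power p y \<le> n" .
  moreover have "\<exists>m. y = (q ^^ m) y" by (rule exI[of _ 0]) simp
  ultimately show ?case by (simp only: funpow_0 simp_thms)
next
  case (Suc k)
  then obtain m where m: "(s ^^ k) y = (q ^^ m) y" and sh: "least_power p ((s ^^ k) y) \<le> n" by blast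
  have "(s ^^ k) y \<notin> close_moved p s n" using good m by metis
  from segment(2)[OF s_funpow_moved[OF y] this sh]
  have "(s ^^ Suc k) y = (q ^^ (least_power p ((s ^^ k) y))) ((q ^^ m) y)"
    by (simp only: m [symmetric] funpow.simps comp_apply)
  then have m': "(s ^^ Suc k) y = (q ^^ (least_power p ((s ^^ k) y) + m)) y"
    by (simp only: funpow_add_apply)
  have "least_power p ((s ^^ Suc k) y) \<le> n"
    by (rule q_orbit_short[OF s_funpow_moved[OF y]])
       (simp_all only: m' good least_power_funpow[OF q] n not_False_eq_True)
  then show ?case using m' by blast
qed

end

lemma permutes_funpow_in:
  assumes "s permutes U" "z \<in> U" shows "(s ^^ k) z \<in> U"
  using assms by (metis permutes_in_funpow_image imageI permutes_funpow permutes_in_image)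

context two_permutations
begin

lemma moved_in_p_cycle_unique:
  assumes y: "s y \<noteq> y" "y \<notin> close_moved p s n" and a: "least_power p y \<le> n"
    and y': "s y' \<noteq> y'" and eq: "(p ^^ l) y = (p ^^ l') y'"
  shows "y' = y"
proof -
  obtain r where "y' = (p ^^ r) ((p ^^ l') y')"
    by (rule funpow_orbit_return[OF p refl])
  then have "y' = (p ^^ (r + l)) y" by (simp only: eq [symmetric] funpow_add_apply)
  then have "y' = (p ^^ ((r + l) mod least_power p y)) y"
    by (simp only: funpow_mod_least_power[OF p])
  moreover define k where "k = (r + l) mod least_power p y"
  ultimately have k: "y' = (p ^^ k) y" by simp
  have "k < least_power p y"
    unfolding k_def by (rule mod_less_divisor) (rule least_power_of_permutation(2)[OF p])
  with k y' show ?thesis using segment(3)[OF y a, of k] by (cases "k = 0") auto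
qed

lemma finite_moved: "finite {y. s y \<noteq> y}"
  using s by (simp add: permutation)

lemma finite_close_moved: "finite (close_moved p s n)"
  by (rule finite_subset[OF _ finite_moved]) (auto simp: close_moved_def)

lemma merged_length_bounds:
  assumes "merged_length p s y = n"
  shows "least_power s y \<le> n" and "least_power p ((s ^^ k) y) \<le> n"
proof -
  have "(\<Sum>k<least_power s y. 1) \<le> merged_length p s y"
    unfolding merged_length_def using least_power_of_permutation(2)[OF p]
    by (intro sum_mono) (simp add: Suc_le_eq)
  then show "least_power s y \<le> n" using assms by simp
  have "least_power p ((s ^^ (k mod least_power s y)) y) \<le> merged_length p s y"
    unfolding merged_length_def using least_power_of_permutation(2)[OF s, of y]
    by (intro member_le_sum) auto
  then show "least_power p ((s ^^ k) y) \<le> n"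
    using assms by (simp add: funpow_mod_least_power[OF s])
qed

text \<open>The moved points at which the prediction \<open>merged_length\<close> is reliable and
  equals \<open>n\<close>; for this the whole \<open>s\<close>-cycle has to avoid
  \<open>close_moved\<close>.\<close>

definition "good_moved n = {y. s y \<noteq> y \<and> merged_length p s y = n \<and> (\<forall>k. (s ^^ k) y \<notin> close_moved p s n)}"

text \<open>A point of a glued cycle lies on the \<open>p\<close>-cycle of exactly one moved point
  \<open>y\<close>, at a unique distance \<open>l\<close> below the period, so the pairs
  \<open>(y, l)\<close> parametrise these points.\<close>

lemma card_merged_orbits:
  "card {j. least_power q j = n \<and> (\<exists>k. s ((q ^^ k) j) \<noteq> (q ^^ k) j) \<and> (\<forall>k. (q ^^ k) j \<notin> close_moved p s n)}
   = (\<Sum>y\<in>good_moved n. least_power p y)" (is "card ?Q = _")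
proof -
  let ?I = "SIGMA y:good_moved n. {..<least_power p y}"
  have fin: "finite (good_moved n)"
    by (rule finite_subset[OF _ finite_moved]) (auto simp: good_moved_def)
  have gm: "s y \<noteq> y" "\<And>k. (s ^^ k) y \<notin> close_moved p s n" "merged_length p s y = n"
    "\<And>k. least_power p ((s ^^ k) y) \<le> n" "y \<notin> close_moved p s n" "least_power p y \<le> n"
    if "y \<in> good_moved n" for y
  proof -
    show g: "s y \<noteq> y" "\<And>k. (s ^^ k) y \<notin> close_moved p s n" "merged_length p s y = n"
      using that unfolding good_moved_def by blast+
    show "\<And>k. least_power p ((s ^^ k) y) \<le> n"
      using merged_length_bounds(2)[OF g(3)] by blast
    from this[of 0] show "least_power p y \<le> n" by simp
    show "y \<notin> close_moved p s n" using g(2)[of 0] by simp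
  qed
  have "bij_betw (\<lambda>(y, l). (p ^^ l) y) ?I ?Q"
    unfolding bij_betw_def
  proof
    show "inj_on (\<lambda>(y, l). (p ^^ l) y) ?I"
    proof (rule inj_onI, clarsimp)
      fix y l y' l'
      assume *: "y \<in> good_moved n" "l < least_power p y" "y' \<in> good_moved n" "l' < least_power p y'"
        and eq: "(p ^^ l) y = (p ^^ l') y'"
      have yy: "y' = y"
        by (rule moved_in_p_cycle_unique[OF gm(1,5,6)[OF *(1)] gm(1)[OF *(3)] eq])
      have "(p ^^ l) y = (p ^^ l') y" using eq yy by simp
      moreover have "inj_on (\<lambda>i. (p ^^ i) y) {..<least_power p y}"
        by (rule inj_on_funpow_orbit[OF p])
      ultimately show "y = y' \<and> l = l'" using * yy by (auto dest: inj_onD)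
    qed
    show "(\<lambda>(y, l). (p ^^ l) y) ` ?I = ?Q"
    proof (intro equalityI subsetI)
      fix j assume "j \<in> (\<lambda>(y, l). (p ^^ l) y) ` ?I"
      then obtain y l where y: "y \<in> good_moved n" and l: "l < least_power p y" and j: "j = (p ^^ l) y"
        by auto
      note g = gm[OF y]
      have j': "j = (q ^^ l) y" unfolding j by (rule segment(1)[OF g(1,5,6) l, symmetric])
      have pn: "least_power q j = n"
        unfolding j' least_power_funpow[OF q] using least_power_q_eq_merged_length[OF g(1,2,4)] g(3) by simp
      obtain r where r: "y = (q ^^ r) j" by (rule funpow_orbit_return[OF q j'])
      \<comment> \<open>Points of the glued cycle are either points of the \<open>s\<close>-cycle,
        which are good, or fixed by \<open>s\<close> and therefore never in
        \<open>close_moved\<close>.\<close>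
      have good: "(q ^^ k) j \<notin> close_moved p s n" for k
      proof -
        obtain a b where ab: "b < least_power p ((s ^^ a) y)"
          "(q ^^ (k + l)) y = (p ^^ b) ((s ^^ a) y)"
          by (rule q_orbit_decomp[OF g(1,2,4)])
        have sa: "s ((s ^^ a) y) \<noteq> (s ^^ a) y" by (rule s_funpow_moved[OF g(1)])
        have "(p ^^ b) ((s ^^ a) y) \<notin> close_moved p s n"
        proof (cases "b = 0")
          case True then show ?thesis using g(2) by simp
        next
          case False
          then have "s ((p ^^ b) ((s ^^ a) y)) = (p ^^ b) ((s ^^ a) y)"
            using segment(3)[OF sa g(2,4) _ ab(1)] by simp
          then show ?thesis unfolding close_moved_def by simp
        qed
        then show ?thesis unfolding j' ab(2) [symmetric] funpow_add_apply .
      qed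
      have "s ((q ^^ r) j) \<noteq> (q ^^ r) j"
        unfolding r [symmetric] by (rule g(1))
      with pn good show "j \<in> ?Q" by blast
    next
      fix j assume j: "j \<in> ?Q"
      then obtain k where k: "s ((q ^^ k) j) \<noteq> (q ^^ k) j" by blast
      have pn: "least_power q j = n" and good: "\<And>k. (q ^^ k) j \<notin> close_moved p s n" using j by blast+
      define y where "y = (q ^^ k) j"
      have y: "s y \<noteq> y" using k by (simp only: y_def not_False_eq_True)
      have py: "least_power q y = n" unfolding y_def least_power_funpow[OF q] by (rule pn)
      have gy: "(q ^^ m) y \<notin> close_moved p s n" for m
        unfolding y_def funpow_add_apply [symmetric] by (rule good)
      have so: "(\<exists>m. (s ^^ k) y = (q ^^ m) y) \<and> least_power p ((s ^^ k) y) \<le> n" for k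
        by (rule q_orbit_contains_s_orbit[OF y py gy])
      have gs: "(s ^^ k) y \<notin> close_moved p s n" for k
      proof -
        from so[of k] obtain m where "(s ^^ k) y = (q ^^ m) y" by blast
        then show ?thesis by (simp only: gy not_False_eq_True)
      qed
      have sh: "least_power p ((s ^^ k) y) \<le> n" for k using so by blast
      have ml: "merged_length p s y = n" using least_power_q_eq_merged_length[OF y gs sh] py by simp
      obtain r where r: "j = (q ^^ r) y" by (rule funpow_orbit_return[OF q y_def])
      obtain a b where ab: "b < least_power p ((s ^^ a) y)" "(q ^^ r) y = (p ^^ b) ((s ^^ a) y)"
        by (rule q_orbit_decomp[OF y gs sh])
      \<comment> \<open>The base point for \<open>j\<close> is the point of the
        \<open>s\<close>-cycle whose \<open>p\<close>-cycle contains \<open>j\<close>, in general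
        not \<open>y\<close>.\<close>
      have "(s ^^ a) y \<in> good_moved n"
      proof -
        from so[of a] obtain m where m: "(s ^^ a) y = (q ^^ m) y" by blast
        have "least_power q ((s ^^ a) y) = merged_length p s ((s ^^ a) y)"
          by (rule least_power_q_eq_merged_length[OF s_funpow_moved[OF y], of _ n])
             (simp_all only: funpow_add_apply [symmetric] gs sh not_False_eq_True)
        moreover have "least_power q ((s ^^ a) y) = n"
          unfolding m least_power_funpow[OF q] by (rule py)
        ultimately have "merged_length p s ((s ^^ a) y) = n" by simp
        then show ?thesis
          unfolding good_moved_def using s_funpow_moved[OF y] gs
          by (simp add: funpow_add_apply [symmetric])
      qed
      then show "j \<in> (\<lambda>(y, l). (p ^^ l) y) ` ?I"
        using ab r by (intro image_eqI[of _ _ "((s ^^ a) y, b)"]) auto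
    qed
  qed
  then have "card ?Q = card ?I" by (rule bij_betw_same_card [symmetric])
  also have "\<dots> = (\<Sum>y\<in>good_moved n. least_power p y)" using fin by (subst card_SigmaI) auto
  finally show ?thesis .
qed

text \<open>A counted \<open>y\<close> that is not good has a point of \<open>close_moved\<close> on
  its \<open>s\<close>-cycle. That cycle has length at most \<open>n\<close>, so there are at most
  \<open>n * card (close_moved p s n)\<close> such \<open>y\<close>, each of weight at most
  \<open>n\<close>.\<close>

lemma merged_moved_bound:
  "(\<Sum>y\<in>good_moved n. least_power p y) \<le> (merged_size p s n)"
  "(merged_size p s n)
     \<le> (\<Sum>y\<in>good_moved n. least_power p y) + n * (n * card (close_moved p s n))"
proof -
  let ?Y = "{y. s y \<noteq> y \<and> merged_length p s y = n}"
  have finY: "finite ?Y" by (rule finite_subset[OF _ finite_moved]) auto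
  have sub: "good_moved n \<subseteq> ?Y" by (auto simp: good_moved_def)
  show "(\<Sum>y\<in>good_moved n. least_power p y) \<le> (\<Sum>y\<in>?Y. least_power p y)"
    by (rule sum_mono2[OF finY sub]) simp
  let ?D = "?Y - good_moved n"
  have D: "?D \<subseteq> (\<lambda>(m, z). (s ^^ m) z) ` ({..<n} \<times> close_moved p s n)"
  proof
    fix y assume y: "y \<in> ?D"
    then obtain k where k: "(s ^^ k) y \<in> close_moved p s n" unfolding good_moved_def by blast
    have "merged_length p s y = n" using y by blast
    then have le: "least_power s y \<le> n" by (rule merged_length_bounds)
    obtain l where l: "l < least_power s y" "y = (s ^^ l) ((s ^^ k) y)"
      by (rule funpow_orbit_return[OF s refl])
    then have "l < n" using le by simp
    then show "y \<in> (\<lambda>(m, z). (s ^^ m) z) ` ({..<n} \<times> close_moved p s n)"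
      using l k by (intro image_eqI[of _ _ "(l, (s ^^ k) y)"]) auto
  qed
  have "card ?D \<le> card ({..<n} \<times> close_moved p s n)"
    by (rule surj_card_le[OF _ D]) (simp add: finite_close_moved)
  then have cD: "card ?D \<le> n * card (close_moved p s n)" by (simp add: card_cartesian_product)
  have "(\<Sum>y\<in>?Y. least_power p y) = (\<Sum>y\<in>good_moved n. least_power p y) + (\<Sum>y\<in>?D. least_power p y)"
    using sum.subset_diff[OF sub finY, of "least_power p"] by simp
  moreover have "(\<Sum>y\<in>?D. least_power p y) \<le> (\<Sum>y\<in>?D. n)"
  proof (rule sum_mono)
    fix y assume "y \<in> ?D"
    then have "merged_length p s y = n" by blast
    from merged_length_bounds(2)[OF this, of 0] show "least_power p y \<le> n" by simp
  qed
  moreover have "(\<Sum>y\<in>?D. n) \<le> n * (n * card (close_moved p s n))" using cD by simp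
  ultimately show "(\<Sum>y\<in>?Y. least_power p y) \<le> (\<Sum>y\<in>good_moved n. least_power p y) + n * (n * card (close_moved p s n))"
    by linarith
qed

text \<open>A \<open>p\<close>-cycle of length \<open>n\<close> that is hit loses its
  \<open>n\<close> points once, whereas the product counts it once for each of its moved points. If
  there are several of these, all lie in \<open>close_moved\<close>; the remaining moved points sit
  on distinct cycles.\<close>

lemma card_lost:
  fixes n
  defines "P1 \<equiv> {j. least_power p j = n \<and> (\<exists>k. s ((p ^^ k) j) \<noteq> (p ^^ k) j)}"
  shows "card P1 \<le> n * card {y. s y \<noteq> y \<and> least_power p y = n}"
    and "n * card {y. s y \<noteq> y \<and> least_power p y = n} \<le> card P1 + n * card (close_moved p s n)"
proof -
  let ?Y = "{y. s y \<noteq> y \<and> least_power p y = n}"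
  have finY: "finite ?Y" by (rule finite_subset[OF _ finite_moved]) auto
  have P1: "P1 = {j. least_power p j = n \<and> (\<exists>k. (p ^^ k) j \<in> ?Y)}"
    unfolding P1_def by (auto simp: least_power_funpow[OF p])
  have finP1: "finite P1" unfolding P1 by (rule card_orbits_meeting_le[OF p finY])
  show "card P1 \<le> n * card ?Y"
    unfolding P1 by (rule card_orbits_meeting_le[OF p finY])
  let ?G = "?Y - close_moved p s n"
  have cG: "card ((\<lambda>(y, l). (p ^^ l) y) ` (?G \<times> {..<n})) = card (?G \<times> {..<n})"
  proof (rule card_image, rule inj_onI, clarsimp)
    fix y l y' l'
    assume y: "y \<notin> close_moved p s (least_power p y)" "s y \<noteq> y" "n = least_power p y"
      and y': "y' \<notin> close_moved p s (least_power p y)" "s y' \<noteq> y'" "least_power p y' = least_power p y"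
      and l: "l < least_power p y" "l' < least_power p y"
      and eq: "(p ^^ l) y = (p ^^ l') y'"
    have yy: "y' = y" by (rule moved_in_p_cycle_unique[OF y(2,1) order_refl y'(2) eq])
    have "l = l'" using inj_onD[OF inj_on_funpow_orbit[OF p], of l y l'] l eq yy by simp
    with yy show "y = y' \<and> l = l'" by simp
  qed
  have "(\<lambda>(y, l). (p ^^ l) y) ` (?G \<times> {..<n}) \<subseteq> P1"
  proof clarsimp
    fix y l assume y: "s y \<noteq> y" "n = least_power p y"
    obtain r where "y = (p ^^ r) ((p ^^ l) y)" by (rule funpow_orbit_return[OF p refl])
    then have "s ((p ^^ r) ((p ^^ l) y)) \<noteq> (p ^^ r) ((p ^^ l) y)" using y(1) by simp
    then have "\<exists>k. s ((p ^^ k) ((p ^^ l) y)) \<noteq> (p ^^ k) ((p ^^ l) y)" by (rule exI)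
    then show "(p ^^ l) y \<in> P1" unfolding P1_def using y(2)
      by (simp only: mem_Collect_eq least_power_funpow[OF p] simp_thms)
  qed
  from card_mono[OF finP1 this] have "n * card ?G \<le> card P1"
    unfolding cG by (simp add: card_cartesian_product mult.commute)
  moreover have "card ?Y \<le> card ?G + card (close_moved p s n)"
    using diff_card_le_card_Diff[OF finite_close_moved[of n], of ?Y] by linarith
  then have "n * card ?Y \<le> n * card ?G + n * card (close_moved p s n)"
    unfolding distrib_left [symmetric] by (rule mult_le_mono2)
  ultimately show "n * card ?Y \<le> card P1 + n * card (close_moved p s n)" by linarith
qed

text \<open>Points of period \<open>n\<close> whose cycle \<open>s\<close> does not touch are the
  same for \<open>p\<close> and \<open>q\<close> and cancel. What remains is gained by gluing or
  lost by being hit; three comparisons are each off by at most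
  \<open>n ^ 2 * card (close_moved p s n)\<close>, whence the constant. The second, crude bound
  serves the quadratic fluctuations.\<close>

lemma period_count_change:
  assumes U: "finite U" "p permutes U" "s permutes U"
  shows "\<bar>(real (card {j\<in>U. least_power q j = n}) - real (card {j\<in>U. least_power p j = n}))
       - (real (merged_size p s n)
          - real (n * card {y. s y \<noteq> y \<and> least_power p y = n}))\<bar>
     \<le> real (3 * n ^ 2 * card (close_moved p s n))"
    and "\<bar>real (card {j\<in>U. least_power q j = n}) - real (card {j\<in>U. least_power p j = n})\<bar>
     \<le> real (n * card {y. s y \<noteq> y})"
proof -
  let ?B = "close_moved p s n"
  define Q where "Q = {j\<in>U. least_power q j = n}"
  define P where "P = {j\<in>U. least_power p j = n}"
  define P0 where "P0 = {j\<in>P. \<forall>k. s ((p ^^ k) j) = (p ^^ k) j}"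
  define P1 where "P1 = {j. least_power p j = n \<and> (\<exists>k. s ((p ^^ k) j) \<noteq> (p ^^ k) j)}"
  define Q' where "Q' = {j. least_power q j = n \<and> (\<exists>k. s ((q ^^ k) j) \<noteq> (q ^^ k) j)}"
  define Q1 where "Q1 = {j. least_power q j = n \<and> (\<exists>k. s ((q ^^ k) j) \<noteq> (q ^^ k) j) \<and> (\<forall>k. (q ^^ k) j \<notin> ?B)}"
  have inU: "j \<in> U" if "f permutes U" "(f ^^ k) j \<in> U" for f k j
    using that by (metis permutes_funpow permutes_in_image)
  have qU: "q permutes U" using U by (intro permutes_compose)
  have sU: "y \<in> U" if "s y \<noteq> y" for y using that U by (auto simp: permutes_def)
  have PU: "P1 \<subseteq> U"
  proof
    fix j assume "j \<in> P1"
    then obtain k where "s ((p ^^ k) j) \<noteq> (p ^^ k) j" unfolding P1_def by blast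
    then show "j \<in> U" using inU[OF U(2)] sU by blast
  qed
  have QU: "Q' \<subseteq> U"
  proof
    fix j assume "j \<in> Q'"
    then obtain k where "s ((q ^^ k) j) \<noteq> (q ^^ k) j" unfolding Q'_def by blast
    then show "j \<in> U" using inU[OF qU] sU by blast
  qed
  have fin: "finite P0" "finite P1" "finite Q'"
    using U PU QU by (auto simp: P0_def P_def finite_subset)
  have cP: "card P = card P0 + card P1"
  proof -
    have "P = P0 \<union> P1" using PU by (auto simp: P0_def P1_def P_def)
    moreover have "P0 \<inter> P1 = {}" by (auto simp: P0_def P1_def)
    ultimately show ?thesis using fin by (simp add: card_Un_disjoint)
  qed
  have cQ: "card Q = card P0 + card Q'"
  proof -
    have "P0 = {j\<in>Q. \<forall>k. s ((q ^^ k) j) = (q ^^ k) j}"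
      unfolding P0_def P_def Q_def using avoid_iff avoid_least_power by auto
    then have "Q = P0 \<union> Q'" "P0 \<inter> Q' = {}" using QU by (auto simp: Q'_def Q_def)
    then show ?thesis using fin by (simp add: card_Un_disjoint)
  qed
  have Q1: "Q1 \<subseteq> Q'" by (auto simp: Q1_def Q'_def)
  have "Q' - Q1 \<subseteq> {j. least_power q j = n \<and> (\<exists>k. (q ^^ k) j \<in> ?B)}"
    unfolding Q1_def Q'_def by blast
  then have "card (Q' - Q1) \<le> card {j. least_power q j = n \<and> (\<exists>k. (q ^^ k) j \<in> ?B)}"
    by (intro card_mono card_orbits_meeting_le[OF q finite_close_moved])
  also have "\<dots> \<le> n * card ?B"
    by (rule card_orbits_meeting_le[OF q finite_close_moved])
  finally have cQ1: "card Q' \<le> card Q1 + n * card ?B" "card Q1 \<le> card Q'"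
    using card_mono[OF fin(3) Q1] card_Diff_subset[OF finite_subset[OF Q1 fin(3)] Q1] by auto
  have nn: "n * card ?B \<le> n ^ 2 * card ?B" by (simp add: power2_eq_square)
  have "card Q1 = (\<Sum>y\<in>good_moved n. least_power p y)"
    unfolding Q1_def by (rule card_merged_orbits)
  then have c1: "card Q' \<le> (\<Sum>y\<in>good_moved n. least_power p y) + n * card ?B"
    "(\<Sum>y\<in>good_moved n. least_power p y) \<le> card Q'"
    using cQ1 by simp_all
  define G where "G = (\<Sum>y\<in>good_moved n. least_power p y)"
  define M where "M = (merged_size p s n)"
  define L where "L = n * card {y. s y \<noteq> y \<and> least_power p y = n}"
  define b where "b = n * card ?B"
  define d where "d = n ^ 2 * card ?B"
  have d: "n * (n * card ?B) = d" "3 * n ^ 2 * card ?B = 3 * d"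
    by (simp_all add: d_def power2_eq_square)
  have "\<bar>(real (card Q) - real (card P)) - (real M - real L)\<bar> \<le> real (3 * d)"
    using cP cQ c1[folded G_def b_def] merged_moved_bound[of n, unfolded d, folded G_def M_def]
      card_lost[of n, folded P1_def L_def b_def] nn[folded b_def d_def]
    by linarith
  then show "\<bar>(real (card Q) - real (card P))
       - (real (merged_size p s n)
          - real (n * card {y. s y \<noteq> y \<and> least_power p y = n}))\<bar>
     \<le> real (3 * n ^ 2 * card (close_moved p s n))"
    unfolding d M_def L_def .
  define L2 where "L2 = n * card {y. s y \<noteq> y}"
  have "card Q' \<le> L2"
    using card_orbits_meeting_le(2)[OF q finite_moved, of n] by (simp only: Q'_def L2_def mem_Collect_eq)
  moreover have "card P1 \<le> L2"
    using card_orbits_meeting_le(2)[OF p finite_moved, of n] by (simp only: P1_def L2_def mem_Collect_eq)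
  ultimately show "\<bar>real (card Q) - real (card P)\<bar> \<le> real (n * card {y. s y \<noteq> y})"
    using cP cQ unfolding L2_def [symmetric] by linarith
qed

end

section \<open>Averages over a conjugacy class\<close>

definition avg :: "'a set \<Rightarrow> ('a \<Rightarrow> real) \<Rightarrow> real" where
  "avg A f = (\<Sum>a\<in>A. f a) / real (card A)"

lemma avg_cong: "(\<And>a. a \<in> A \<Longrightarrow> f a = g a) \<Longrightarrow> avg A f = avg A g"
  by (simp add: avg_def)

lemma avg_sum: "avg A (\<lambda>a. \<Sum>i\<in>I. f i a) = (\<Sum>i\<in>I. avg A (f i))"
  unfolding avg_def by (subst sum.swap) (simp add: sum_divide_distrib)

lemma avg_cmult: "avg A (\<lambda>a. c * f a) = c * avg A f"
  by (simp add: avg_def sum_distrib_left [symmetric])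

lemma avg_add: "avg A (\<lambda>a. f a + g a) = avg A f + avg A g"
  by (simp add: avg_def sum.distrib add_divide_distrib)

lemma avg_diff: "avg A (\<lambda>a. f a - g a) = avg A f - avg A g"
  by (simp add: avg_def sum_subtractf diff_divide_distrib)

lemma avg_const: "finite A \<Longrightarrow> A \<noteq> {} \<Longrightarrow> avg A (\<lambda>_. c) = c"
  by (simp add: avg_def)

lemma avg_mono: "(\<And>a. a \<in> A \<Longrightarrow> f a \<le> g a) \<Longrightarrow> avg A f \<le> avg A g"
  by (simp add: avg_def divide_right_mono sum_mono)

lemma avg_nonneg: "(\<And>a. a \<in> A \<Longrightarrow> 0 \<le> f a) \<Longrightarrow> 0 \<le> avg A f"
  by (simp add: avg_def sum_nonneg)

lemma avg_abs_diff_le: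
  assumes "finite A" "A \<noteq> {}" "\<And>a. a \<in> A \<Longrightarrow> \<bar>f a - c\<bar> \<le> e"
  shows "\<bar>avg A f - c\<bar> \<le> e"
proof -
  have "avg A f \<le> avg A (\<lambda>_. c + e)" by (rule avg_mono) (use assms(3) in \<open>force simp: abs_le_iff\<close>)
  moreover have "avg A (\<lambda>_. c - e) \<le> avg A f" by (rule avg_mono) (use assms(3) in \<open>force simp: abs_le_iff\<close>)
  ultimately show ?thesis using assms(1,2) by (simp add: avg_const abs_le_iff)
qed

lemma avg_reindex: "bij_betw g A B \<Longrightarrow> avg A (\<lambda>a. f (g a)) = avg B f"
  unfolding avg_def by (simp add: sum.reindex_bij_betw bij_betw_same_card)

lemma avg_swap: "avg A (\<lambda>a. avg B (f a)) = avg B (\<lambda>b. avg A (\<lambda>a. f a b))"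
  unfolding avg_def by (simp add: sum_divide_distrib [symmetric]) (subst sum.swap, simp)

section \<open>Uniform random relabellings of a finite set\<close>

definition perms_of :: "'a set \<Rightarrow> ('a \<Rightarrow> 'a) set" where
  "perms_of U = {h. h permutes U}"

lemma perms_of_finite: "finite U \<Longrightarrow> finite (perms_of U)"
  by (simp add: perms_of_def finite_permutations)

lemma perms_of_nonempty: "perms_of U \<noteq> {}"
  unfolding perms_of_def by (blast intro: permutes_id)

text \<open>Exchangeability: composing with a transposition on the right is a bijection of the
  group, so two labels may be swapped under the average.\<close>

lemma avg_perms_transpose:
  assumes "a \<in> U" "b \<in> U"
  shows "avg (perms_of U) (\<lambda>h. F (h \<circ> Transposition.transpose a b)) = avg (perms_of U) F"
proof (rule avg_reindex)
  have t: "Transposition.transpose a b permutes U" by (rule permutes_swap_id) (use assms in auto)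
  show "bij_betw (\<lambda>h. h \<circ> Transposition.transpose a b) (perms_of U) (perms_of U)"
    by (rule bij_betw_byWitness[where f' = "\<lambda>h. h \<circ> Transposition.transpose a b"])
       (auto simp: perms_of_def comp_assoc intro!: permutes_compose[OF t])
qed

text \<open>By exchangeability the average is the same for every point of \<open>U\<close>, and the
  sum of \<open>f (h a)\<close> over all \<open>a\<close> does not depend on
  \<open>h\<close>.\<close>

lemma avg_perms_eval:
  assumes U: "finite U" "x \<in> U"
  shows "avg (perms_of U) (\<lambda>h. f (h x)) = avg U f"
proof -
  have eq: "avg (perms_of U) (\<lambda>h. f (h a)) = avg (perms_of U) (\<lambda>h. f (h x))" if "a \<in> U" for a
    using avg_perms_transpose[OF U(2) that, of "\<lambda>h. f (h x)"] by simp
  have "real (card U) * avg (perms_of U) (\<lambda>h. f (h x)) = (\<Sum>a\<in>U. avg (perms_of U) (\<lambda>h. f (h a)))"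
    by (subst sum.cong[OF refl eq]) simp_all
  also have "\<dots> = avg (perms_of U) (\<lambda>h. \<Sum>a\<in>U. f (h a))"
    by (simp add: avg_sum)
  also have "\<dots> = avg (perms_of U) (\<lambda>h. \<Sum>a\<in>U. f a)"
    by (rule avg_cong) (auto simp: perms_of_def intro: sum.permute [symmetric, unfolded comp_def])
  also have "\<dots> = (\<Sum>a\<in>U. f a)"
    using U by (intro avg_const perms_of_finite perms_of_nonempty)
  finally have "real (card U) * avg (perms_of U) (\<lambda>h. f (h x)) = (\<Sum>a\<in>U. f a)" .
  moreover have "real (card U) \<noteq> 0" using U by auto
  ultimately show ?thesis by (simp add: avg_def[of U] field_simps)
qed

text \<open>The average does not change when \<open>x'\<close> varies over all points other than \<open>x\<close>.\<close>

lemma avg_perms_related_pair: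
  assumes U: "finite U" and x: "x \<in> U" "x' \<in> U" "x \<noteq> x'"
  shows "real (card U - 1) * avg (perms_of U) (\<lambda>h. of_bool (g (h x) = h x')) \<le> 1"
proof -
  have eq: "avg (perms_of U) (\<lambda>h. of_bool (g (h x) = h a)) = avg (perms_of U) (\<lambda>h. of_bool (g (h x) = h x'))"
    if "a \<in> U - {x}" for a
  proof -
    have "Transposition.transpose x' a x = x" using that x by (intro transpose_apply_other) auto
    then show ?thesis
      using avg_perms_transpose[of x' U a "\<lambda>h. of_bool (g (h x) = h x')"] that x by simp
  qed
  have "real (card U - 1) * avg (perms_of U) (\<lambda>h. of_bool (g (h x) = h x'))
     = (\<Sum>a\<in>U - {x}. avg (perms_of U) (\<lambda>h. of_bool (g (h x) = h a)))"
    using U x by (subst sum.cong[OF refl eq]) simp_all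
  also have "\<dots> = avg (perms_of U) (\<lambda>h. \<Sum>a\<in>U - {x}. of_bool (g (h x) = h a))"
    by (simp add: avg_sum)
  also have "\<dots> \<le> avg (perms_of U) (\<lambda>h. 1)"
  proof (rule avg_mono)
    fix h assume "h \<in> perms_of U"
    then have inj: "inj h" by (auto simp: perms_of_def permutes_inj)
    have "(\<Sum>a\<in>U - {x}. of_bool (g (h x) = h a)) = real (card {a\<in>U - {x}. g (h x) = h a})"
      using U by (simp add: sum.If_cases of_bool_def Int_def)
    also have "\<dots> \<le> 1"
      using card_le_Suc0_iff_eq[of "{a\<in>U - {x}. g (h x) = h a}"] U inj by (auto dest: injD)
    finally show "(\<Sum>a\<in>U - {x}. of_bool (g (h x) = h a)) \<le> (1::real)" .
  qed
  also have "\<dots> = 1" using U by (intro avg_const perms_of_finite perms_of_nonempty)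
  finally show ?thesis .
qed

text \<open>Sampling without replacement is compared with independent uniform points. In the
  induction the new point is exchanged with every point outside the earlier ones, which costs at
  most \<open>i / N\<close>, and \<open>i + i ^ 2 \<le> (i + 1) ^ 2\<close>.\<close>

lemma avg_perms_tuple:
  assumes U: "finite U" "U \<noteq> {}"
    and x: "x ` {..<i} \<subseteq> U" "inj_on x {..<i}" and A: "\<And>k. A k \<subseteq> U"
  shows "\<bar>avg (perms_of U) (\<lambda>h. of_bool (\<forall>k<i. h (x k) \<in> A k)) - (\<Prod>k<i. real (card (A k)) / real (card U))\<bar>
     \<le> real (i ^ 2) / real (card U)"
  using x
proof (induction i)
  case 0
  then show ?case using U by (simp add: avg_const perms_of_finite perms_of_nonempty)
next
  case (Suc i)
  define N where "N = real (card U)"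
  have N: "N > 0" using U by (simp add: N_def card_gt_0_iff)
  define E where "E h = (of_bool (\<forall>k<i. h (x k) \<in> A k) :: real)" for h
  define X where "X = x ` {..<i}"
  have XU: "X \<subseteq> U" using Suc.prems by (auto simp: X_def)
  have injx: "inj_on x {..<i}" by (rule inj_on_subset[OF Suc.prems(2)]) auto
  have cX: "card X = i" unfolding X_def using injx by (simp add: card_image)
  have xi: "x i \<in> U - X"
    using Suc.prems by (auto simp: X_def dest: inj_onD[of x "{..<Suc i}" i])
  define P where "P = avg (perms_of U) (\<lambda>h. E h * of_bool (h (x i) \<in> A i))"
  define S where "S h = (\<Sum>a\<in>X. of_bool (h a \<in> A i) :: real)" for h
  have fin: "finite (perms_of U)" "perms_of U \<noteq> {}"
    using U by (simp_all add: perms_of_finite perms_of_nonempty)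
  have eq: "avg (perms_of U) (\<lambda>h. E h * of_bool (h a \<in> A i)) = P" if a: "a \<in> U - X" for a
  proof -
    have "avg (perms_of U) (\<lambda>h. E (h \<circ> Transposition.transpose (x i) a) * of_bool ((h \<circ> Transposition.transpose (x i) a) (x i) \<in> A i)) = P"
      unfolding P_def
      by (rule avg_perms_transpose[of "x i" U a "\<lambda>h. E h * of_bool (h (x i) \<in> A i)"]) (use a xi in auto)
    moreover have "E (h \<circ> Transposition.transpose (x i) a) = E h" for h
    proof -
      have "Transposition.transpose (x i) a (x k) = x k" if "k < i" for k
      proof (rule transpose_apply_other)
        have "x k \<in> X" using that by (auto simp: X_def)
        then show "x k \<noteq> x i" "x k \<noteq> a" using xi a by auto
      qed
      then show ?thesis unfolding E_def by auto
    qed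
    ultimately show ?thesis by simp
  qed
  have "real (card (U - X)) * P = (\<Sum>a\<in>U - X. avg (perms_of U) (\<lambda>h. E h * of_bool (h a \<in> A i)))"
    by (simp add: eq)
  also have "\<dots> = avg (perms_of U) (\<lambda>h. E h * (\<Sum>a\<in>U - X. of_bool (h a \<in> A i)))"
    by (simp add: avg_sum sum_distrib_left)
  also have "\<dots> = avg (perms_of U) (\<lambda>h. real (card (A i)) * E h - E h * S h)"
  proof (rule avg_cong)
    fix h assume "h \<in> perms_of U"
    then have h: "h permutes U" by (simp add: perms_of_def)
    have "(\<Sum>a\<in>U. of_bool (h a \<in> A i)) = (\<Sum>a\<in>U. of_bool (a \<in> A i) :: real)"
      using sum.permute[OF h, of "\<lambda>a. of_bool (a \<in> A i) :: real"] by (simp add: comp_def)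
    also have "\<dots> = real (card (A i))"
      using U A[of i] by (simp add: of_bool_def sum.If_cases Int_absorb1)
    finally have e: "(\<Sum>a\<in>U - X. of_bool (h a \<in> A i)) = real (card (A i)) - S h"
      using sum.subset_diff[OF XU U(1), of "\<lambda>a. of_bool (h a \<in> A i) :: real"] by (simp add: S_def)
    then show "E h * (\<Sum>a\<in>U - X. of_bool (h a \<in> A i)) = real (card (A i)) * E h - E h * S h"
      unfolding e by (simp add: algebra_simps)
  qed
  also have "\<dots> = real (card (A i)) * avg (perms_of U) E - avg (perms_of U) (\<lambda>h. E h * S h)"
    by (simp add: avg_diff avg_cmult)
  also have "real (card (U - X)) = N - real i"
    using U XU cX card_mono[OF U(1) XU] by (simp add: card_Diff_subset finite_subset N_def of_nat_diff)
  \<comment> \<open>\<open>S\<close> counts the earlier points that land in \<open>A i\<close>. Both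
    terms on the right lie between 0 and \<open>i\<close>, so the new event is independent of the
    earlier ones up to an error \<open>i / N\<close>.\<close>
  finally have rec: "N * P - real (card (A i)) * avg (perms_of U) E = real i * P - avg (perms_of U) (\<lambda>h. E h * S h)"
    by (simp add: algebra_simps)
  have S: "0 \<le> S h" "S h \<le> real i" for h
    using cX sum_bounded_above[of X "\<lambda>a. of_bool (h a \<in> A i) :: real" 1]
    by (auto simp: S_def intro!: sum_nonneg)
  have E: "0 \<le> E h" "E h \<le> 1" for h by (auto simp: E_def)
  have "0 \<le> avg (perms_of U) (\<lambda>h. E h * S h)" by (intro avg_nonneg mult_nonneg_nonneg S E)
  moreover have "avg (perms_of U) (\<lambda>h. E h * S h) \<le> avg (perms_of U) (\<lambda>h. real i)"
    using mult_mono[OF E(2) S(2) _ S(1)] by (intro avg_mono) simp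
  moreover have "0 \<le> P" unfolding P_def by (intro avg_nonneg mult_nonneg_nonneg E) auto
  moreover have "P \<le> avg (perms_of U) (\<lambda>h. 1)"
    unfolding P_def by (intro avg_mono) (simp add: E_def)
  ultimately have AP: "0 \<le> avg (perms_of U) (\<lambda>h. E h * S h)" "avg (perms_of U) (\<lambda>h. E h * S h) \<le> real i"
    "0 \<le> P" "P \<le> 1"
    using fin by (simp_all add: avg_const)
  have b: "\<bar>N * P - real (card (A i)) * avg (perms_of U) E\<bar> \<le> real i"
  proof -
    have "real i * P \<le> real i" "0 \<le> real i * P"
      using AP mult_left_mono[of P 1 "real i"] by simp_all
    then show ?thesis unfolding rec abs_le_iff using AP(1,2) by linarith
  qed
  define r where "r = real (card (A i)) / N"
  have r: "0 \<le> r" "r \<le> 1"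
    using N card_mono[OF U(1) A[of i]] by (auto simp: r_def N_def divide_le_eq)
  have "P - r * avg (perms_of U) E = (N * P - real (card (A i)) * avg (perms_of U) E) / N"
    using N by (simp add: r_def field_simps)
  then have b1: "\<bar>P - r * avg (perms_of U) E\<bar> \<le> real i / N"
    using b N by (simp add: divide_right_mono)
  define R where "R = (\<Prod>k<i. real (card (A k)) / N)"
  have IH: "\<bar>avg (perms_of U) E - R\<bar> \<le> real (i ^ 2) / N"
    unfolding E_def R_def N_def by (rule Suc.IH) (use Suc.prems injx in auto)
  have "\<bar>r * avg (perms_of U) E - r * R\<bar> = r * \<bar>avg (perms_of U) E - R\<bar>"
    using r by (simp add: right_diff_distrib [symmetric] abs_mult)
  also have "\<dots> \<le> 1 * (real (i ^ 2) / N)"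
    using r IH N by (intro mult_mono) auto
  finally have "\<bar>P - r * R\<bar> \<le> real i / N + real (i ^ 2) / N" using b1 by linarith
  also have "\<dots> \<le> real (Suc i ^ 2) / N"
    using N by (simp add: add_divide_distrib [symmetric] divide_right_mono power2_eq_square)
  finally have "\<bar>P - r * R\<bar> \<le> real (Suc i ^ 2) / N" .
  moreover have "P = avg (perms_of U) (\<lambda>h. of_bool (\<forall>k<Suc i. h (x k) \<in> A k))"
    unfolding P_def E_def by (rule avg_cong) (auto simp: less_Suc_eq)
  moreover have "r * R = (\<Prod>k<Suc i. real (card (A k)) / N)"
    by (simp add: r_def R_def mult.commute)
  ultimately show ?case by (simp add: N_def)
qed

section \<open>Averages over a conjugation-invariant set\<close>

locale conj_closed =
  fixes U :: "'a set" and C :: "('a \<Rightarrow> 'a) set"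
  assumes finU: "finite U" and cardU: "2 \<le> card U"
    and C_perms: "\<And>s. s \<in> C \<Longrightarrow> s permutes U" and C_ne: "C \<noteq> {}"
    and C_conj: "\<And>s h. s \<in> C \<Longrightarrow> h permutes U \<Longrightarrow> h \<circ> s \<circ> inv' h \<in> C"
begin

lemma U_ne: "U \<noteq> {}" using cardU by auto

lemma finC: "finite C"
  by (rule finite_subset[OF _ perms_of_finite[OF finU]]) (auto simp: perms_of_def C_perms)

text \<open>Conjugation by a fixed relabelling permutes \<open>C\<close>, so a further average over
  relabellings changes nothing. Estimates can then be made for one fixed \<open>s\<close>, with all
  randomness in \<open>h\<close>.\<close>

lemma avg_C_conj:
  "avg C F = avg C (\<lambda>s. avg (perms_of U) (\<lambda>h. F (h \<circ> s \<circ> inv' h)))"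
proof -
  have "avg C (\<lambda>s. F (h \<circ> s \<circ> inv' h)) = avg C F" if h: "h permutes U" for h
  proof (rule avg_reindex)
    have *: "inv' h \<circ> s \<circ> h \<in> C" if "s \<in> C" for s
      using C_conj[OF that permutes_inv[OF h]] by (simp add: permutes_inv_inv[OF h])
    show "bij_betw (\<lambda>s. h \<circ> s \<circ> inv' h) C C"
    proof (rule bij_betw_byWitness[where f' = "\<lambda>s. inv' h \<circ> s \<circ> h"])
      show "\<forall>s\<in>C. inv' h \<circ> (h \<circ> s \<circ> inv' h) \<circ> h = s" "\<forall>s\<in>C. h \<circ> (inv' h \<circ> s \<circ> h) \<circ> inv' h = s"
        using permutes_inverses[OF h] by (auto simp: fun_eq_iff)
    qed (use C_conj h * in auto)
  qed
  then have "avg (perms_of U) (\<lambda>h. avg C (\<lambda>s. F (h \<circ> s \<circ> inv' h))) = avg (perms_of U) (\<lambda>h. avg C F)"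
    by (intro avg_cong[of "perms_of U"]) (simp add: perms_of_def)
  also have "\<dots> = avg C F" using finU by (intro avg_const perms_of_finite perms_of_nonempty)
  finally show ?thesis by (subst (asm) avg_swap) simp
qed

lemma avg_C_abs_diff_le:
  assumes "\<And>s. s \<in> C \<Longrightarrow> \<bar>avg (perms_of U) (\<lambda>h. F (h \<circ> s \<circ> inv' h)) - c\<bar> \<le> e"
  shows "\<bar>avg C F - c\<bar> \<le> e"
  by (subst avg_C_conj) (intro avg_abs_diff_le finC C_ne assms)

end

section \<open>Cyclic symmetry of compositions\<close>

lemma sum_list_rotate1: "sum_list (rotate1 xs) = (sum_list xs :: 'a :: comm_monoid_add)"
  by (cases xs) (simp_all add: add.commute)

lemma compositions_rotate: "bij_betw rotate1 (compositions i n) (compositions i n)"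
proof -
  have inj: "inj_on rotate1 (compositions i n)"
    by (rule inj_on_subset[OF inj_rotate1]) simp
  have "rotate1 ` compositions i n \<subseteq> compositions i n"
    by (auto simp: compositions_def sum_list_rotate1)
  then show ?thesis
    unfolding bij_betw_def using inj endo_inj_surj[OF finite_compositions] by blast
qed

text \<open>By rotation invariance all entries of a composition contribute equally.\<close>

lemma sum_compositions_hd:
  assumes i: "1 \<le> i"
  shows "(\<Sum>is\<in>compositions i n. real (is ! 0) * (\<Prod>k<i. x (is ! k)))
       = real n / real i * composition_sum i n x"
proof -
  define w where "w is = prod_list (map x is)" for "is" :: "nat list"
  have w: "w (rotate1 is) = w is" for "is"
    by (cases "is") (simp_all add: w_def mult.commute)
  have w_eq: "(\<Prod>k<i. x (is ! k)) = w is" if "is \<in> compositions i n" for "is"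
    using that by (auto simp: w_def compositions_def prod.list_conv_set_nth atLeast0LessThan)
  define T where "T k = (\<Sum>is\<in>compositions i n. real (is ! k) * w is)" for k
  have step: "T (Suc k) = T k" if "Suc k < i" for k
  proof -
    have "T k = (\<Sum>is\<in>compositions i n. real (rotate1 is ! k) * w (rotate1 is))"
      unfolding T_def by (rule sum.reindex_bij_betw[OF compositions_rotate, symmetric])
    also have "\<dots> = T (Suc k)"
      unfolding T_def
      using that by (intro sum.cong) (auto simp: compositions_def nth_rotate1 w mod_less)
    finally show ?thesis by simp
  qed
  have T: "T k = T 0" if "k < i" for k
    using that by (induction k) (auto simp: step)
  have "(\<Sum>k<i. T k) = (\<Sum>k<i. T 0)" by (intro sum.cong refl T) simp
  then have "real i * T 0 = (\<Sum>k<i. T k)" by simp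
  also have "\<dots> = (\<Sum>is\<in>compositions i n. (\<Sum>k<i. real (is ! k)) * w is)"
    unfolding T_def by (subst sum.swap) (simp add: sum_distrib_right)
  also have "\<dots> = (\<Sum>is\<in>compositions i n. real n * w is)"
  proof (intro sum.cong refl)
    fix "is" assume "is \<in> compositions i n"
    then have "(\<Sum>k<i. is ! k) = n"
      by (auto simp: compositions_def sum_list_sum_nth atLeast0LessThan)
    then show "(\<Sum>k<i. real (is ! k)) * w is = real n * w is"
      by (simp flip: of_nat_sum)
  qed
  finally have "real i * T 0 = real n * (\<Sum>is\<in>compositions i n. w is)"
    by (simp add: sum_distrib_left)
  then show ?thesis using i by (simp add: T_def w_eq field_simps)
qed

text \<open>Accumulated error of \<open>avg_perms_tuple\<close>: \<open>i\<^sup>2\<close> for each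
  composition, times the weight \<open>is ! 0\<close> that the composition carries in
  \<open>merged_size\<close>.\<close>

abbreviation collision_weight :: "nat \<Rightarrow> real" where
  "collision_weight n \<equiv> \<Sum>i=2..n. \<Sum>is\<in>compositions i n. real (is ! 0 * i\<^sup>2)"

abbreviation conj_by :: "('a \<Rightarrow> 'a) \<Rightarrow> ('a \<Rightarrow> 'a) \<Rightarrow> 'a \<Rightarrow> 'a" where
  "conj_by h s \<equiv> h \<circ> s \<circ> inv' h"

lemma conj_funpow:
  assumes "h permutes U"
  shows "((conj_by h s) ^^ k) (h x) = h ((s ^^ k) x)"
  by (induction k) (simp_all add: permutes_inverses(2)[OF assms])

lemma conj_least_power:
  assumes "h permutes U"
  shows "least_power (conj_by h s) (h x) = least_power s x"
  unfolding least_power_def conj_funpow[OF assms] using permutes_inj[OF assms] by (simp add: inj_eq)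

section \<open>One step from a fixed state, averaged over the class\<close>

locale class_step = conj_closed +
  fixes p :: "'a \<Rightarrow> 'a" and c :: "nat \<Rightarrow> nat" and m :: nat
  assumes p: "p permutes U"
    and c: "\<And>s i. s \<in> C \<Longrightarrow> card {y\<in>U. least_power s y = i} = c i"
    and m: "\<And>s. s \<in> C \<Longrightarrow> card {y. s y \<noteq> y} = m"
begin

abbreviation "N \<equiv> card U"

definition dens :: "nat \<Rightarrow> real" where
  "dens n = real (card {y\<in>U. least_power p y = n}) / real N"

lemma moved_subset: "s \<in> C \<Longrightarrow> {y. s y \<noteq> y} \<subseteq> U"
  using C_perms by (auto simp: permutes_def)

lemma m_le: "m \<le> N"
proof -
  obtain s where "s \<in> C" using C_ne by blast
  from card_mono[OF finU moved_subset[OF this]] m[OF this] show ?thesis by simp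
qed

lemma c_le:
  assumes "2 \<le> i" shows "c i \<le> m"
proof -
  obtain s where s: "s \<in> C" using C_ne by blast
  have "{y\<in>U. least_power s y = i} \<subseteq> {y. s y \<noteq> y}"
  proof clarsimp
    fix y assume "s y = y" "i = least_power s y"
    then show False using least_power_le[of 1 s y] assms by simp
  qed
  from card_mono[OF finite_subset[OF moved_subset[OF s] finU] this] show ?thesis
    unfolding c[OF s] m[OF s] .
qed

lemma two_perms: "s \<in> C \<Longrightarrow> two_permutations p s"
  using p C_perms finU unfolding two_permutations_def permutation_permutes by blast

lemma sum_moved_conj:
  assumes s: "s \<in> C" and h: "h permutes U"
  shows "(\<Sum>y\<in>{y. (conj_by h s) y \<noteq> y}. F y :: real) = (\<Sum>x\<in>{x. s x \<noteq> x}. F (h x))"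
proof (rule sum.reindex_bij_betw [symmetric])
  have "{y. (conj_by h s) y \<noteq> y} = h ` {x. s x \<noteq> x}"
  proof (intro equalityI subsetI)
    fix y assume "y \<in> {y. (conj_by h s) y \<noteq> y}"
    then have "h (s (inv' h y)) \<noteq> h (inv' h y)" "y = h (inv' h y)"
      by (simp_all add: permutes_inverses(1)[OF h])
    then show "y \<in> h ` {x. s x \<noteq> x}" by auto
  next
    fix y assume "y \<in> h ` {x. s x \<noteq> x}"
    then show "y \<in> {y. (conj_by h s) y \<noteq> y}"
      using permutes_inj[OF h] by (auto simp: permutes_inverses(2)[OF h] inj_eq)
  qed
  then show "bij_betw h {x. s x \<noteq> x} {y. (conj_by h s) y \<noteq> y}"
    using permutes_inj_on[OF h] by (simp add: bij_betw_def)
qed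

text \<open>For some \<open>k \<le> n\<close> the \<open>k\<close>-th iterate of a moved point has
  to be another moved point. For each \<open>k\<close> there are \<open>m * (m - 1)\<close> ordered
  pairs, each with probability at most \<open>1 / (N - 1)\<close> by
  \<open>avg_perms_related_pair\<close>, and \<open>m \<le> N\<close> bounds the product by
  \<open>m\<^sup>2 / N\<close>.\<close>

lemma avg_close_moved: "avg C (\<lambda>s. real (card (close_moved p s n))) \<le> real n * (real m)\<^sup>2 / real N"
proof -
  define F where "F k s = (\<Sum>z\<in>{y. s y \<noteq> y}. of_bool (s ((p ^^ k) z) \<noteq> (p ^^ k) z \<and> (p ^^ k) z \<noteq> z) :: real)" for k s
  have F: "avg C (F k) \<le> (real m)\<^sup>2 / real N" for k
  proof -
    have "avg C (F k) = avg C (\<lambda>s. avg (perms_of U) (\<lambda>h. F k (conj_by h s)))"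
      by (rule avg_C_conj)
    also have "\<dots> \<le> avg C (\<lambda>s. (real m)\<^sup>2 / real N)"
    proof (rule avg_mono)
      fix s assume s: "s \<in> C"
      let ?M = "{y. s y \<noteq> y}"
      have finM: "finite ?M" using moved_subset[OF s] finU finite_subset by blast
      have "avg (perms_of U) (\<lambda>h. F k (conj_by h s)) \<le>
          avg (perms_of U) (\<lambda>h. \<Sum>x\<in>?M. \<Sum>x'\<in>?M - {x}. of_bool ((p ^^ k) (h x) = h x'))"
      proof (rule avg_mono)
        fix h assume "h \<in> perms_of U"
        then have h: "h permutes U" by (simp add: perms_of_def)
        define s' where "s' = h \<circ> s \<circ> inv' h"
        have "F k s' = (\<Sum>x\<in>?M. of_bool (s' ((p ^^ k) (h x)) \<noteq> (p ^^ k) (h x) \<and> (p ^^ k) (h x) \<noteq> h x))"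
          unfolding F_def s'_def by (rule sum_moved_conj[OF s h])
        also have "\<dots> \<le> (\<Sum>x\<in>?M. \<Sum>x'\<in>?M - {x}. of_bool ((p ^^ k) (h x) = h x'))"
        proof (rule sum_mono)
          fix x assume "x \<in> ?M"
          show "of_bool (s' ((p ^^ k) (h x)) \<noteq> (p ^^ k) (h x) \<and> (p ^^ k) (h x) \<noteq> h x)
             \<le> (\<Sum>x'\<in>?M - {x}. of_bool ((p ^^ k) (h x) = h x') :: real)"
          proof (cases "s' ((p ^^ k) (h x)) \<noteq> (p ^^ k) (h x) \<and> (p ^^ k) (h x) \<noteq> h x")
            case True
            \<comment> \<open>The label of the second moved point: the event is thereby witnessed by
              a pair of distinct labels moved by the fixed \<open>s\<close>.\<close>
            define x' where "x' = inv' h ((p ^^ k) (h x))"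
            have x': "h x' = (p ^^ k) (h x)" by (simp add: x'_def permutes_inverses(1)[OF h])
            have "s' (h x') = h (s x')" by (simp add: s'_def permutes_inverses(2)[OF h])
            then have "h (s x') \<noteq> h x'" "h x' \<noteq> h x" using True unfolding x' by metis+
            then have "x' \<in> ?M - {x}" by auto
            then have "of_bool ((p ^^ k) (h x) = h x') \<le> (\<Sum>x'\<in>?M - {x}. of_bool ((p ^^ k) (h x) = h x') :: real)"
              using finM by (intro member_le_sum) auto
            then show ?thesis using True x' by simp
          qed (auto intro: sum_nonneg)
        qed
        finally show "F k (conj_by h s) \<le> (\<Sum>x\<in>?M. \<Sum>x'\<in>?M - {x}. of_bool ((p ^^ k) (h x) = h x'))"
          by (simp only: s'_def)
      qed
      also have "\<dots> = (\<Sum>x\<in>?M. \<Sum>x'\<in>?M - {x}. avg (perms_of U) (\<lambda>h. of_bool ((p ^^ k) (h x) = h x')))"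
        by (simp add: avg_sum)
      also have "\<dots> \<le> (\<Sum>x\<in>?M. \<Sum>x'\<in>?M - {x}. 1 / real (N - 1))"
      proof (intro sum_mono)
        fix x x' assume "x \<in> ?M" "x' \<in> ?M - {x}"
        then have "x \<in> U" "x' \<in> U" "x \<noteq> x'" using moved_subset[OF s] by auto
        from avg_perms_related_pair[OF finU this, of "p ^^ k"]
        show "avg (perms_of U) (\<lambda>h. of_bool ((p ^^ k) (h x) = h x')) \<le> 1 / real (N - 1)"
          using cardU by (simp add: field_simps)
      qed
      also have "\<dots> = real m * (real (m - 1) / real (N - 1))"
        using m[OF s] finM by simp
      also have "\<dots> \<le> real m * (real m / real N)"
      proof (rule mult_left_mono)
        have "real (m - 1) * real N \<le> real m * real (N - 1)"
        proof (cases m)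
          case (Suc m')
          have "m' * N \<le> Suc m' * (N - 1)" using m_le Suc cardU by (cases N) (auto simp: algebra_simps)
          then show ?thesis using Suc by (simp only: of_nat_mult [symmetric] of_nat_le_iff) simp
        qed simp
        then show "real (m - 1) / real (N - 1) \<le> real m / real N"
          using cardU by (simp add: divide_le_eq le_divide_eq field_simps)
      qed simp
      finally show "avg (perms_of U) (\<lambda>h. F k (conj_by h s)) \<le> (real m)\<^sup>2 / real N"
        by (simp add: power2_eq_square)
    qed
    also have "\<dots> = (real m)\<^sup>2 / real N" by (intro avg_const finC C_ne)
    finally show ?thesis .
  qed
  have "avg C (\<lambda>s. real (card (close_moved p s n))) \<le> avg C (\<lambda>s. \<Sum>k=1..n. F k s)"
  proof (rule avg_mono)
    fix s assume s: "s \<in> C"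
    let ?M = "{y. s y \<noteq> y}"
    have finM: "finite ?M" using moved_subset[OF s] finU finite_subset by blast
    have Fc: "F k s = real (card {z\<in>?M. s ((p ^^ k) z) \<noteq> (p ^^ k) z \<and> (p ^^ k) z \<noteq> z})" for k
      unfolding F_def using finM by (simp add: of_bool_def sum.If_cases Int_def)
    have "close_moved p s n = (\<Union>k\<in>{1..n}. {z\<in>?M. s ((p ^^ k) z) \<noteq> (p ^^ k) z \<and> (p ^^ k) z \<noteq> z})"
      by (auto simp: close_moved_def)
    then have "card (close_moved p s n) \<le> (\<Sum>k=1..n. card {z\<in>?M. s ((p ^^ k) z) \<noteq> (p ^^ k) z \<and> (p ^^ k) z \<noteq> z})"
      using card_UN_le[of "{1..n}"] by simp
    then show "real (card (close_moved p s n)) \<le> (\<Sum>k=1..n. F k s)"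
      unfolding Fc of_nat_sum [symmetric] of_nat_le_iff .
  qed
  also have "\<dots> = (\<Sum>k=1..n. avg C (F k))" by (rule avg_sum)
  also have "\<dots> \<le> (\<Sum>k=1..n. (real m)\<^sup>2 / real N)" by (intro sum_mono F)
  finally show ?thesis by simp
qed

text \<open>Each of the \<open>m\<close> moved labels is sent to a uniform point, so linearity gives
  the expectation exactly.\<close>

lemma avg_lost: "avg C (\<lambda>s. real (card {y. s y \<noteq> y \<and> least_power p y = n})) = real m * dens n"
proof -
  have "avg C (\<lambda>s. real (card {y. s y \<noteq> y \<and> least_power p y = n})) =
      avg C (\<lambda>s. avg (perms_of U) (\<lambda>h. real (card {y. (conj_by h s) y \<noteq> y \<and> least_power p y = n})))"
    by (rule avg_C_conj)
  also have "\<dots> = avg C (\<lambda>s. real m * dens n)"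
  proof (rule avg_cong)
    fix s assume s: "s \<in> C"
    let ?M = "{y. s y \<noteq> y}"
    have "avg (perms_of U) (\<lambda>h. real (card {y. (conj_by h s) y \<noteq> y \<and> least_power p y = n}))
        = avg (perms_of U) (\<lambda>h. \<Sum>x\<in>?M. of_bool (least_power p (h x) = n))"
    proof (rule avg_cong)
      fix h assume "h \<in> perms_of U"
      then have h: "h permutes U" by (simp add: perms_of_def)
      have fin: "finite {y. (conj_by h s) y \<noteq> y}"
        using moved_subset[OF C_conj[OF s h]] finU finite_subset by blast
      have "real (card {y. (conj_by h s) y \<noteq> y \<and> least_power p y = n})
         = (\<Sum>y\<in>{y. (conj_by h s) y \<noteq> y}. of_bool (least_power p y = n))"
        using fin by (simp add: of_bool_def sum.If_cases Int_def del: comp_apply)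
      also have "\<dots> = (\<Sum>x\<in>?M. of_bool (least_power p (h x) = n))"
        by (rule sum_moved_conj[OF s h])
      finally show "real (card {y. (conj_by h s) y \<noteq> y \<and> least_power p y = n})
         = (\<Sum>x\<in>?M. of_bool (least_power p (h x) = n))" .
    qed
    also have "\<dots> = (\<Sum>x\<in>?M. avg (perms_of U) (\<lambda>h. of_bool (least_power p (h x) = n)))"
      by (rule avg_sum)
    also have "\<dots> = (\<Sum>x\<in>?M. dens n)"
    proof (rule sum.cong[OF refl])
      fix x assume "x \<in> ?M"
      then have "x \<in> U" using moved_subset[OF s] by auto
      from avg_perms_eval[OF finU this, of "\<lambda>y. of_bool (least_power p y = n)"]
      show "avg (perms_of U) (\<lambda>h. of_bool (least_power p (h x) = n)) = dens n"
        using finU by (simp add: avg_def[of U] dens_def of_bool_def sum.If_cases Int_def)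
    qed
    finally show "avg (perms_of U) (\<lambda>h. real (card {y. (conj_by h s) y \<noteq> y \<and> least_power p y = n}))
        = real m * dens n" using m[OF s] by simp
  qed
  finally show ?thesis by (simp add: avg_const finC C_ne)
qed

text \<open>At most one composition can match the values \<open>v\<close>, so having total
  \<open>n\<close> splits into events with prescribed values, whose probabilities
  \<open>avg_perms_tuple\<close> controls.\<close>

lemma merged_indicator:
  assumes i: "1 \<le> i"
  shows "of_bool ((\<Sum>k<i. v k) = n \<and> (\<forall>k<i. 1 \<le> v k)) * real (v 0) =
    (\<Sum>is\<in>compositions i n. real (is ! 0) * of_bool (\<forall>k<i. v k = is ! k))"
proof -
  define V where "V = map v [0..<i]"
  have "(\<Sum>is\<in>compositions i n. real (is ! 0) * of_bool (\<forall>k<i. v k = is ! k))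
      = (\<Sum>is\<in>compositions i n. if is = V then real (v 0) else 0)"
  proof (intro sum.cong refl)
    fix "is" assume "is \<in> compositions i n"
    then have "length is = i" by (simp add: compositions_def)
    then have "(\<forall>k<i. v k = is ! k) \<longleftrightarrow> is = V"
      by (auto simp: V_def list_eq_iff_nth_eq)
    then show "real (is ! 0) * of_bool (\<forall>k<i. v k = is ! k) = (if is = V then real (v 0) else 0)"
      using i by (auto simp: V_def)
  qed
  also have "\<dots> = (if V \<in> compositions i n then real (v 0) else 0)"
    by (simp add: sum.delta)
  also have "V \<in> compositions i n \<longleftrightarrow> (\<Sum>k<i. v k) = n \<and> (\<forall>k<i. 1 \<le> v k)"
    by (auto simp: V_def compositions_def interv_sum_list_conv_sum_set_nat atLeast0LessThan)
  finally show ?thesis by simp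
qed

text \<open>Fix \<open>s\<close>. For a label \<open>x\<close> on an \<open>i\<close>-cycle the
  points \<open>h x\<close>, \<open>h (s x)\<close>, ... are a sample of \<open>i\<close> distinct
  points whose \<open>p\<close>-periods have to form a composition of \<open>n\<close>. There are
  \<open>c i\<close> such labels, and the weight is the first part, the \<open>p\<close>-period of
  \<open>h x\<close>.\<close>

lemma avg_merged:
  "\<bar>avg C (\<lambda>s. real (merged_size p s n))
    - (\<Sum>i=2..n. real (c i) * (\<Sum>is\<in>compositions i n. real (is ! 0) * (\<Prod>k<i. dens (is ! k))))\<bar>
   \<le> (\<Sum>i=2..n. real (c i) * (\<Sum>is\<in>compositions i n. real (is ! 0) * (real (i\<^sup>2) / real N)))"
  (is "\<bar>_ - ?c\<bar> \<le> ?e")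
proof (rule avg_C_abs_diff_le)
  fix s assume s: "s \<in> C"
  have ps: "permutation s" "permutation p"
    using two_perms[OF s] by (auto simp: two_permutations_def)
  let ?M = "{y. s y \<noteq> y}"
  let ?P = "\<lambda>i. {y\<in>U. least_power s y = i}"
  have finM: "finite ?M" using moved_subset[OF s] finU finite_subset by blast
  define A where "A j = {y\<in>U. least_power p y = j}" for j
  define E where "E i x is h = (of_bool (\<forall>k<i. h ((s ^^ k) x) \<in> A (is ! k)) :: real)" for i x "is" h
  have split: "real (merged_size p (conj_by h s) n)
      = (\<Sum>i=2..n. \<Sum>x\<in>?P i. \<Sum>is\<in>compositions i n. real (is ! 0) * E i x is h)"
    if h: "h permutes U" for h
  proof -
    define s' where "s' = h \<circ> s \<circ> inv' h"
    have s': "s' \<in> C" unfolding s'_def by (rule C_conj[OF s h])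
    have fin': "finite {y. s' y \<noteq> y}" using moved_subset[OF s'] finU finite_subset by blast
    define g where "g x = of_bool (merged_length p s' (h x) = n) * real (least_power p (h x))" for x
    have ml: "merged_length p s' (h x) = (\<Sum>k<least_power s x. least_power p (h ((s ^^ k) x)))" for x
      unfolding merged_length_def s'_def conj_least_power[OF h] conj_funpow[OF h] ..
    have "real (\<Sum>y | s' y \<noteq> y \<and> merged_length p s' y = n. least_power p y)
       = (\<Sum>y\<in>{y. s' y \<noteq> y}. of_bool (merged_length p s' y = n) * real (least_power p y))"
      unfolding of_nat_sum
      by (rule sum.mono_neutral_cong_left) (use fin' in auto)
    also have "\<dots> = (\<Sum>x\<in>?M. g x)"
      unfolding s'_def g_def by (rule sum_moved_conj[OF s h])
    also have "\<dots> = (\<Sum>x\<in>(\<Union>i\<in>{2..n}. ?P i). g x)"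
    proof (rule sum.mono_neutral_right[OF finM])
      show "(\<Union>i\<in>{2..n}. ?P i) \<subseteq> ?M"
      proof clarsimp
        fix y assume "2 \<le> least_power s y" "s y = y"
        then show False using least_power_le[of 1 s y] by simp
      qed
      \<comment> \<open>An \<open>s\<close>-cycle longer than \<open>n\<close> has merged length
        above \<open>n\<close>, since every summand is at least 1.\<close>
      show "\<forall>x\<in>?M - (\<Union>i\<in>{2..n}. ?P i). g x = 0"
      proof
        fix x assume x: "x \<in> ?M - (\<Union>i\<in>{2..n}. ?P i)"
        then have "x \<in> U" using moved_subset[OF s] by auto
        moreover have "least_power s x > 1" using least_power_gt_one[OF ps(1)] x by auto
        ultimately have "n < least_power s x" using x by auto
        also have "least_power s x = (\<Sum>k<least_power s x. 1)" by simp
        also have "\<dots> \<le> merged_length p s' (h x)"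
          unfolding ml using least_power_of_permutation(2)[OF ps(2)] by (intro sum_mono) (simp add: Suc_le_eq)
        finally show "g x = 0" by (simp add: g_def)
      qed
    qed
    also have "\<dots> = (\<Sum>i=2..n. \<Sum>x\<in>?P i. g x)"
      using finU by (intro sum.UNION_disjoint) auto
    also have "\<dots> = (\<Sum>i=2..n. \<Sum>x\<in>?P i. \<Sum>is\<in>compositions i n. real (is ! 0) * E i x is h)"
    proof (intro sum.cong refl)
      fix i x assume i: "i \<in> {2..n}" and x: "x \<in> ?P i"
      define v where "v k = least_power p (h ((s ^^ k) x))" for k
      have v1: "1 \<le> v k" for k
        using least_power_of_permutation(2)[OF ps(2)] by (simp add: v_def Suc_le_eq)
      have "g x = of_bool ((\<Sum>k<i. v k) = n \<and> (\<forall>k<i. 1 \<le> v k)) * real (v 0)"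
        unfolding g_def ml using x v1 by (simp add: v_def)
      also have "\<dots> = (\<Sum>is\<in>compositions i n. real (is ! 0) * of_bool (\<forall>k<i. v k = is ! k))"
        by (rule merged_indicator) (use i in simp)
      also have "\<dots> = (\<Sum>is\<in>compositions i n. real (is ! 0) * E i x is h)"
      proof -
        have "h ((s ^^ k) x) \<in> U" for k
          using permutes_funpow_in[OF C_perms[OF s], of x k] permutes_in_image[OF h] x by simp
        then show ?thesis unfolding E_def A_def v_def by simp
      qed
      finally show "g x = (\<Sum>is\<in>compositions i n. real (is ! 0) * E i x is h)" .
    qed
    finally show ?thesis unfolding s'_def .
  qed
  have E: "\<bar>avg (perms_of U) (E i x is) - (\<Prod>k<i. dens (is ! k))\<bar> \<le> real (i\<^sup>2) / real N"
    if x: "x \<in> ?P i" for i x "is"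
  proof -
    have "\<bar>avg (perms_of U) (\<lambda>h. of_bool (\<forall>k<i. h ((s ^^ k) x) \<in> A (is ! k)))
       - (\<Prod>k<i. real (card (A (is ! k))) / real N)\<bar> \<le> real (i\<^sup>2) / real N"
    proof (rule avg_perms_tuple[OF finU U_ne])
      show "(\<lambda>k. (s ^^ k) x) ` {..<i} \<subseteq> U"
        using permutes_funpow_in[OF C_perms[OF s]] x by auto
      show "inj_on (\<lambda>k. (s ^^ k) x) {..<i}"
        using inj_on_funpow_orbit[OF ps(1), of x] x by simp
    qed (auto simp: A_def)
    then show ?thesis unfolding E_def dens_def A_def .
  qed
  have "avg (perms_of U) (\<lambda>h. real (merged_size p (conj_by h s) n))
     = avg (perms_of U) (\<lambda>h. \<Sum>i=2..n. \<Sum>x\<in>?P i. \<Sum>is\<in>compositions i n. real (is ! 0) * E i x is h)"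
    by (rule avg_cong, rule split) (simp add: perms_of_def)
  also have "\<dots> = (\<Sum>i=2..n. \<Sum>x\<in>?P i. \<Sum>is\<in>compositions i n. real (is ! 0) * avg (perms_of U) (E i x is))"
    by (simp add: avg_sum avg_cmult)
  finally have eq: "avg (perms_of U) (\<lambda>h. real (merged_size p (conj_by h s) n))
     = (\<Sum>i=2..n. \<Sum>x\<in>?P i. \<Sum>is\<in>compositions i n. real (is ! 0) * avg (perms_of U) (E i x is))" .
  have cs: "real (c i) * r = (\<Sum>x\<in>?P i. r)" for i r
    using c[OF s, of i] by simp
  show "\<bar>avg (perms_of U) (\<lambda>h. real (merged_size p (conj_by h s) n)) - ?c\<bar> \<le> ?e"
    unfolding eq cs sum_subtractf [symmetric] right_diff_distrib [symmetric]
  proof (intro order.trans[OF sum_abs] sum_mono)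
    fix i x "is" assume x: "x \<in> ?P i"
    show "\<bar>real (is ! 0) * (avg (perms_of U) (E i x is) - (\<Prod>k<i. dens (is ! k)))\<bar>
      \<le> real (is ! 0) * (real (i\<^sup>2) / real N)"
      unfolding abs_mult abs_of_nat by (rule mult_left_mono[OF E[OF x]]) simp
  qed
qed

text \<open>The term with \<open>3 * n ^ 3\<close> is \<open>period_count_change\<close> combined
  with \<open>avg_close_moved\<close>; the other error is that of \<open>avg_merged\<close> with
  every \<open>c i\<close> bounded by \<open>m\<close>. A factor \<open>m\<close> is kept outside
  because the jump rate will divide by it.\<close>

lemma avg_period_change:
  "\<bar>avg C (\<lambda>s. real (card {j\<in>U. least_power (s \<circ> p) j = n}) - real (card {j\<in>U. least_power p j = n}))
     - real m * merge_rate (\<lambda>i. real (c i) / real m) dens n\<bar>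
   \<le> real m * ((3 * real n ^ 3) * real m / real N + collision_weight n / real N)"
proof -
  define D where "D s = real (card {j\<in>U. least_power (s \<circ> p) j = n}) - real (card {j\<in>U. least_power p j = n})" for s
  define G where "G s = real (merged_size p s n)" for s
  define L where "L s = real (card {y. s y \<noteq> y \<and> least_power p y = n})" for s
  define B where "B s = real (card (close_moved p s n))" for s
  have "\<bar>D s - (G s - real n * L s)\<bar> \<le> 3 * real n ^ 2 * B s" if "s \<in> C" for s
    using two_permutations.period_count_change(1)[OF two_perms[OF that] finU p C_perms[OF that], of n]
    by (simp add: D_def G_def L_def B_def)
  then have D1: "D s \<le> (G s - real n * L s) + 3 * real n ^ 2 * B s"
    "(G s - real n * L s) - 3 * real n ^ 2 * B s \<le> D s" if "s \<in> C" for s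
    using that by (simp_all add: abs_le_iff) (smt (verit, best))+
  have "avg C D \<le> avg C (\<lambda>s. (G s - real n * L s) + 3 * real n ^ 2 * B s)"
    by (rule avg_mono) (rule D1)
  moreover have "avg C (\<lambda>s. (G s - real n * L s) - 3 * real n ^ 2 * B s) \<le> avg C D"
    by (rule avg_mono) (rule D1)
  ultimately have "\<bar>avg C D - (avg C G - real n * avg C L)\<bar> \<le> 3 * real n ^ 2 * avg C B"
    by (simp add: avg_add avg_diff avg_cmult)
  also have "\<dots> \<le> 3 * real n ^ 2 * (real n * (real m)\<^sup>2 / real N)"
    unfolding B_def by (intro mult_left_mono avg_close_moved) simp
  also have "\<dots> = real m * (3 * real n ^ 3 * real m / real N)"
    by (simp add: power2_eq_square power3_eq_cube)
  finally have 1: "\<bar>avg C D - (avg C G - real n * avg C L)\<bar> \<le> real m * (3 * real n ^ 3 * real m / real N)" .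
  define R where "R = (\<Sum>i=2..n. real (c i) * (\<Sum>is\<in>compositions i n. real (is ! 0) * (\<Prod>k<i. dens (is ! k))))"
  have "\<bar>avg C G - R\<bar> \<le> (\<Sum>i=2..n. real (c i) * (\<Sum>is\<in>compositions i n. real (is ! 0) * (real (i\<^sup>2) / real N)))"
    unfolding G_def R_def by (rule avg_merged)
  also have "\<dots> \<le> (\<Sum>i=2..n. real m * (\<Sum>is\<in>compositions i n. real (is ! 0) * (real (i\<^sup>2) / real N)))"
    by (intro sum_mono mult_right_mono sum_nonneg) (simp_all add: c_le)
  also have "\<dots> = real m * (collision_weight n / real N)"
    by (simp add: sum_distrib_left sum_divide_distrib)
  finally have 2: "\<bar>avg C G - R\<bar> \<le> real m * (collision_weight n / real N)" .
  have 3: "avg C L = real m * dens n" unfolding L_def by (rule avg_lost)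
  \<comment> \<open>This holds for \<open>m = 0\<close> too, where \<open>c_le\<close> forces
    \<open>c i = 0\<close>.\<close>
  have m0: "real (c i) = real m * (real (c i) / real m)" if "i \<in> {2..n}" for i
    using c_le[of i] that by (cases "m = 0") auto
  define T where "T i = real (c i) / real m * (real n / real i) * composition_sum i n dens" for i
  have "R = (\<Sum>i=2..n. real m * T i)"
    unfolding R_def
  proof (intro sum.cong refl)
    fix i assume i: "i \<in> {2..n}"
    then have "(\<Sum>is\<in>compositions i n. real (is ! 0) * (\<Prod>k<i. dens (is ! k)))
      = real n / real i * composition_sum i n dens"
      by (intro sum_compositions_hd) simp
    then show "real (c i) * (\<Sum>is\<in>compositions i n. real (is ! 0) * (\<Prod>k<i. dens (is ! k))) = real m * T i"
      unfolding T_def by (subst m0[OF i]) (simp only: mult.assoc)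
  qed
  then have "R = real m * (\<Sum>i=2..n. T i)" by (simp only: sum_distrib_left)
  then have "real m * merge_rate (\<lambda>i. real (c i) / real m) dens n = R - real n * avg C L"
    unfolding merge_rate_def 3 T_def [symmetric] by (simp add: right_diff_distrib)
  with 1 2 show ?thesis unfolding D_def [symmetric] distrib_left by linarith
qed

end

section \<open>Finite Markov semigroups\<close>

text \<open>\<open>deviation_drift G f x x' b\<close> is the drift at \<open>b\<close> of the squared deviation of \<open>f\<close> from a moving
  target which has value \<open>x\<close> and velocity \<open>x'\<close>.\<close>

abbreviation deviation_drift ::
    "(('s \<Rightarrow> real) \<Rightarrow> 's \<Rightarrow> real) \<Rightarrow> ('s \<Rightarrow> real) \<Rightarrow> real \<Rightarrow> real \<Rightarrow> 's \<Rightarrow> real" where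
  "deviation_drift G f x x' b \<equiv>
     2 * (f b - x) * (G f b - x') + (G (\<lambda>b. (f b)\<^sup>2) b - 2 * f b * G f b)"

locale finite_semigroup =
  fixes E :: "'s set" and K :: "real \<Rightarrow> 's \<Rightarrow> 's pmf" and G :: "('s \<Rightarrow> real) \<Rightarrow> 's \<Rightarrow> real" and x0 :: 's
  assumes finE: "finite E" and x0: "x0 \<in> E"
    and K: "markov_semigroup E K" and G: "has_generator E K G"
begin

definition mean :: "real \<Rightarrow> ('s \<Rightarrow> real) \<Rightarrow> real" where
  "mean t f = (\<Sum>b\<in>E. pmf (K t x0) b * f b)"

lemma expectation_K:
  assumes "x \<in> E" "0 \<le> t"
  shows "measure_pmf.expectation (K t x) f = (\<Sum>b\<in>E. pmf (K t x) b * f b)"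
proof -
  have "set_pmf (K t x) \<subseteq> E" using K assms by (auto simp: markov_semigroup_def)
  then show ?thesis
    by (subst integral_measure_pmf_real[OF finE]) (auto simp: mult.commute)
qed

lemma expectation_eq_mean: "0 \<le> t \<Longrightarrow> measure_pmf.expectation (K t x0) f = mean t f"
  by (simp add: mean_def expectation_K x0)

lemma mean_add: "mean t (\<lambda>b. f b + g b) = mean t f + mean t g"
  by (simp add: mean_def sum.distrib distrib_left)

lemma mean_diff: "mean t (\<lambda>b. f b - g b) = mean t f - mean t g"
  by (simp add: mean_def sum_subtractf right_diff_distrib)

lemma mean_cmult: "mean t (\<lambda>b. c * f b) = c * mean t f"
  by (simp add: mean_def sum_distrib_left mult_ac)

lemma mean_sum: "mean t (\<lambda>b. \<Sum>i\<in>I. f i b) = (\<Sum>i\<in>I. mean t (f i))"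
  unfolding mean_def by (simp add: sum_distrib_left) (rule sum.swap)

lemma mean_const: "0 \<le> t \<Longrightarrow> mean t (\<lambda>_. c) = c"
  using K x0 unfolding mean_def markov_semigroup_def
  by (simp add: sum_distrib_right [symmetric] sum_pmf_eq_1 finE)

lemma mean_mono: "(\<And>b. b \<in> E \<Longrightarrow> f b \<le> g b) \<Longrightarrow> mean t f \<le> mean t g"
  unfolding mean_def by (intro sum_mono mult_left_mono) auto

lemma mean_0: "mean 0 f = f x0"
proof -
  have "mean 0 f = measure_pmf.expectation (K 0 x0) f" by (simp add: expectation_eq_mean)
  then show ?thesis using K x0 by (simp add: markov_semigroup_def)
qed

text \<open>Chapman-Kolmogorov: conditioning at time \<open>s\<close> carries the generator, which
  is given at time 0, to later times.\<close>

lemma mean_semigroup: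
  assumes "0 \<le> s" "0 \<le> t"
  shows "mean (s + t) f = mean s (\<lambda>y. measure_pmf.expectation (K t y) f)"
proof -
  have "K (s + t) x0 = bind_pmf (K s x0) (K t)" "set_pmf (K s x0) \<subseteq> E"
    using K x0 assms by (auto simp: markov_semigroup_def)
  moreover have "finite (set_pmf (K t y))" if "y \<in> E" for y
    using K that assms finE by (auto simp: markov_semigroup_def intro: finite_subset)
  ultimately have "measure_pmf.expectation (K (s + t) x0) f
      = (\<Sum>a\<in>E. pmf (K s x0) a *\<^sub>R measure_pmf.expectation (K t a) f)"
    by (simp add: pmf_expectation_bind[OF finE])
  then show ?thesis using assms by (simp add: expectation_eq_mean mean_def)
qed

definition quot :: "('s \<Rightarrow> real) \<Rightarrow> real \<Rightarrow> 's \<Rightarrow> real" where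
  "quot f h y = (measure_pmf.expectation (K h y) f - f y) / h"

lemma quot_tendsto: "y \<in> E \<Longrightarrow> ((\<lambda>h. quot f h y) \<longlongrightarrow> G f y) (at_right 0)"
  using G by (simp add: has_generator_def quot_def)

lemma mean_quot:
  assumes "0 \<le> s" "0 < h"
  shows "(mean (s + h) f - mean s f) / h = mean s (quot f h)"
proof -
  have "mean s (quot f h) = mean s (\<lambda>y. (1 / h) * (measure_pmf.expectation (K h y) f - f y))"
    by (simp add: quot_def[abs_def])
  also have "\<dots> = (1 / h) * (mean (s + h) f - mean s f)"
    unfolding mean_cmult mean_diff using assms by (simp add: mean_semigroup)
  finally show ?thesis by simp
qed

lemma at_right_0_pos: "\<forall>\<^sub>F h in at_right 0. 0 < (h :: real)"
  by (simp add: eventually_at_right_less)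

lemma mean_right_deriv:
  assumes "0 \<le> t"
  shows "((\<lambda>h. (mean (t + h) f - mean t f) / h) \<longlongrightarrow> mean t (G f)) (at_right 0)"
proof -
  have "((\<lambda>h. mean t (quot f h)) \<longlongrightarrow> mean t (G f)) (at_right 0)"
    unfolding mean_def by (intro tendsto_intros quot_tendsto)
  moreover have "\<forall>\<^sub>F h in at_right 0. mean t (quot f h) = (mean (t + h) f - mean t f) / h"
    using at_right_0_pos by eventually_elim (simp add: mean_quot assms)
  ultimately show ?thesis by (rule Lim_transform_eventually)
qed

lemma eventually_less_at_right_0: "0 < t \<Longrightarrow> \<forall>\<^sub>F h in at_right 0. h < (t :: real)"
  by (rule eventually_at_rightI[of 0 t]) auto

text \<open>The generator is a one-sided derivative at time 0, so the left side needs an argument: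
  the increment over \<open>[t - h, t]\<close> is \<open>h\<close> times a mean of difference
  quotients, and as probabilities are at most 1 this mean is bounded by a sum over \<open>E\<close>
  that converges.\<close>

lemma mean_left_cont:
  assumes t: "0 < t"
  shows "((\<lambda>h. mean (t - h) f) \<longlongrightarrow> mean t f) (at_right 0)"
proof -
  have "((\<lambda>h. h * (\<Sum>y\<in>E. \<bar>quot f h y\<bar>)) \<longlongrightarrow> 0 * (\<Sum>y\<in>E. \<bar>G f y\<bar>)) (at_right 0)"
    by (intro tendsto_intros quot_tendsto)
  then have lim: "((\<lambda>h. h * (\<Sum>y\<in>E. \<bar>quot f h y\<bar>)) \<longlongrightarrow> 0) (at_right 0)" by simp
  have ev: "\<forall>\<^sub>F h in at_right 0. norm (mean t f - mean (t - h) f) \<le> h * (\<Sum>y\<in>E. \<bar>quot f h y\<bar>)"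
    using at_right_0_pos eventually_less_at_right_0[OF t]
  proof eventually_elim
    fix h :: real assume h: "0 < h" "h < t"
    have "mean t f - mean (t - h) f = h * mean (t - h) (quot f h)"
      using mean_quot[of "t - h" h f] h by (simp add: field_simps)
    moreover have "\<bar>mean (t - h) (quot f h)\<bar> \<le> (\<Sum>y\<in>E. \<bar>quot f h y\<bar>)"
      unfolding mean_def
      by (rule order.trans[OF sum_abs]) (intro sum_mono, simp add: abs_mult mult_left_le_one_le pmf_le_1)
    ultimately show "norm (mean t f - mean (t - h) f) \<le> h * (\<Sum>y\<in>E. \<bar>quot f h y\<bar>)"
      using h by (simp add: abs_mult)
  qed
  have "((\<lambda>h. mean t f - mean (t - h) f) \<longlongrightarrow> 0) (at_right 0)"
    by (rule Lim_null_comparison[OF ev lim])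
  from tendsto_diff[OF tendsto_const[of "mean t f"] this] show ?thesis by simp
qed

text \<open>Here the difference quotient is averaged with the law at the moving time
  \<open>t - h\<close>; left continuity, applied to indicators of points, makes these weights
  converge along with the quotients.\<close>

lemma mean_left_deriv:
  assumes t: "0 < t"
  shows "((\<lambda>h. (mean t f - mean (t - h) f) / h) \<longlongrightarrow> mean t (G f)) (at_right 0)"
proof -
  have pm: "((\<lambda>h. pmf (K (t - h) x0) y) \<longlongrightarrow> pmf (K t x0) y) (at_right 0)" if y: "y \<in> E" for y
  proof -
    have "mean s (\<lambda>b. of_bool (b = y)) = pmf (K s x0) y" for s
      using y finE by (simp add: mean_def of_bool_def sum.If_cases if_distrib sum.delta cong: if_cong)
    then show ?thesis using mean_left_cont[OF t, of "\<lambda>b. of_bool (b = y)"] by simp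
  qed
  have "((\<lambda>h. mean (t - h) (quot f h)) \<longlongrightarrow> mean t (G f)) (at_right 0)"
    unfolding mean_def by (intro tendsto_intros quot_tendsto pm)
  moreover have "\<forall>\<^sub>F h in at_right 0. mean (t - h) (quot f h) = (mean t f - mean (t - h) f) / h"
    using at_right_0_pos eventually_less_at_right_0[OF t]
    by eventually_elim (use mean_quot[of "t - h" h f for h] in simp)
  ultimately show ?thesis by (rule Lim_transform_eventually)
qed

lemma mean_has_derivative:
  assumes t: "0 < t"
  shows "((\<lambda>t. mean t f) has_real_derivative mean t (G f)) (at t)"
  unfolding has_field_derivative_iff
proof (rule filterlim_split_at)
  have "((\<lambda>h. (mean (h + t) f - mean t f) / (h + t - t)) \<longlongrightarrow> mean t (G f)) (at_right 0)"
    using mean_right_deriv[of t f] t by (simp add: add.commute)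
  then show "((\<lambda>y. (mean y f - mean t f) / (y - t)) \<longlongrightarrow> mean t (G f)) (at_right t)"
    by (subst filterlim_at_right_to_0)
  have "((\<lambda>h. (mean (- (h + - t)) f - mean t f) / (- (h + - t) - t)) \<longlongrightarrow> mean t (G f)) (at_right 0)"
  proof (rule Lim_transform_eventually[OF mean_left_deriv[OF t, of f]])
    show "\<forall>\<^sub>F h in at_right 0. (mean t f - mean (t - h) f) / h = (mean (- (h + - t)) f - mean t f) / (- (h + - t) - t)"
      using at_right_0_pos by eventually_elim (simp add: field_simps)
  qed
  then show "((\<lambda>y. (mean y f - mean t f) / (y - t)) \<longlongrightarrow> mean t (G f)) (at_left t)"
    by (subst filterlim_at_left_to_right, subst filterlim_at_right_to_0)
qed

lemma mean_continuous: "continuous_on {0..} (\<lambda>t. mean t f)"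
  unfolding continuous_on_def
proof
  fix t :: real assume "t \<in> {0..}"
  then consider "t = 0" | "0 < t" by force
  then show "((\<lambda>t. mean t f) \<longlongrightarrow> mean t f) (at t within {0..})"
  proof cases
    case 1
    have "((\<lambda>h. h * ((mean (0 + h) f - mean 0 f) / h) + mean 0 f) \<longlongrightarrow> 0 * mean 0 (G f) + mean 0 f) (at_right 0)"
      by (intro tendsto_intros mean_right_deriv) simp
    then have "((\<lambda>h. h * ((mean (0 + h) f - mean 0 f) / h) + mean 0 f) \<longlongrightarrow> mean 0 f) (at_right 0)" by simp
    then have "((\<lambda>h. mean h f) \<longlongrightarrow> mean 0 f) (at_right 0)"
      by (rule Lim_transform_eventually) (use at_right_0_pos in eventually_elim, simp)
    moreover have "at 0 within {0::real..} = at_right 0"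
      by (rule at_within_Ici_at_right)
    ultimately show ?thesis using 1 by simp
  next
    case 2
    have "isCont (\<lambda>t. mean t f) t" by (rule DERIV_isCont[OF mean_has_derivative[OF 2]])
    then show ?thesis unfolding isCont_def by (rule tendsto_within_subset) simp
  qed
qed

text \<open>The derivative of the mean squared deviation is the mean of
  \<open>deviation_drift\<close>, to which Gronwall's argument applies. The last summand of the
  drift is the carre du champ of \<open>f n\<close>, the contribution of the noise.\<close>

lemma mean_square_deviation_le:
  assumes "finite I" and L: "0 < L"
    and deriv: "\<And>n t. n \<in> I \<Longrightarrow> (x n has_real_derivative x' n t) (at t)"
    and init: "\<And>n. n \<in> I \<Longrightarrow> f n x0 = x n 0"
    and T: "0 \<le> T"
    and bound: "\<And>t b. 0 < t \<Longrightarrow> t < T \<Longrightarrow> b \<in> E \<Longrightarrow>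
       (\<Sum>n\<in>I. deviation_drift G (f n) (x n t) (x' n t) b)
       \<le> L * (\<Sum>n\<in>I. (f n b - x n t)\<^sup>2) + \<delta>"
  shows "mean T (\<lambda>b. \<Sum>n\<in>I. (f n b - x n T)\<^sup>2) \<le> \<delta> / L * (exp (L * T) - 1)"
proof -
  \<comment> \<open>The square is expanded so that the generator meets only the fixed functions
    \<open>f n\<close> and their squares; the time dependence stays in scalar coefficients.\<close>
  define D where "D t = (\<Sum>n\<in>I. mean t (\<lambda>b. (f n b)\<^sup>2) - 2 * x n t * mean t (f n) + (x n t)\<^sup>2)" for t
  define D' where "D' t = (\<Sum>n\<in>I. mean t (G (\<lambda>b. (f n b)\<^sup>2)) - (2 * x' n t * mean t (f n) + 2 * x n t * mean t (G (f n)))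
      + 2 * x n t * x' n t)" for t
  have D_eq: "D t = mean t (\<lambda>b. \<Sum>n\<in>I. (f n b - x n t)\<^sup>2)" if "0 \<le> t" for t
    unfolding mean_sum D_def
  proof (intro sum.cong refl)
    fix n
    have "mean t (\<lambda>b. (f n b - x n t)\<^sup>2) = mean t (\<lambda>b. ((f n b)\<^sup>2 - (2 * x n t) * f n b) + (x n t)\<^sup>2)"
      by (simp add: power2_diff algebra_simps)
    then show "mean t (\<lambda>b. (f n b)\<^sup>2) - 2 * x n t * mean t (f n) + (x n t)\<^sup>2 = mean t (\<lambda>b. (f n b - x n t)\<^sup>2)"
      using that by (simp only: mean_add mean_diff mean_cmult mean_const)
  qed
  have D0: "D 0 = 0" using init by (simp add: D_eq mean_0)
  have dD: "(D has_real_derivative D' t) (at t)" if "0 < t" for t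
    unfolding D_def D'_def
    by (auto intro!: derivative_eq_intros mean_has_derivative deriv that sum.cong simp: algebra_simps)
  have D'_le: "D' t \<le> L * D t + \<delta>" if t: "0 < t" "t < T" for t
  proof -
    have "D' t = mean t (\<lambda>b. \<Sum>n\<in>I. deviation_drift G (f n) (x n t) (x' n t) b)"
      unfolding mean_sum D'_def
    proof (intro sum.cong refl)
      fix n
      have "mean t (\<lambda>b. deviation_drift G (f n) (x n t) (x' n t) b)
         = mean t (\<lambda>b. G (\<lambda>b. (f n b)\<^sup>2) b - ((2 * x' n t) * f n b + (2 * x n t) * G (f n) b) + 2 * x n t * x' n t)"
        by (simp add: algebra_simps)
      then show "mean t (G (\<lambda>b. (f n b)\<^sup>2)) - (2 * x' n t * mean t (f n) + 2 * x n t * mean t (G (f n))) + 2 * x n t * x' n t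
       = mean t (\<lambda>b. deviation_drift G (f n) (x n t) (x' n t) b)"
        using t by (simp only: mean_add mean_diff mean_cmult mean_const less_imp_le)
    qed
    also have "\<dots> \<le> mean t (\<lambda>b. L * (\<Sum>n\<in>I. (f n b - x n t)\<^sup>2) + \<delta>)"
      by (rule mean_mono) (rule bound[OF t])
    also have "\<dots> = L * D t + \<delta>"
      using t by (simp add: mean_add mean_cmult mean_const D_eq)
    finally show ?thesis .
  qed
  \<comment> \<open>Integrating factor; the shift \<open>\<delta> / L\<close> absorbs the
    inhomogeneous term, so that \<open>g\<close> is nonincreasing.\<close>
  define g where "g t = exp (- L * t) * (D t + \<delta> / L)" for t
  have "g T \<le> g 0"
  proof (rule DERIV_nonpos_imp_decreasing_open[OF T])
    fix t assume t: "0 < t" "t < T"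
    have "(g has_real_derivative (exp (- L * t) * D' t + (- L * exp (- L * t)) * (D t + \<delta> / L))) (at t)"
      unfolding g_def by (auto intro!: derivative_eq_intros dD t)
    moreover have "exp (- L * t) * D' t + (- L * exp (- L * t)) * (D t + \<delta> / L)
       = exp (- L * t) * (D' t - (L * D t + \<delta>))"
      using L by (simp add: field_simps)
    moreover have "exp (- L * t) * (D' t - (L * D t + \<delta>)) \<le> 0"
      using D'_le[OF t] by (simp add: mult_le_0_iff)
    ultimately show "\<exists>y. (g has_real_derivative y) (at t) \<and> y \<le> 0" by auto
  next
    have "continuous_on {0..T} (\<lambda>t. mean t h)" for h
      by (rule continuous_on_subset[OF mean_continuous]) auto
    moreover have "continuous_on {0..T} (x n)" if "n \<in> I" for n
      using deriv[OF that] by (meson DERIV_isCont continuous_at_imp_continuous_on)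
    ultimately show "continuous_on {0..T} g"
      unfolding g_def D_def by (intro continuous_intros)
  qed
  then have "exp (- L * T) * (D T + \<delta> / L) \<le> \<delta> / L" by (simp add: g_def D0)
  then have "exp (L * T) * (exp (- L * T) * (D T + \<delta> / L)) \<le> exp (L * T) * (\<delta> / L)"
    by (intro mult_left_mono) auto
  then have "D T + \<delta> / L \<le> exp (L * T) * (\<delta> / L)"
    by (simp add: mult.assoc [symmetric] exp_add [symmetric])
  then show ?thesis using T by (simp add: D_eq algebra_simps)
qed

text \<open>Nonnegativity of the variance; this is how the bound on second moments reaches the
  expectation.\<close>

lemma mean_square_ge:
  assumes "0 \<le> t"
  shows "(mean t f - c)\<^sup>2 \<le> mean t (\<lambda>b. (f b - c)\<^sup>2)"
proof -
  define a where "a = mean t f"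
  have "0 \<le> mean t (\<lambda>b. (f b - a)\<^sup>2)"
    using mean_mono[of "\<lambda>_. 0" "\<lambda>b. (f b - a)\<^sup>2" t] assms by (simp add: mean_const)
  moreover have sq: "mean t (\<lambda>b. (f b - c)\<^sup>2) = mean t (\<lambda>b. (f b)\<^sup>2) - 2 * c * a + c\<^sup>2" for c
  proof -
    have "mean t (\<lambda>b. (f b - c)\<^sup>2) = mean t (\<lambda>b. ((f b)\<^sup>2 - (2 * c) * f b) + c\<^sup>2)"
      by (simp add: power2_diff algebra_simps)
    then show ?thesis using assms by (simp only: mean_add mean_diff mean_cmult mean_const a_def)
  qed
  ultimately have "0 \<le> mean t (\<lambda>b. (f b)\<^sup>2) - a\<^sup>2"
    by (simp add: power2_eq_square)
  then show ?thesis unfolding sq a_def [symmetric] by (simp add: power2_diff algebra_simps)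
qed

end

text \<open>The law at time \<open>t\<close> comes from the Markov property with
  \<open>s = 0\<close>, \<open>J = {}\<close> and \<open>a = x0\<close>; the almost sure start at
  \<open>x0\<close> removes the conditioning event.\<close>

lemma markov_process_expectation:
  assumes mp: "markov_process E G M X" and X0: "AE \<omega> in M. X 0 \<omega> = x0" and fin: "finite E" and x0: "x0 \<in> E"
  obtains K where "finite_semigroup E K G x0"
    "\<And>t f. 0 \<le> t \<Longrightarrow> (\<integral>\<omega>. f (X t \<omega>) \<partial>M) = measure_pmf.expectation (K t x0) (f :: 's \<Rightarrow> real)"
proof -
  interpret prob_space M using mp by (simp add: markov_process_def)
  have X: "X t \<in> M \<rightarrow>\<^sub>M count_space E" if "0 \<le> t" for t
    using mp that by (simp add: markov_process_def)
  obtain K where K: "markov_semigroup E K" "has_generator E K G"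
    and mk: "\<forall>s\<ge>0. \<forall>t\<ge>0. \<forall>J. finite J \<and> J \<subseteq> {0..s} \<longrightarrow> (\<forall>x. \<forall>a\<in>E. \<forall>b\<in>E.
           measure M {\<omega>\<in>space M. (\<forall>u\<in>J. X u \<omega> = x u) \<and> X s \<omega> = a \<and> X (s + t) \<omega> = b}
           = measure M {\<omega>\<in>space M. (\<forall>u\<in>J. X u \<omega> = x u) \<and> X s \<omega> = a} * pmf (K t a) b)"
    using mp unfolding markov_process_def by (elim conjE exE) (rule that)
  interpret finite_semigroup E K G x0
    by unfold_locales (use K fin x0 in auto)
  have meas: "{\<omega>\<in>space M. X t \<omega> = b} \<in> sets M" if "0 \<le> t" "b \<in> E" for t b
    using measurable_sets[OF X[OF that(1)], of "{b}"] that(2) by (simp add: vimage_def Int_def conj_commute)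
  have pX: "measure M {\<omega>\<in>space M. X t \<omega> = b} = pmf (K t x0) b" if t: "0 \<le> t" and b: "b \<in> E" for t b
  proof -
    have m2: "{\<omega>\<in>space M. X 0 \<omega> = x0 \<and> X t \<omega> = b} \<in> sets M"
      using sets.Int[OF meas[OF order_refl x0] meas[OF t b]] by (simp add: Int_def conj_ac cong: conj_cong)
    have "measure M {\<omega>\<in>space M. X 0 \<omega> = x0 \<and> X t \<omega> = b} = measure M {\<omega>\<in>space M. X 0 \<omega> = x0} * pmf (K t x0) b"
      using mk[rule_format, of 0 t "{}" x0 b] t x0 b by simp
    moreover have "measure M {\<omega>\<in>space M. X 0 \<omega> = x0} = 1"
      using X0 meas[OF order_refl x0] by (simp add: prob_Collect_eq_1)
    moreover have "measure M {\<omega>\<in>space M. X 0 \<omega> = x0 \<and> X t \<omega> = b} = measure M {\<omega>\<in>space M. X t \<omega> = b}"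
      using X0 by (intro finite_measure_eq_AE m2 meas t b) auto
    ultimately show ?thesis by simp
  qed
  have "(\<integral>\<omega>. f (X t \<omega>) \<partial>M) = measure_pmf.expectation (K t x0) f" if t: "0 \<le> t" for t and f :: "'s \<Rightarrow> real"
  proof -
    have "(\<integral>\<omega>. f (X t \<omega>) \<partial>M) = (\<integral>\<omega>. (\<Sum>b\<in>E. f b * indicator {\<omega>\<in>space M. X t \<omega> = b} \<omega>) \<partial>M)"
    proof (rule Bochner_Integration.integral_cong[OF refl])
      fix \<omega> assume w: "\<omega> \<in> space M"
      then have "X t \<omega> \<in> E" using measurable_space[OF X[OF t]] by auto
      then have "(\<Sum>b\<in>E. if b = X t \<omega> then f b else 0) = f (X t \<omega>)" using fin by (simp add: sum.delta)
      moreover have "(\<Sum>b\<in>E. f b * indicator {\<omega>\<in>space M. X t \<omega> = b} \<omega>) = (\<Sum>b\<in>E. if b = X t \<omega> then f b else 0)"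
        using w by (intro sum.cong) (auto simp: indicator_def)
      ultimately show "f (X t \<omega>) = (\<Sum>b\<in>E. f b * indicator {\<omega>\<in>space M. X t \<omega> = b} \<omega>)" by simp
    qed
    also have "\<dots> = (\<Sum>b\<in>E. f b * measure M {\<omega>\<in>space M. X t \<omega> = b})"
      using meas[OF t] by (subst Bochner_Integration.integral_sum) (auto simp: less_top[symmetric])
    also have "\<dots> = mean t f"
      unfolding mean_def using pX[OF t] by (intro sum.cong) (auto simp: mult.commute)
    finally show ?thesis using t by (simp add: expectation_eq_mean)
  qed
  with that show ?thesis using finite_semigroup_axioms by blast
qed

section \<open>Convergence of the period densities\<close>

lemma num_period_le: "num_period N p i \<le> N"
proof -
  have "num_period N p i \<le> card {1..N}" unfolding num_period_def by (rule card_mono) auto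
  then show ?thesis by simp
qed

lemma conj_class_sym_group:
  assumes "conj_class (sym_group N) C"
  obtains g where "g permutes {1..N}" "C = {h \<circ> g \<circ> inv' h | h. h permutes {1..N}}"
proof -
  obtain g where g: "g \<in> carrier (sym_group N)"
    and C: "C = {h \<otimes>\<^bsub>sym_group N\<^esub> g \<otimes>\<^bsub>sym_group N\<^esub> inv\<^bsub>sym_group N\<^esub> h | h. h \<in> carrier (sym_group N)}"
    using assms by (auto simp: conj_class_def)
  show ?thesis
  proof (rule that)
    show "g permutes {1..N}" using g by (simp add: sym_group_carrier)
    show "C = {h \<circ> g \<circ> inv' h | h. h permutes {1..N}}"
    proof -
      have "u = h \<otimes>\<^bsub>sym_group N\<^esub> g \<otimes>\<^bsub>sym_group N\<^esub> inv\<^bsub>sym_group N\<^esub> h \<and> h \<in> carrier (sym_group N)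
          \<longleftrightarrow> u = h \<circ> g \<circ> inv' h \<and> h permutes {1..N}" for u h
        by (cases "h \<in> carrier (sym_group N)") (simp_all add: sym_group_mult del: One_nat_def flip: sym_group_carrier)
      then show ?thesis unfolding C by (simp only:)
    qed
  qed
qed

section \<open>The generator of the walk on period densities\<close>

locale nontrivial_class =
  fixes N :: nat and C :: "(nat \<Rightarrow> nat) set"
  assumes N: "2 \<le> N" and C: "conj_class (sym_group N) C" and nontriv: "C \<noteq> {id}"
begin

abbreviation "U \<equiv> {1..N}"

lemma closed: "conj_closed U C"
proof -
  obtain g where g: "g permutes U" and C': "C = {h \<circ> g \<circ> inv' h | h. h permutes U}"
    using conj_class_sym_group[OF C] .
  show ?thesis
  proof
    show "finite U" "2 \<le> card U" using N by auto
    show "s permutes U" if "s \<in> C" for s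
      using that g unfolding C' by (auto intro!: permutes_compose permutes_inv)
    show "C \<noteq> {}" unfolding C' using permutes_id by blast
    show "h \<circ> s \<circ> inv' h \<in> C" if s: "s \<in> C" and h: "h permutes U" for s h
    proof -
      obtain k where k: "k permutes U" "s = k \<circ> g \<circ> inv' k" using s unfolding C' by blast
      have "inv' (h \<circ> k) = inv' k \<circ> inv' h"
        using h k by (intro o_inv_distrib permutes_bij)
      then have "h \<circ> s \<circ> inv' h = (h \<circ> k) \<circ> g \<circ> inv' (h \<circ> k)" by (simp add: k comp_assoc)
      moreover have "(h \<circ> k) permutes U" using k h by (intro permutes_compose)
      ultimately show ?thesis unfolding C' by blast
    qed
  qed
qed

sublocale conj_closed U C by (rule closed)

definition "c i = num_period N (SOME p. p \<in> C) i"
definition "m = N - c 1"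

text \<open>Conjugation by \<open>h\<close> maps points of period \<open>i\<close> bijectively to
  points of period \<open>i\<close>; hence the representative chosen by \<open>SOME\<close> in
  \<open>class_period\<close> does not matter.\<close>

lemma num_period_eq:
  assumes "s \<in> C"
  shows "num_period N s i = c i"
proof -
  obtain g where g: "g permutes U" and C': "C = {h \<circ> g \<circ> inv' h | h. h permutes U}"
    using conj_class_sym_group[OF C] .
  have *: "num_period N s i = num_period N g i" if s: "s \<in> C" for s
  proof -
    obtain h where h: "h permutes U" and s: "s = h \<circ> g \<circ> inv' h" using s unfolding C' by blast
    have "bij_betw h {j\<in>U. least_power g j = i} {j\<in>U. least_power s j = i}"
      unfolding bij_betw_def
    proof
      show "inj_on h {j\<in>U. least_power g j = i}" using permutes_inj_on[OF h] .
      show "h ` {j\<in>U. least_power g j = i} = {j\<in>U. least_power s j = i}"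
      proof (intro equalityI subsetI)
        fix y assume "y \<in> {j\<in>U. least_power s j = i}"
        then have y: "y \<in> U" "least_power s y = i" by auto
        have hy: "h (inv' h y) = y" by (rule permutes_inverses(1)[OF h])
        have "least_power g (inv' h y) = i"
          using conj_least_power[OF h, of g "inv' h y"] y(2) unfolding s hy by simp
        moreover have "inv' h y \<in> U" using y permutes_in_image[OF permutes_inv[OF h]] by simp
        ultimately show "y \<in> h ` {j\<in>U. least_power g j = i}" using hy by (intro image_eqI[of _ _ "inv' h y"]) auto
      next
        fix y assume "y \<in> h ` {j\<in>U. least_power g j = i}"
        then obtain x where x: "x \<in> U" "least_power g x = i" "y = h x" by blast
        have "least_power s y = i" unfolding s x(3) conj_least_power[OF h] by (rule x(2))
        moreover have "y \<in> U" unfolding x(3) permutes_in_image[OF h] by (rule x(1))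
        ultimately show "y \<in> {j\<in>U. least_power s j = i}" by blast
      qed
    qed
    then show ?thesis unfolding num_period_def by (rule bij_betw_same_card [symmetric])
  qed
  have "(SOME p. p \<in> C) \<in> C" using C_ne by (simp add: some_in_eq)
  then show ?thesis unfolding c_def using *[OF assms] * by simp
qed

lemma card_moved:
  assumes "s \<in> C"
  shows "card {y. s y \<noteq> y} = m"
proof -
  have s: "s permutes U" by (rule C_perms[OF assms])
  have "least_power s y = 1 \<longleftrightarrow> s y = y" for y
  proof
    assume "least_power s y = 1"
    then show "s y = y"
      using least_power_of_permutation(1)[of s y] s by (auto simp: permutation_permutes)
  next
    assume *: "s y = y"
    have "permutation s" using s by (auto simp: permutation_permutes)
    from least_power_of_permutation(2)[OF this, of y] least_power_le[of 1 s y] * show "least_power s y = 1" by simp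
  qed
  then have "{y. s y \<noteq> y} = U - {y\<in>U. least_power s y = 1}"
    using s by (auto simp: permutes_def)
  moreover have "card (U - {y\<in>U. least_power s y = 1}) = card U - card {y\<in>U. least_power s y = 1}"
    by (rule card_Diff_subset) auto
  ultimately have "card {y. s y \<noteq> y} = card U - card {y\<in>U. least_power s y = 1}" by simp
  also have "card {y\<in>U. least_power s y = 1} = c 1"
    using num_period_eq[OF assms, of 1] by (simp add: num_period_def)
  finally show ?thesis by (simp add: m_def)
qed

lemma c_le_N: "c i \<le> N"
  unfolding c_def by (rule num_period_le)

lemma class_period_eq: "class_period N C i = real (c i)"
  by (simp add: class_period_def c_def)

lemma class_support_eq: "class_support N C = real m"
  using c_le_N[of 1] by (simp add: class_support_def class_period_eq m_def of_nat_diff)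

lemma m_pos: "0 < m"
proof (rule ccontr)
  assume "\<not> 0 < m"
  then have m0: "m = 0" by simp
  have "s = id" if s: "s \<in> C" for s
  proof -
    have "{y. s y \<noteq> y} \<subseteq> U" using C_perms[OF s] unfolding permutes_def by blast
    then have "finite {y. s y \<noteq> y}" by (rule finite_subset) simp
    then have "{y. s y \<noteq> y} = {}" using card_moved[OF s] m0 by simp
    then show ?thesis by auto
  qed
  then show False using nontriv C_ne by auto
qed

lemma step:
  assumes "p permutes U"
  shows "class_step U C p c m"
proof
  show "p permutes U" by fact
  show "card {y\<in>U. least_power s y = i} = c i" if "s \<in> C" for s i
    using num_period_eq[OF that] by (simp add: num_period_def)
qed (rule card_moved)

lemma walk_generator_avg: "walk_generator N C f p = real N / real m * avg C (\<lambda>s. f (s \<circ> p) - f p)"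
  by (simp add: walk_generator_def class_support_eq avg_def)

lemma dens_eq: "p permutes U \<Longrightarrow> class_step.dens U p n = period_density N n p"
  using class_step.dens_def[OF step] by (simp add: period_density_def num_period_def)

text \<open>The jump rate \<open>N / m\<close> and the normalisation \<open>1 / N\<close> of
  densities leave a factor \<open>1 / m\<close>, which cancels the \<open>m\<close> in
  \<open>avg_period_change\<close>. The first error is the one that evanescence makes small.\<close>

lemma generator_period_density:
  assumes p: "p permutes U"
  shows "\<bar>walk_generator N C (period_density N n) p
     - merge_rate (\<lambda>i. class_period N C i / class_support N C) (\<lambda>k. period_density N k p) n\<bar>
   \<le> (3 * real n ^ 3) * (class_support N C / real N)
      + collision_weight n / real N"
proof -
  interpret class_step U C p c m by (rule step[OF p])
  have d: "dens = (\<lambda>k. period_density N k p)" using dens_eq[OF p] by auto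
  define R where "R = merge_rate (\<lambda>i. real (c i) / real m) dens n"
  define D where "D = avg C (\<lambda>s. real (card {j\<in>U. least_power (s \<circ> p) j = n}) - real (card {j\<in>U. least_power p j = n}))"
  define K where "K = collision_weight n"
  have "avg C (\<lambda>s. period_density N n (s \<circ> p) - period_density N n p)
     = avg C (\<lambda>s. (1 / real N) * (real (card {j\<in>U. least_power (s \<circ> p) j = n}) - real (card {j\<in>U. least_power p j = n})))"
    by (rule avg_cong) (simp add: period_density_def num_period_def diff_divide_distrib)
  then have "walk_generator N C (period_density N n) p = real N / real m * (D / real N)"
    unfolding walk_generator_avg avg_cmult D_def by simp
  then have w: "walk_generator N C (period_density N n) p = D / real m"
    using N by simp
  have "\<bar>D - real m * R\<bar> \<le> real m * ((3 * real n ^ 3) * real m / real N + K / real N)"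
    using avg_period_change[of n] by (simp add: D_def R_def K_def)
  then have "\<bar>D - real m * R\<bar> / real m \<le> (3 * real n ^ 3) * real m / real N + K / real N"
    using m_pos by (simp add: divide_le_eq mult.commute)
  moreover have "\<bar>D - real m * R\<bar> / real m = \<bar>D / real m - R\<bar>"
    using m_pos by (simp add: abs_divide [symmetric, of _ "real m", unfolded abs_of_nat] diff_divide_distrib)
  ultimately have "\<bar>D / real m - R\<bar> \<le> (3 * real n ^ 3) * real m / real N + K / real N" by simp
  then show ?thesis
    unfolding w class_period_eq class_support_eq d [symmetric] R_def K_def by simp
qed

text \<open>The carre du champ is the jump rate times the mean squared jump. A jump is at most
  \<open>n * m / N\<close>, and
  \<open>N / m * (n * m / N)\<^sup>2 = n\<^sup>2 * m / N\<close>.\<close>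

lemma generator_square:
  assumes p: "p permutes U"
  shows "walk_generator N C (\<lambda>q. (period_density N n q)\<^sup>2) p
      - 2 * period_density N n p * walk_generator N C (period_density N n) p
    \<le> (real n)\<^sup>2 * (class_support N C / real N)"
proof -
  interpret class_step U C p c m by (rule step[OF p])
  let ?f = "period_density N n"
  have "walk_generator N C (\<lambda>q. (?f q)\<^sup>2) p - 2 * ?f p * walk_generator N C ?f p
     = real N / real m * (avg C (\<lambda>s. (?f (s \<circ> p))\<^sup>2 - (?f p)\<^sup>2) - avg C (\<lambda>s. 2 * ?f p * (?f (s \<circ> p) - ?f p)))"
    unfolding walk_generator_avg avg_cmult by (simp add: algebra_simps)
  also have "\<dots> = real N / real m * avg C (\<lambda>s. (?f (s \<circ> p) - ?f p)\<^sup>2)"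
    unfolding avg_diff [symmetric] by (simp add: power2_eq_square algebra_simps)
  also have "\<dots> \<le> real N / real m * (real n * real m / real N)\<^sup>2"
  proof (rule mult_left_mono)
    have "avg C (\<lambda>s. (?f (s \<circ> p) - ?f p)\<^sup>2) \<le> avg C (\<lambda>s. (real n * real m / real N)\<^sup>2)"
    proof (rule avg_mono)
      fix s assume s: "s \<in> C"
      have "\<bar>real (card {j\<in>U. least_power (s \<circ> p) j = n}) - real (card {j\<in>U. least_power p j = n})\<bar> \<le> real (n * m)"
        using two_permutations.period_count_change(2)[OF two_perms[OF s] finU p C_perms[OF s], of n] card_moved[OF s]
        by simp
      then have "\<bar>real (card {j\<in>U. least_power (s \<circ> p) j = n}) - real (card {j\<in>U. least_power p j = n})\<bar> / real N \<le> real (n * m) / real N"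
        by (rule divide_right_mono) simp
      then have "\<bar>?f (s \<circ> p) - ?f p\<bar> \<le> \<bar>real n * real m / real N\<bar>"
        by (simp add: period_density_def num_period_def diff_divide_distrib [symmetric])
      then show "(?f (s \<circ> p) - ?f p)\<^sup>2 \<le> (real n * real m / real N)\<^sup>2"
        by (simp only: abs_le_square_iff)
    qed
    then show "avg C (\<lambda>s. (?f (s \<circ> p) - ?f p)\<^sup>2) \<le> (real n * real m / real N)\<^sup>2"
      by (simp add: avg_const finC C_ne)
  qed simp
  also have "\<dots> = (real n)\<^sup>2 * (class_support N C / real N)"
    using m_pos N by (simp add: class_support_eq power2_eq_square field_simps)
  finally show ?thesis .
qed

end

lemma period_density_bounds: "0 \<le> period_density N n p" "period_density N n p \<le> 1"
proof -
  show "period_density N n p \<le> 1"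
    using num_period_le[of N p n] by (simp add: period_density_def divide_le_eq)
qed (simp add: period_density_def)

lemma period_density_id:
  assumes "1 \<le> N"
  shows "period_density N n id = (if n = 1 then 1 else 0)"
proof -
  have "least_power (id :: nat \<Rightarrow> nat) j = 1" for j
    by (rule least_power_eqI) auto
  then have "num_period N id n = card (if n = 1 then {1..N} else {})"
    unfolding num_period_def by (intro arg_cong[of _ _ card]) auto
  then show ?thesis using assms by (simp add: period_density_def)
qed

section \<open>Regularity of the limiting vector field\<close>

lemma compositions_nth:
  assumes "is \<in> compositions i n" "k < i"
  shows "1 \<le> is ! k" "is ! k \<le> n"
  using assms member_le_sum_list[of "is ! k" "is"] by (auto simp: compositions_def)

lemma merge_rate_coeff_diff:
  assumes "\<And>k. 0 \<le> y k" "\<And>k. y k \<le> 1"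
  shows "\<bar>merge_rate c y n - merge_rate c' y n\<bar>
     \<le> (\<Sum>i=2..n. \<bar>c i - c' i\<bar> * (real n / real i * real (card (compositions i n))))"
proof -
  have "merge_rate c y n - merge_rate c' y n
    = (\<Sum>i=2..n. (c i - c' i) * (real n / real i * composition_sum i n y))"
    by (simp only: merge_rate_def left_diff_distrib mult.assoc sum_subtractf)
  also have "\<bar>\<dots>\<bar> \<le> (\<Sum>i=2..n. \<bar>c i - c' i\<bar> * (real n / real i * real (card (compositions i n))))"
  proof (intro order.trans[OF sum_abs] sum_mono)
    fix i
    have "0 \<le> composition_sum i n y"
      by (intro sum_nonneg prod_nonneg) (simp add: assms)
    moreover have "composition_sum i n y \<le> (\<Sum>is\<in>compositions i n. 1)"
      by (intro sum_mono prod_le_1) (simp add: assms)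
    ultimately show "\<bar>(c i - c' i) * (real n / real i * composition_sum i n y)\<bar>
      \<le> \<bar>c i - c' i\<bar> * (real n / real i * real (card (compositions i n)))"
      by (simp add: abs_mult mult_left_mono divide_right_mono)
  qed
  finally show ?thesis .
qed

text \<open>On the box of radius \<open>R \<ge> 1\<close> the linear term contributes
  \<open>n\<close>, and a product of \<open>i\<close> factors changes by at most
  \<open>R ^ i * i\<close> times the total deviation.\<close>

definition merge_lipschitz :: "(nat \<Rightarrow> real) \<Rightarrow> real \<Rightarrow> nat \<Rightarrow> real" where
  "merge_lipschitz c R n = real n + (\<Sum>i=2..n. \<bar>c i\<bar> * (real n / real i) * (real (card (compositions i n)) * (R ^ i * real i)))"

lemma merge_lipschitz_nonneg: "0 \<le> R \<Longrightarrow> 0 \<le> merge_lipschitz c R n"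
  unfolding merge_lipschitz_def by (intro add_nonneg_nonneg sum_nonneg mult_nonneg_nonneg) auto

lemma merge_rate_lipschitz:
  assumes R: "1 \<le> R" and x: "\<And>k. 1 \<le> k \<Longrightarrow> k \<le> n \<Longrightarrow> \<bar>x k\<bar> \<le> R" and y: "\<And>k. 1 \<le> k \<Longrightarrow> k \<le> n \<Longrightarrow> \<bar>y k\<bar> \<le> R"
    and n: "1 \<le> n"
  shows "\<bar>merge_rate c x n - merge_rate c y n\<bar> \<le> merge_lipschitz c R n * (\<Sum>k=1..n. \<bar>x k - y k\<bar>)"
proof -
  define S where "S = (\<Sum>k=1..n. \<bar>x k - y k\<bar>)"
  have S: "\<bar>x k - y k\<bar> \<le> S" if "1 \<le> k" "k \<le> n" for k
    unfolding S_def using that by (intro member_le_sum) auto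
  have prod: "\<bar>(\<Prod>j<i. x (is ! j)) - (\<Prod>j<i. y (is ! j))\<bar> \<le> R ^ i * real i * S"
    if "is": "is \<in> compositions i n" for i "is"
  proof -
    note k = compositions_nth[OF "is"]
    \<comment> \<open>Dividing by \<open>R\<close> brings all factors into the unit ball, where
      \<open>norm_prod_diff\<close> applies; the power \<open>R ^ i\<close> is restored
      afterwards.\<close>
    have "norm ((\<Prod>j<i. x (is ! j) / R) - (\<Prod>j<i. y (is ! j) / R)) \<le> (\<Sum>j<i. norm (x (is ! j) / R - y (is ! j) / R))"
      using R x y k by (intro norm_prod_diff) (simp_all add: divide_le_eq)
    also have "\<dots> \<le> (\<Sum>j<i. S)"
    proof (rule sum_mono)
      fix j assume j: "j \<in> {..<i}"
      have "norm (x (is ! j) / R - y (is ! j) / R) = \<bar>x (is ! j) - y (is ! j)\<bar> / R"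
        using R by (simp add: diff_divide_distrib [symmetric])
      also have "\<dots> \<le> \<bar>x (is ! j) - y (is ! j)\<bar> / 1"
        using R by (intro divide_left_mono) auto
      finally show "norm (x (is ! j) / R - y (is ! j) / R) \<le> S" using S k j by force
    qed
    finally have *: "\<bar>(\<Prod>j<i. x (is ! j) / R) - (\<Prod>j<i. y (is ! j) / R)\<bar> \<le> real i * S" by simp
    have "\<bar>(\<Prod>j<i. x (is ! j)) - (\<Prod>j<i. y (is ! j))\<bar>
        = R ^ i * \<bar>(\<Prod>j<i. x (is ! j) / R) - (\<Prod>j<i. y (is ! j) / R)\<bar>"
      using R by (simp add: prod_dividef diff_divide_distrib [symmetric] abs_divide)
    also have "\<dots> \<le> R ^ i * (real i * S)" using * R by (intro mult_left_mono) auto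
    finally show ?thesis by (simp add: mult.assoc)
  qed
  have "merge_rate c x n - merge_rate c y n
     = (\<Sum>i=2..n. c i * (real n / real i) * (\<Sum>is\<in>compositions i n. (\<Prod>j<i. x (is ! j)) - (\<Prod>j<i. y (is ! j))))
       - real n * (x n - y n)"
    by (simp add: merge_rate_def sum_subtractf right_diff_distrib)
  then have "\<bar>merge_rate c x n - merge_rate c y n\<bar>
     \<le> \<bar>\<Sum>i=2..n. c i * (real n / real i) * (\<Sum>is\<in>compositions i n. (\<Prod>j<i. x (is ! j)) - (\<Prod>j<i. y (is ! j)))\<bar>
       + \<bar>real n * (x n - y n)\<bar>" by (simp only: abs_triangle_ineq4)
  also have "\<dots> \<le> (\<Sum>i=2..n. \<bar>c i\<bar> * (real n / real i) * (real (card (compositions i n)) * (R ^ i * real i * S))) + real n * S"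
  proof (rule add_mono)
    show "\<bar>real n * (x n - y n)\<bar> \<le> real n * S"
      using S[of n] n by (simp add: abs_mult mult_left_mono)
    show "\<bar>\<Sum>i=2..n. c i * (real n / real i) * (\<Sum>is\<in>compositions i n. (\<Prod>j<i. x (is ! j)) - (\<Prod>j<i. y (is ! j)))\<bar>
      \<le> (\<Sum>i=2..n. \<bar>c i\<bar> * (real n / real i) * (real (card (compositions i n)) * (R ^ i * real i * S)))"
    proof (rule order.trans[OF sum_abs], rule sum_mono)
      fix i
      have "\<bar>\<Sum>is\<in>compositions i n. (\<Prod>j<i. x (is ! j)) - (\<Prod>j<i. y (is ! j))\<bar>
        \<le> (\<Sum>is\<in>compositions i n. R ^ i * real i * S)"
        by (rule order.trans[OF sum_abs], rule sum_mono) (rule prod)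
      then have "\<bar>c i * (real n / real i)\<bar> * \<bar>\<Sum>is\<in>compositions i n. (\<Prod>j<i. x (is ! j)) - (\<Prod>j<i. y (is ! j))\<bar>
        \<le> \<bar>c i * (real n / real i)\<bar> * (real (card (compositions i n)) * (R ^ i * real i * S))"
        by (intro mult_left_mono) simp_all
      then show "\<bar>c i * (real n / real i) * (\<Sum>is\<in>compositions i n. (\<Prod>j<i. x (is ! j)) - (\<Prod>j<i. y (is ! j)))\<bar>
        \<le> \<bar>c i\<bar> * (real n / real i) * (real (card (compositions i n)) * (R ^ i * real i * S))"
        by (simp add: abs_mult)
    qed
  qed
  also have "\<dots> = merge_lipschitz c R n * S"
    by (simp add: merge_lipschitz_def distrib_right sum_distrib_right mult.assoc add.commute)
  finally show ?thesis unfolding S_def .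
qed

text \<open>A bound by 1 will follow only from the convergence; for the comparison, continuity on
  the compact interval \<open>{0..T}\<close> and finitely many indices suffice.\<close>

lemma limit_density_bounded:
  obtains R where "1 \<le> R" "\<And>n t. 1 \<le> n \<Longrightarrow> n \<le> m \<Longrightarrow> 0 \<le> t \<Longrightarrow> t \<le> T \<Longrightarrow> \<bar>limit_density lam n t\<bar> \<le> R"
proof -
  have "\<exists>B. \<forall>t\<in>{0..T}. \<bar>limit_density lam n t\<bar> \<le> B" if "1 \<le> n" for n
  proof -
    have "continuous_on {0..T} (limit_density lam n)"
      using limit_density_has_derivative[OF that] by (meson DERIV_isCont continuous_at_imp_continuous_on)
    then have "bounded (limit_density lam n ` {0..T})"
      by (intro compact_imp_bounded compact_continuous_image) auto
    then show ?thesis by (auto simp: bounded_iff)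
  qed
  then obtain B where B: "\<And>n t. 1 \<le> n \<Longrightarrow> t \<in> {0..T} \<Longrightarrow> \<bar>limit_density lam n t\<bar> \<le> B n" by metis
  show ?thesis
  proof (rule that[of "1 + (\<Sum>n=1..m. \<bar>B n\<bar>)"])
    show "1 \<le> 1 + (\<Sum>n=1..m. \<bar>B n\<bar>)" by (simp add: sum_nonneg)
    fix n and t :: real assume n: "1 \<le> n" "n \<le> m" "0 \<le> t" "t \<le> T"
    have "\<bar>limit_density lam n t\<bar> \<le> \<bar>B n\<bar>" using B[of n t] n by force
    also have "\<dots> \<le> (\<Sum>n=1..m. \<bar>B n\<bar>)" using n by (intro member_le_sum) auto
    finally show "\<bar>limit_density lam n t\<bar> \<le> 1 + (\<Sum>n=1..m. \<bar>B n\<bar>)" by simp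
  qed
qed

text \<open>Total error when the generator on the density of period \<open>n\<close> is replaced by
  \<open>merge_rate lam\<close>: coincidences of moved points, sampling without replacement, and the
  distance of the class ratios from \<open>lam\<close>.\<close>

definition density_error :: "(nat \<Rightarrow> real) \<Rightarrow> nat \<Rightarrow> nat \<Rightarrow> (nat \<Rightarrow> nat) set \<Rightarrow> real" where
  "density_error lam n N C =
      (3 * real n ^ 3) * (class_support N C / real N)
      + collision_weight n / real N
      + (\<Sum>i=2..n. \<bar>class_period N C i / class_support N C - lam i\<bar> * (real n / real i * real (card (compositions i n))))"

definition generator_error :: "(nat \<Rightarrow> real) \<Rightarrow> nat \<Rightarrow> nat \<Rightarrow> (nat \<Rightarrow> nat) set \<Rightarrow> real" where
  "generator_error lam m N C = (\<Sum>n=1..m. density_error lam n N C)"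

lemma class_seq_evanescent:
  assumes "class_seq_converges C lam 0"
  shows "(\<lambda>N. class_support N (C N) / real N) \<longlonglongrightarrow> 0"
proof -
  have "(\<lambda>N. 1 - class_period N (C N) 1 / real N) \<longlonglongrightarrow> 1 - (1 - 0)"
    using assms by (intro tendsto_intros) (simp add: class_seq_converges_def)
  then have "(\<lambda>N. 1 - class_period N (C N) 1 / real N) \<longlonglongrightarrow> 0" by simp
  then show ?thesis
    by (rule Lim_transform_eventually)
       (auto simp: eventually_sequentially class_support_def diff_divide_distrib intro!: exI[of _ 1])
qed

lemma generator_error_tendsto:
  assumes "class_seq_converges C lam 0"
  shows "(\<lambda>N. generator_error lam m N (C N)) \<longlonglongrightarrow> 0"
proof -
  have inv: "(\<lambda>N. a / real N) \<longlonglongrightarrow> 0" for a by real_asymp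
  have per: "(\<lambda>N. \<bar>class_period N (C N) i / class_support N (C N) - lam i\<bar>) \<longlonglongrightarrow> 0" if "2 \<le> i" for i
  proof -
    have "(\<lambda>N. class_period N (C N) i / class_support N (C N)) \<longlonglongrightarrow> lam i"
      using assms that by (simp add: class_seq_converges_def)
    then show ?thesis by (simp add: LIM_zero tendsto_rabs_zero)
  qed
  have "(\<lambda>N. generator_error lam m N (C N)) \<longlonglongrightarrow> (\<Sum>n=1..m. (3 * real n ^ 3) * 0 + 0 +
      (\<Sum>i=2..n. 0 * (real n / real i * real (card (compositions i n)))))"
    unfolding generator_error_def density_error_def
    by (intro tendsto_intros class_seq_evanescent[OF assms] inv per) auto
  then show ?thesis by simp
qed

text \<open>The densities of periods \<open>1\<close>, ..., \<open>m\<close> form a closed system,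
  so their squared deviations are summed and treated at once. \<open>\<delta>\<close> collects what
  will tend to 0, while \<open>L\<close> does not depend on \<open>N\<close>.\<close>

lemma period_density_deviation:
  assumes NC: "nontrivial_class N C" and rw: "random_walk N C M X"
    and R: "1 \<le> R" "\<And>n t. 1 \<le> n \<Longrightarrow> n \<le> m \<Longrightarrow> 0 \<le> t \<Longrightarrow> t \<le> T \<Longrightarrow> \<bar>limit_density lam n t\<bar> \<le> R"
    and T: "0 \<le> T" and n0: "1 \<le> n0" "n0 \<le> m"
  defines "L \<equiv> 2 * (\<Sum>n=1..m. merge_lipschitz lam R n) * real m + 1"
  defines "\<delta> \<equiv> real m * (2 * (1 + R) * generator_error lam m N C + (real m)\<^sup>2 * (class_support N C / real N))"
  shows "((\<integral>\<omega>. period_density N n0 (X T \<omega>) \<partial>M) - limit_density lam n0 T)\<^sup>2 \<le> \<delta> / L * (exp (L * T) - 1)"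
proof -
  interpret nontrivial_class N C by fact
  let ?E = "carrier (sym_group N)" and ?G = "walk_generator N C"
  have E: "?E = {p. p permutes U}" by (auto simp: sym_group_carrier)
  have finE: "finite ?E" unfolding E by (rule finite_permutations) simp
  have idE: "id \<in> ?E" unfolding E using permutes_id by blast
  obtain K where fs: "finite_semigroup ?E K ?G id"
    and KX: "\<And>t f. 0 \<le> t \<Longrightarrow> (\<integral>\<omega>. f (X t \<omega>) \<partial>M) = measure_pmf.expectation (K t id) (f :: _ \<Rightarrow> real)"
    using rw finE idE unfolding random_walk_def by (blast elim!: markov_process_expectation)
  interpret finite_semigroup ?E K ?G id by fact
  define x where "x = limit_density lam"
  define x' where "x' n t = merge_rate lam (\<lambda>n. limit_density lam n t) n" for n t
  define f where "f = period_density N"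
  define e where "e = generator_error lam m N C"
  define Lm where "Lm = (\<Sum>n=1..m. merge_lipschitz lam R n)"
  define v where "v = class_support N C / real N"
  have ml0: "0 \<le> merge_lipschitz lam R n" for n using R by (intro merge_lipschitz_nonneg) simp
  have Lm0: "0 \<le> Lm" unfolding Lm_def by (intro sum_nonneg ml0)
  \<comment> \<open>The summand 1 keeps \<open>L\<close> positive for the division by it; the factor
    \<open>m\<close> is the price of Cauchy-Schwarz when the square of the summed deviations is
    bounded by the sum of squares.\<close>
  have L: "L = 2 * Lm * real m + 1" by (simp add: L_def Lm_def)
  have Lpos: "0 < L" unfolding L using Lm0 by (simp add: add_nonneg_pos)
  have v0: "0 \<le> v" using class_support_eq by (simp add: v_def)
  have e_ge: "density_error lam n N C \<le> e" if "n \<in> {1..m}" for n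
    unfolding e_def generator_error_def density_error_def v_def [symmetric]
    using that by (intro member_le_sum) (auto intro!: add_nonneg_nonneg sum_nonneg divide_nonneg_nonneg mult_nonneg_nonneg v0)
  have "mean T (\<lambda>b. \<Sum>n\<in>{1..m}. (f n b - x n T)\<^sup>2) \<le> \<delta> / L * (exp (L * T) - 1)"
  proof (rule mean_square_deviation_le[where x' = x'])
    show "(x n has_real_derivative x' n t) (at t)" if "n \<in> {1..m}" for n t
      unfolding x_def x'_def using that by (intro limit_density_has_derivative) simp
    show "f n id = x n 0" if "n \<in> {1..m}" for n
      using that N by (simp add: f_def x_def period_density_id limit_density_0)
  next
    fix t and b :: "nat \<Rightarrow> nat" assume t: "0 < t" "t < T" and b: "b \<in> ?E"
    have bp: "b permutes U" using b by (simp add: sym_group_carrier)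
    define S where "S = (\<Sum>k\<in>{1..m}. \<bar>f k b - x k t\<bar>)"
    have f01: "0 \<le> f n b" "f n b \<le> 1" for n unfolding f_def by (rule period_density_bounds)+
    have xR: "\<bar>x n t\<bar> \<le> R" if "1 \<le> n" "n \<le> m" for n using R(2)[OF that] t by (simp add: x_def)
    have bnd: "deviation_drift ?G (f n) (x n t) (x' n t) b
      \<le> 2 * Lm * (\<bar>f n b - x n t\<bar> * S) + (2 * (1 + R) * e + (real m)\<^sup>2 * v)" if n: "n \<in> {1..m}" for n
    proof -
      let ?cN = "\<lambda>i. class_period N C i / class_support N C"
      \<comment> \<open>A crude bound, so that the product of deviation and generator error is
        linear in \<open>e\<close> and can go into \<open>\<delta>\<close>.\<close>
      have d: "\<bar>f n b - x n t\<bar> \<le> 1 + R" using f01[of n] xR[of n] n by auto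
      have "\<bar>?G (f n) b - merge_rate ?cN (\<lambda>k. f k b) n\<bar>
         \<le> (3 * real n ^ 3) * v + collision_weight n / real N"
        unfolding f_def v_def by (rule generator_period_density[OF bp])
      moreover have "\<bar>merge_rate ?cN (\<lambda>k. f k b) n - merge_rate lam (\<lambda>k. f k b) n\<bar>
        \<le> (\<Sum>i=2..n. \<bar>?cN i - lam i\<bar> * (real n / real i * real (card (compositions i n))))"
        by (rule merge_rate_coeff_diff) (rule f01)+
      ultimately have 1: "\<bar>?G (f n) b - merge_rate lam (\<lambda>k. f k b) n\<bar> \<le> e"
        using e_ge[OF n] unfolding density_error_def v_def [symmetric] by linarith
      have "\<bar>merge_rate lam (\<lambda>k. f k b) n - merge_rate lam (\<lambda>k. x k t) n\<bar>
        \<le> merge_lipschitz lam R n * (\<Sum>k=1..n. \<bar>f k b - x k t\<bar>)"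
      proof (rule merge_rate_lipschitz[OF R(1)])
        show "\<bar>f k b\<bar> \<le> R" for k using f01[of k] R(1) by simp
        show "\<bar>x k t\<bar> \<le> R" if "1 \<le> k" "k \<le> n" for k using xR that n by simp
      qed (use n in simp)
      also have "\<dots> \<le> Lm * S"
      proof (rule mult_mono)
        show "merge_lipschitz lam R n \<le> Lm"
          unfolding Lm_def using n ml0 by (intro member_le_sum) auto
        show "(\<Sum>k=1..n. \<bar>f k b - x k t\<bar>) \<le> S"
          unfolding S_def using n by (intro sum_mono2) auto
      qed (auto intro: Lm0 sum_nonneg)
      finally have 2: "\<bar>merge_rate lam (\<lambda>k. f k b) n - x' n t\<bar> \<le> Lm * S" by (simp add: x'_def x_def)
      have e0: "0 \<le> e" using 1 by linarith
      have "(f n b - x n t) * (?G (f n) b - x' n t) \<le> \<bar>f n b - x n t\<bar> * \<bar>?G (f n) b - x' n t\<bar>"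
        by (simp add: abs_mult [symmetric])
      also have "\<dots> \<le> \<bar>f n b - x n t\<bar> * (e + Lm * S)"
        using 1 2 by (intro mult_left_mono) auto
      also have "\<dots> \<le> (1 + R) * e + Lm * (\<bar>f n b - x n t\<bar> * S)"
        using mult_right_mono[OF d e0] by (simp add: algebra_simps)
      finally have 3: "2 * (f n b - x n t) * (?G (f n) b - x' n t) \<le> 2 * (1 + R) * e + 2 * Lm * (\<bar>f n b - x n t\<bar> * S)"
        by (simp add: algebra_simps)
      have "?G (\<lambda>b. (f n b)\<^sup>2) b - 2 * f n b * ?G (f n) b \<le> (real n)\<^sup>2 * v"
        unfolding f_def v_def by (rule generator_square[OF bp])
      also have "\<dots> \<le> (real m)\<^sup>2 * v"
        using n v0 by (intro mult_right_mono power_mono) auto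
      finally show ?thesis using 3 by linarith
    qed
    have "(\<Sum>n\<in>{1..m}. deviation_drift ?G (f n) (x n t) (x' n t) b)
      \<le> (\<Sum>n\<in>{1..m}. 2 * Lm * (\<bar>f n b - x n t\<bar> * S) + (2 * (1 + R) * e + (real m)\<^sup>2 * v))"
      by (rule sum_mono) (rule bnd)
    also have "\<dots> = 2 * Lm * ((\<Sum>n\<in>{1..m}. \<bar>f n b - x n t\<bar>) * S) + \<delta>"
      by (simp add: sum.distrib sum_distrib_left [symmetric] sum_distrib_right [symmetric] \<delta>_def e_def v_def)
    also have "\<dots> = 2 * Lm * S\<^sup>2 + \<delta>"
      by (simp only: S_def [symmetric] power2_eq_square)
    also have "S\<^sup>2 \<le> (\<Sum>n\<in>{1..m}. (f n b - x n t)\<^sup>2) * real m"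
      using sum_squared_le_sum_of_squares[of "\<lambda>n. \<bar>f n b - x n t\<bar>" "{1..m}"] by (simp add: S_def)
    then have "2 * Lm * S\<^sup>2 + \<delta> \<le> 2 * Lm * ((\<Sum>n\<in>{1..m}. (f n b - x n t)\<^sup>2) * real m) + \<delta>"
      using Lm0 by (intro add_right_mono mult_left_mono) auto
    also have "\<dots> \<le> L * (\<Sum>n\<in>{1..m}. (f n b - x n t)\<^sup>2) + \<delta>"
      unfolding L by (simp add: algebra_simps sum_nonneg)
    finally show "(\<Sum>n\<in>{1..m}. deviation_drift ?G (f n) (x n t) (x' n t) b)
       \<le> L * (\<Sum>n\<in>{1..m}. (f n b - x n t)\<^sup>2) + \<delta>" .
  qed (use Lpos T in auto)
  moreover have "(mean T (f n0) - x n0 T)\<^sup>2 \<le> mean T (\<lambda>b. (f n0 b - x n0 T)\<^sup>2)"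
    by (rule mean_square_ge[OF T])
  moreover have "mean T (\<lambda>b. (f n0 b - x n0 T)\<^sup>2) \<le> mean T (\<lambda>b. \<Sum>n\<in>{1..m}. (f n b - x n T)\<^sup>2)"
    by (rule mean_mono, rule member_le_sum[of n0 "{1..m}" "\<lambda>n. (f n b - x n T)\<^sup>2" for b]) (use n0 in auto)
  ultimately have "(mean T (f n0) - x n0 T)\<^sup>2 \<le> \<delta> / L * (exp (L * T) - 1)"
    by linarith
  then show ?thesis
    unfolding KX[OF T] expectation_eq_mean[OF T] f_def x_def .
qed

text \<open>\<open>period_density_deviation\<close> is applied with \<open>m = n\<close>;
  \<open>L\<close> and \<open>R\<close> do not depend on \<open>N\<close>, so the squared error is
  at most a constant times \<open>\<delta> N\<close>.\<close>

lemma expected_period_density_tendsto: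
  assumes "\<And>N. N \<ge> 2 \<Longrightarrow> nontrivial_class N (C N)"
    and conv: "class_seq_converges C lam 0"
    and "\<And>N. N \<ge> 2 \<Longrightarrow> random_walk N (C N) (M N) (S N)"
    and n: "1 \<le> n" and t: "0 \<le> t"
  shows "(\<lambda>N. \<integral>\<omega>. period_density N n (S N t \<omega>) \<partial>M N) \<longlonglongrightarrow> limit_density lam n t"
proof -
  obtain R where R: "1 \<le> R" "\<And>k s. 1 \<le> k \<Longrightarrow> k \<le> n \<Longrightarrow> 0 \<le> s \<Longrightarrow> s \<le> t \<Longrightarrow> \<bar>limit_density lam k s\<bar> \<le> R"
    using limit_density_bounded[of n t lam] by blast
  define L where "L = 2 * (\<Sum>k=1..n. merge_lipschitz lam R k) * real n + 1"
  define \<delta> where "\<delta> N = real n * (2 * (1 + R) * generator_error lam n N (C N) + (real n)\<^sup>2 * (class_support N (C N) / real N))" for N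
  define d where "d N = (\<integral>\<omega>. period_density N n (S N t \<omega>) \<partial>M N) - limit_density lam n t" for N
  have "\<delta> \<longlonglongrightarrow> real n * (2 * (1 + R) * 0 + (real n)\<^sup>2 * 0)"
    unfolding \<delta>_def by (intro tendsto_intros generator_error_tendsto[OF conv] class_seq_evanescent[OF conv])
  then have "\<delta> \<longlonglongrightarrow> 0" by simp
  then have lim: "(\<lambda>N. \<delta> N * (1 / L * (exp (L * t) - 1))) \<longlonglongrightarrow> 0"
    by (rule tendsto_mult_left_zero)
  have "\<forall>\<^sub>F N in sequentially. norm ((d N)\<^sup>2) \<le> \<delta> N * (1 / L * (exp (L * t) - 1))"
    using eventually_ge_at_top[of 2]
  proof eventually_elim
    fix N :: nat assume N: "2 \<le> N"
    have "(d N)\<^sup>2 \<le> \<delta> N / L * (exp (L * t) - 1)"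
      unfolding d_def \<delta>_def L_def
      by (rule period_density_deviation[OF assms(1)[OF N] assms(3)[OF N] R t n order_refl])
    then show "norm ((d N)\<^sup>2) \<le> \<delta> N * (1 / L * (exp (L * t) - 1))" by simp
  qed
  from Lim_null_comparison[OF this lim] have "(\<lambda>N. (d N)\<^sup>2) \<longlonglongrightarrow> 0" .
  then have "d \<longlonglongrightarrow> 0" by simp
  then show ?thesis unfolding d_def by (simp add: LIM_zero_iff)
qed

section \<open>Eigenvalues of permutation matrices\<close>

definition mat_trace :: "'a :: comm_ring_1 mat \<Rightarrow> 'a" where
  "mat_trace A = (\<Sum>i<dim_row A. A $$ (i, i))"

lemma mat_trace_mult_comm:
  assumes A: "A \<in> carrier_mat n n" and B: "B \<in> carrier_mat n n"
  shows "mat_trace (A * B) = mat_trace (B * A)"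
proof -
  have "mat_trace (A * B) = (\<Sum>i<n. \<Sum>k<n. A $$ (i, k) * B $$ (k, i))"
    using A B by (auto simp: mat_trace_def scalar_prod_def atLeast0LessThan intro!: sum.cong)
  also have "\<dots> = (\<Sum>k<n. \<Sum>i<n. B $$ (k, i) * A $$ (i, k))"
    by (subst sum.swap) (simp add: mult.commute)
  also have "\<dots> = mat_trace (B * A)"
    using A B by (auto simp: mat_trace_def scalar_prod_def atLeast0LessThan intro!: sum.cong)
  finally show ?thesis .
qed

lemma upper_triangular_pow:
  fixes B :: "'a :: comm_ring_1 mat"
  assumes B: "B \<in> carrier_mat n n" and ut: "upper_triangular B"
  shows "(\<forall>i<n. \<forall>j<i. (B ^\<^sub>m k) $$ (i, j) = 0) \<and> (\<forall>i<n. (B ^\<^sub>m k) $$ (i, i) = (B $$ (i, i)) ^ k)"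
proof (induction k)
  case 0
  then show ?case using B by auto
next
  case (Suc k)
  have Bk: "B ^\<^sub>m k \<in> carrier_mat n n" using B by simp
  have mult: "(B ^\<^sub>m Suc k) $$ (i, j) = (\<Sum>l<n. (B ^\<^sub>m k) $$ (i, l) * B $$ (l, j))" if "i < n" "j < n" for i j
    using that B Bk by (simp add: scalar_prod_def atLeast0LessThan)
  have z: "(B ^\<^sub>m k) $$ (i, l) * B $$ (l, j) = 0" if "i < n" "l < n" "l < i \<or> j < l" for i j l
    using that(3)
  proof
    assume "l < i"
    then show ?thesis using that(1) Suc by simp
  next
    assume "j < l"
    then show ?thesis using upper_triangularD[OF ut, of j l] that(2) B by simp
  qed
  show ?case
  proof (intro conjI allI impI)
    fix i j assume "i < n" "j < i"
    then show "(B ^\<^sub>m Suc k) $$ (i, j) = 0"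
      by (subst mult) (auto intro!: sum.neutral z)
  next
    fix i assume i: "i < n"
    have "(B ^\<^sub>m Suc k) $$ (i, i) = (\<Sum>l\<in>{i}. (B ^\<^sub>m k) $$ (i, l) * B $$ (l, i))"
      unfolding mult[OF i i] using i by (intro sum.mono_neutral_right) (auto intro!: z)
    then show "(B ^\<^sub>m Suc k) $$ (i, i) = (B $$ (i, i)) ^ Suc k"
      using Suc i by (simp add: mult.commute)
  qed
qed

text \<open>Schur triangularisation: over the complex numbers the characteristic polynomial splits,
  and the diagonal of the triangular form lists its roots with multiplicity.\<close>

lemma proots_char_poly:
  fixes A :: "complex mat"
  assumes A: "A \<in> carrier_mat n n"
  obtains B P Q where "similar_mat_wit A B P Q" "upper_triangular B" "B \<in> carrier_mat n n"
    "proots (char_poly A) = image_mset (\<lambda>i. B $$ (i, i)) (mset_set {..<n})"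
proof -
  obtain es where es: "char_poly A = (\<Prod>a\<leftarrow>es. [:- a, 1:])" and len: "length es = n"
    using char_poly_factorized[OF A] by blast
  obtain B P Q where sd: "schur_decomposition A es = (B, P, Q)" by (cases "schur_decomposition A es")
  from schur_decomposition[OF A es sd]
  have sim: "similar_mat_wit A B P Q" and ut: "upper_triangular B" and diag: "diag_mat B = es" by auto
  have B: "B \<in> carrier_mat n n" using similar_mat_witD2[OF A sim] by auto
  have "proots (\<Prod>a\<leftarrow>es. [:- a, 1:]) = mset es"
  proof (induction es)
    case (Cons a es)
    have nz: "(\<Prod>a\<leftarrow>es. [:- a, 1:]) \<noteq> 0" by (simp add: prod_list_zero_iff) auto
    have "proots ([:- a, 1:] * (\<Prod>a\<leftarrow>es. [:- a, 1:])) = proots [:- a, 1:] + proots (\<Prod>a\<leftarrow>es. [:- a, 1:])"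
      by (rule proots_mult) (use nz in auto)
    then show ?case by (simp only: list.map prod_list.Cons Cons.IH proots_linear_factor) simp
  qed simp
  moreover have "mset es = image_mset (\<lambda>i. B $$ (i, i)) (mset_set {..<n})"
    using B unfolding diag [symmetric] diag_mat_def
    by (simp add: atLeast0LessThan [symmetric] flip: mset_upt)
  ultimately show ?thesis using that[OF sim ut B] es by simp
qed

lemma perm_matrix_carrier: "perm_matrix N p \<in> carrier_mat N N"
  by (simp add: perm_matrix_def)

lemma perm_matrix_mult:
  assumes "p' permutes {1..N}"
  shows "perm_matrix N p * perm_matrix N p' = perm_matrix N (p \<circ> p')"
proof (rule eq_matI)
  fix i j assume "i < dim_row (perm_matrix N (p \<circ> p'))" "j < dim_col (perm_matrix N (p \<circ> p'))"
  then have ij: "i < N" "j < N" by (auto simp: perm_matrix_def)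
  have "p' (j + 1) \<in> {1..N}" using permutes_in_image[OF assms] ij by auto
  then obtain l0 where l0: "p' (j + 1) = l0 + 1" "l0 < N"
    by (metis Suc_eq_plus1 Suc_le_eq atLeastAtMost_iff not0_implies_Suc not_one_le_zero)
  have "(perm_matrix N p * perm_matrix N p') $$ (i, j)
      = (\<Sum>l<N. (if p (l + 1) = i + 1 then 1 else 0) * (if p' (j + 1) = l + 1 then 1 else 0))"
    using ij by (simp add: perm_matrix_def scalar_prod_def atLeast0LessThan)
  also have "\<dots> = (\<Sum>l<N. if l = l0 then (if p (l0 + 1) = i + 1 then 1 else 0) else 0)"
    using l0 by (intro sum.cong) auto
  also have "\<dots> = perm_matrix N (p \<circ> p') $$ (i, j)"
    using ij l0 by (simp add: perm_matrix_def)
  finally show "(perm_matrix N p * perm_matrix N p') $$ (i, j) = perm_matrix N (p \<circ> p') $$ (i, j)" .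
qed (simp_all add: perm_matrix_def)

lemma perm_matrix_pow:
  assumes "p permutes {1..N}"
  shows "perm_matrix N p ^\<^sub>m k = perm_matrix N (p ^^ k)"
proof (induction k)
  case 0
  show ?case by (rule eq_matI) (auto simp: perm_matrix_def)
next
  case (Suc k)
  then show ?case by (simp only: pow_mat.simps perm_matrix_mult[OF assms] funpow_Suc_right)
qed

lemma mat_trace_perm_matrix: "mat_trace (perm_matrix N p) = of_nat (card {j\<in>{1..N}. p j = j})"
proof -
  have "mat_trace (perm_matrix N p) = (\<Sum>i<N. if p (i + 1) = i + 1 then 1 else 0)"
    by (simp add: mat_trace_def perm_matrix_def)
  also have "\<dots> = (\<Sum>j\<in>{1..N}. if p j = j then 1 else 0)"
    by (rule sum.reindex_bij_witness[where i = "\<lambda>j. j - 1" and j = "\<lambda>i. i + 1"]) auto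
  also have "\<dots> = of_nat (card {j\<in>{1..N}. p j = j})"
    by (simp add: sum.If_cases Int_def)
  finally show ?thesis .
qed

text \<open>The power sum of the eigenvalues is the trace of the matrix power, computed once on the
  triangular form and once on the permutation matrix of \<open>p ^^ k\<close>. Eigenvalues are roots
  of unity because some power of \<open>p\<close> is the identity.\<close>

lemma proots_perm_matrix:
  assumes p: "p permutes {1..N}"
  defines "R \<equiv> proots (char_poly (perm_matrix N p))"
  shows "size R = N" and "\<And>z. z \<in># R \<Longrightarrow> norm z = 1"
    and "\<Sum>\<^sub># (image_mset (\<lambda>z. z ^ k) R) = of_nat (card {j\<in>{1..N}. (p ^^ k) j = j})"
proof -
  let ?A = "perm_matrix N p"
  obtain B P Q where sim: "similar_mat_wit ?A B P Q" and ut: "upper_triangular B"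
    and B: "B \<in> carrier_mat N N" and R: "R = image_mset (\<lambda>i. B $$ (i, i)) (mset_set {..<N})"
    unfolding R_def using proots_char_poly[OF perm_matrix_carrier] by blast
  note simD = similar_mat_witD2[OF perm_matrix_carrier sim]
  have Ak: "perm_matrix N (p ^^ k) = P * B ^\<^sub>m k * Q" for k
    using similar_mat_wit_pow_id[OF sim, of k] by (simp add: perm_matrix_pow[OF p])
  have Bk: "B ^\<^sub>m k \<in> carrier_mat N N" for k using B by simp
  have diag: "(B ^\<^sub>m k) $$ (i, i) = (B $$ (i, i)) ^ k" if "i < N" for i k
    using upper_triangular_pow[OF B ut, of k] that by blast
  show "size R = N" by (simp add: R)
  show "\<Sum>\<^sub># (image_mset (\<lambda>z. z ^ k) R) = of_nat (card {j\<in>{1..N}. (p ^^ k) j = j})"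
  proof -
    have "mat_trace (P * B ^\<^sub>m k * Q) = mat_trace (Q * (P * B ^\<^sub>m k))"
      using simD Bk by (intro mat_trace_mult_comm[of _ N]) auto
    also have "Q * (P * B ^\<^sub>m k) = (Q * P) * B ^\<^sub>m k"
      using simD Bk by (intro assoc_mult_mat[symmetric]) auto
    also have "\<dots> = B ^\<^sub>m k" using simD Bk by simp
    finally have "mat_trace (B ^\<^sub>m k) = of_nat (card {j\<in>{1..N}. (p ^^ k) j = j})"
      by (simp add: Ak [symmetric] mat_trace_perm_matrix)
    moreover have "mat_trace (B ^\<^sub>m k) = (\<Sum>i<N. (B $$ (i, i)) ^ k)"
      using B diag by (simp add: mat_trace_def)
    ultimately show ?thesis by (simp add: R sum_unfold_sum_mset image_mset.compositionality comp_def)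
  qed
  fix z assume "z \<in># R"
  then obtain i where i: "i < N" "z = B $$ (i, i)" by (auto simp: R)
  have "permutation p" using p by (auto simp: permutation_permutes)
  from permutation_is_nilpotent[OF this] obtain k where k: "p ^^ k = id" "k > 0" by blast
  have "perm_matrix N id = 1\<^sub>m N" by (rule eq_matI) (auto simp: perm_matrix_def)
  then have PBQ: "P * B ^\<^sub>m k * Q = 1\<^sub>m N" using Ak[of k] k by simp
  have carr: "P \<in> carrier_mat N N" "Q \<in> carrier_mat N N" and QP: "Q * P = 1\<^sub>m N" using simD by auto
  define D where "D = B ^\<^sub>m k"
  have D: "D \<in> carrier_mat N N" unfolding D_def by (rule Bk)
  have "Q * (P * D * Q) = Q * (P * (D * Q))"
    using assoc_mult_mat[OF carr(1) D carr(2)] by simp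
  also have "\<dots> = (Q * P) * (D * Q)"
    using assoc_mult_mat[OF carr(2) carr(1) mult_carrier_mat[OF D carr(2)]] by simp
  also have "\<dots> = D * Q" unfolding QP using D carr by simp
  finally have "Q * (P * D * Q) * P = D * (Q * P)"
    using assoc_mult_mat[OF D carr(2) carr(1)] by simp
  then have "D = Q * (P * D * Q) * P" unfolding QP using D by simp
  also have "\<dots> = 1\<^sub>m N" unfolding D_def PBQ using carr QP by simp
  finally have "(B ^\<^sub>m k) $$ (i, i) = 1" unfolding D_def using i by simp
  then have "z ^ k = 1" using diag[OF i(1), of k] i by simp
  then have "norm z ^ k = 1" by (simp flip: norm_power)
  then show "norm z = 1" using k power_eq_imp_eq_base[of "norm z" k 1] by simp
qed

text \<open>A point is fixed by \<open>p ^^ n\<close> exactly if its period divides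
  \<open>n\<close>; this is the source of the divisor sum.\<close>

lemma card_fixed_funpow:
  assumes p: "p permutes {1..N}" and n: "1 \<le> n"
  shows "card {j\<in>{1..N}. (p ^^ n) j = j} = (\<Sum>d | d dvd n. num_period N p d)"
proof -
  have perm: "permutation p" using p by (auto simp: permutation_permutes)
  have fin: "finite {d. d dvd n}" using n by simp
  have "{j\<in>{1..N}. (p ^^ n) j = j} = (\<Union>d\<in>{d. d dvd n}. {j\<in>{1..N}. least_power p j = d})"
    by (auto simp: least_power_dvd[OF perm, symmetric])
  then show ?thesis unfolding num_period_def
    using fin by (subst card_UN_disjoint [symmetric]) auto
qed

section \<open>Weak convergence on the unit circle\<close>

text \<open>Radial projection onto the closed unit disc; \<open>max 1\<close> keeps the denominator
  away from 0, so that it is continuous at the origin as well.\<close>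

definition circle_retract :: "complex \<Rightarrow> complex" where
  "circle_retract z = z / of_real (max 1 (norm z))"

text \<open>Extends \<open>z\<^sup>k\<close> from the unit circle to a bounded continuous function on the plane, as required
  of the test functions for weak convergence.\<close>
definition cpow :: "int \<Rightarrow> complex \<Rightarrow> complex" where
  "cpow k z = (if 0 \<le> k then circle_retract z ^ nat k else cnj (circle_retract z) ^ nat (- k))"

definition moment :: "complex measure \<Rightarrow> int \<Rightarrow> complex" where
  "moment \<nu> k = (\<integral>z. cpow k z \<partial>\<nu>)"

lemma norm_cpow_le: "norm (cpow k z) \<le> 1"
proof -
  have "norm (circle_retract z) \<le> 1"
    by (simp add: circle_retract_def norm_divide divide_le_eq)
  then show ?thesis by (simp add: cpow_def norm_power power_le_one)
qed

lemma continuous_cpow: "continuous_on UNIV (cpow k)"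
proof -
  have "complex_of_real (max 1 (norm z)) \<noteq> 0" for z :: complex
    unfolding of_real_eq_0_iff by (auto simp: max_def)
  then have "continuous_on UNIV circle_retract"
    unfolding circle_retract_def by (intro continuous_intros) blast+
  then show ?thesis
    unfolding cpow_def[abs_def] by (cases "0 \<le> k") (auto intro!: continuous_intros)
qed

lemma cpow_circle:
  assumes "norm z = 1"
  shows "cpow k z = z powi k"
proof -
  have "circle_retract z = z" using assms by (simp add: circle_retract_def)
  moreover have "cnj z = inverse z" using assms by (simp add: inverse_complex_def complex_norm cmod_def complex_eq_iff)
  ultimately show ?thesis by (simp add: cpow_def power_int_def)
qed

lemma cpow_uminus: "cpow (- k) z = cnj (cpow k z)"
  by (cases "k = 0") (auto simp: cpow_def)

context
  fixes \<nu> :: "complex measure"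
  assumes \<nu>: "circle_prob \<nu>"
begin

lemma circle_prob_space: "prob_space \<nu>" and circle_sets: "sets \<nu> = sets borel"
  using \<nu> by (simp_all add: circle_prob_def)

lemma circle_AE: "AE z in \<nu>. norm z = 1"
proof -
  interpret prob_space \<nu> by (rule circle_prob_space)
  have "prob (sphere 0 1) = 1" using \<nu> by (simp add: circle_prob_def measure_def)
  from AE_prob_1[OF this] show ?thesis by simp
qed

lemma circle_measurable:
  "continuous_on UNIV (f :: complex \<Rightarrow> 'b :: {banach, second_countable_topology}) \<Longrightarrow> f \<in> borel_measurable \<nu>"
  using borel_measurable_continuous_onI[of f] measurable_cong_sets[OF circle_sets refl] by blast

lemma circle_integrable:
  fixes f :: "complex \<Rightarrow> 'b :: {banach, second_countable_topology}"
  assumes "continuous_on UNIV f" "bounded (range f)"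
  shows "integrable \<nu> f"
proof -
  interpret prob_space \<nu> by (rule circle_prob_space)
  obtain B where "\<And>z. norm (f z) \<le> B" using assms(2) by (auto simp: bounded_iff)
  then show ?thesis using circle_measurable[OF assms(1)] by (intro integrable_const_bound[of _ B]) auto
qed

lemma integrable_cpow: "integrable \<nu> (cpow k)"
  by (rule circle_integrable[OF continuous_cpow]) (auto simp: bounded_iff intro: exI[of _ 1] norm_cpow_le)

lemma moment_uminus: "moment \<nu> (- k) = cnj (moment \<nu> k)"
  by (simp add: moment_def cpow_uminus)

lemma moment_0: "moment \<nu> 0 = 1"
proof -
  interpret prob_space \<nu> by (rule circle_prob_space)
  show ?thesis by (simp add: moment_def cpow_def prob_space)
qed

lemma norm_moment_le: "norm (moment \<nu> k) \<le> 1"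
proof -
  interpret prob_space \<nu> by (rule circle_prob_space)
  have "norm (moment \<nu> k) \<le> (\<integral>z. norm (cpow k z) \<partial>\<nu>)" unfolding moment_def by (rule integral_norm_bound)
  also have "\<dots> \<le> (\<integral>z. 1 \<partial>\<nu>)"
    using integrable_cpow by (intro integral_mono) (auto simp: norm_cpow_le)
  finally show ?thesis by (simp add: prob_space)
qed

text \<open>The circle carries full mass, so neither the restriction of the integral to it nor the
  bounded extension of the power changes the value.\<close>

lemma moment_eq_set_integral: "(LINT z:sphere 0 1|\<nu>. z ^ n) = moment \<nu> (int n)"
  unfolding moment_def set_lebesgue_integral_def
proof (rule integral_cong_AE)
  show "AE z in \<nu>. indicat_real (sphere 0 1) z *\<^sub>R z ^ n = cpow (int n) z"
    using circle_AE by eventually_elim (simp add: cpow_circle)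
  have [measurable]: "sphere (0 :: complex) 1 \<in> sets borel" by (simp add: borel_closed)
  have "(\<lambda>z::complex. indicat_real (sphere 0 1) z *\<^sub>R z ^ n) \<in> borel_measurable borel" by measurable
  then show "(\<lambda>z. indicat_real (sphere 0 1) z *\<^sub>R z ^ n) \<in> borel_measurable \<nu>"
    using measurable_cong_sets[OF circle_sets refl] by blast
qed (rule circle_measurable[OF continuous_cpow])

end

text \<open>Trigonometric polynomials as lists of coefficients and frequencies, repetitions allowed;
  sums are then concatenations, and products run over pairs of entries.\<close>

definition trig :: "(complex \<times> int) list \<Rightarrow> complex \<Rightarrow> complex" where
  "trig L z = (\<Sum>(c, k)\<leftarrow>L. c * cpow k z)"

lemma trig_mult:
  assumes "norm z = 1"
  shows "trig (concat (map (\<lambda>(c, k). map (\<lambda>(c', k'). (c * c', k + k')) L') L)) z = trig L z * trig L' z"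
proof -
  have z: "z \<noteq> 0" using assms by auto
  have "trig (map (\<lambda>(c', k'). (c * c', k + k')) L') z = c * cpow k z * trig L' z" for c k
    by (induction L') (auto simp: trig_def cpow_circle[OF assms] power_int_add z algebra_simps)
  then show ?thesis
    by (induction L) (auto simp: trig_def distrib_right)
qed

text \<open>On the circle \<open>Re z\<close> and \<open>Im z\<close> are combinations of
  \<open>z\<close> and its conjugate, which has frequency -1; this settles linear functions, and
  closure under sums and products does the rest.\<close>

lemma real_polynomial_function_trig:
  assumes "real_polynomial_function (g :: complex \<Rightarrow> real)"
  shows "\<exists>L. \<forall>z. norm z = 1 \<longrightarrow> complex_of_real (g z) = trig L z"
  using assms
proof induction
  case (linear f)
  interpret bounded_linear f by fact
  have "complex_of_real (f z) = trig [((f 1 - \<i> * f \<i>) / 2, 1), ((f 1 + \<i> * f \<i>) / 2, -1)] z"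
    if "norm z = 1" for z
  proof -
    have "f z = f (Re z *\<^sub>R 1 + Im z *\<^sub>R \<i>)" by (rule arg_cong[of _ _ f]) (simp add: complex_eq_iff)
    then have "f z = Re z * f 1 + Im z * f \<i>" by (simp add: add scaleR)
    moreover have "circle_retract z = z" using that by (simp add: circle_retract_def)
    ultimately show ?thesis by (simp add: trig_def cpow_def complex_eq_iff field_simps)
  qed
  then show ?case by blast
next
  case (const c)
  have "complex_of_real c = trig [(complex_of_real c, 0)] z" for z by (simp add: trig_def cpow_def)
  then show ?case by blast
next
  case (add f g)
  then obtain L L' where "\<forall>z. norm z = 1 \<longrightarrow> complex_of_real (f z) = trig L z"
    "\<forall>z. norm z = 1 \<longrightarrow> complex_of_real (g z) = trig L' z" by blast
  then have "\<forall>z. norm z = 1 \<longrightarrow> complex_of_real (f z + g z) = trig (L @ L') z"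
    by (simp add: trig_def)
  then show ?case by blast
next
  case (mult f g)
  then obtain L L' where "\<forall>z. norm z = 1 \<longrightarrow> complex_of_real (f z) = trig L z"
    "\<forall>z. norm z = 1 \<longrightarrow> complex_of_real (g z) = trig L' z" by blast
  then have "\<forall>z. norm z = 1 \<longrightarrow> complex_of_real (f z * g z)
      = trig (concat (map (\<lambda>(c, k). map (\<lambda>(c', k'). (c * c', k + k')) L') L)) z"
    by (simp add: trig_mult)
  then show ?case by blast
qed

lemma continuous_trig: "continuous_on UNIV (trig L)"
  unfolding trig_def[abs_def]
  by (induction L) (auto intro!: continuous_intros continuous_cpow)

lemma bounded_trig: "bounded (range (trig L))"
proof -
  have "norm (trig L z) \<le> (\<Sum>(c, k)\<leftarrow>L. norm c)" for z
  proof (induction L)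
    case (Cons a L)
    obtain c k where a: "a = (c, k)" by force
    have "norm (trig (a # L) z) \<le> norm (c * cpow k z) + norm (trig L z)"
      by (simp add: trig_def a norm_triangle_ineq)
    also have "\<dots> \<le> norm c * 1 + (\<Sum>(c, k)\<leftarrow>L. norm c)"
      unfolding norm_mult by (intro add_mono mult_left_mono norm_cpow_le Cons) auto
    finally show ?case by (simp add: a)
  qed (simp add: trig_def)
  then show ?thesis by (auto simp: bounded_iff)
qed

lemma integral_trig:
  assumes "circle_prob \<nu>"
  shows "(\<integral>z. trig L z \<partial>\<nu>) = (\<Sum>(c, k)\<leftarrow>L. c * moment \<nu> k)"
proof (induction L)
  case (Cons a L)
  obtain c k where a: "a = (c, k)" by force
  have "(\<integral>z. trig (a # L) z \<partial>\<nu>) = (\<integral>z. c * cpow k z + trig L z \<partial>\<nu>)"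
    by (simp add: trig_def a)
  also have "\<dots> = c * moment \<nu> k + (\<integral>z. trig L z \<partial>\<nu>)"
    unfolding moment_def
    using integrable_cpow[OF assms] circle_integrable[OF assms continuous_trig bounded_trig]
    by (subst Bochner_Integration.integral_add) auto
  finally show ?case using Cons by (simp add: a)
qed (simp add: trig_def)

text \<open>Stone-Weierstrass on the circle reduces a test function to a trigonometric polynomial,
  whose integral is a finite combination of moments. Negative moments are conjugates of positive
  ones and the zeroth is 1.\<close>

lemma weakly_convergesI_moments:
  assumes \<nu>: "\<And>N. N \<ge> N0 \<Longrightarrow> circle_prob (\<nu> N)" and \<mu>: "circle_prob \<mu>"
    and mom: "\<And>n. n \<ge> 1 \<Longrightarrow> (\<lambda>N. moment (\<nu> N) (int n)) \<longlonglongrightarrow> moment \<mu> (int n)"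
  shows "weakly_converges \<nu> \<mu>"
  unfolding weakly_converges_def
proof (intro allI impI)
  fix f :: "complex \<Rightarrow> real" assume f: "continuous_on UNIV f \<and> bounded (range f)"
  have ev: "\<forall>\<^sub>F N in sequentially. circle_prob (\<nu> N)"
    using \<nu> by (auto simp: eventually_sequentially)
  have momk: "(\<lambda>N. moment (\<nu> N) k) \<longlonglongrightarrow> moment \<mu> k" for k
  proof (cases "k = 0")
    case True
    have "\<forall>\<^sub>F N in sequentially. moment \<mu> k = moment (\<nu> N) k"
      using ev by eventually_elim (simp add: True moment_0 \<mu>)
    then show ?thesis by (rule Lim_transform_eventually[OF tendsto_const])
  next
    case False
    then have "nat \<bar>k\<bar> \<ge> 1" by simp
    from mom[OF this] have abs: "(\<lambda>N. moment (\<nu> N) \<bar>k\<bar>) \<longlonglongrightarrow> moment \<mu> \<bar>k\<bar>" by simp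
    show ?thesis
    proof (cases "0 \<le> k")
      case True
      then show ?thesis using abs by simp
    next
      case False
      have "\<forall>\<^sub>F N in sequentially. cnj (moment (\<nu> N) \<bar>k\<bar>) = moment (\<nu> N) k"
        using ev by eventually_elim (use False in \<open>simp flip: moment_uminus\<close>)
      moreover have "cnj (moment \<mu> \<bar>k\<bar>) = moment \<mu> k"
        using False \<mu> by (simp flip: moment_uminus)
      ultimately show ?thesis using tendsto_cnj[OF abs] by (metis Lim_transform_eventually)
    qed
  qed
  show "(\<lambda>N. \<integral>x. f x \<partial>\<nu> N) \<longlonglongrightarrow> (\<integral>x. f x \<partial>\<mu>)"
  proof (rule tendstoI)
    fix e :: real assume e: "0 < e"
    have "compact (sphere (0::complex) 1)" "continuous_on (sphere 0 1) f" "0 < e / 3"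
      using f e by (auto intro: continuous_on_subset)
    from Stone_Weierstrass_polynomial_function[OF this] obtain g where
      g: "polynomial_function g" "\<And>z. norm z = 1 \<Longrightarrow> \<bar>f z - g z\<bar> < e / 3" by auto
    from g(1) have "real_polynomial_function g" by (simp add: real_polynomial_function_eq)
    from real_polynomial_function_trig[OF this]
    obtain L where L: "\<And>z. norm z = 1 \<Longrightarrow> complex_of_real (g z) = trig L z" by blast
    \<comment> \<open>A polynomial may be unbounded on the plane; \<open>h\<close> agrees with
      \<open>g\<close> on the circle but is bounded and continuous everywhere, hence
      integrable.\<close>
    define h where "h z = Re (trig L z)" for z
    have hc: "continuous_on UNIV h"
      unfolding h_def by (intro continuous_intros continuous_on_Re continuous_trig)
    have hb: "bounded (range h)"
      using bounded_trig[of L] unfolding h_def bounded_iff by (auto intro: order.trans[OF abs_Re_le_cmod])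
    \<comment> \<open>The approximation is uniform on the circle, so one error \<open>e / 3\<close>
      serves all large \<open>N\<close> and the limit alike.\<close>
    have approx: "\<bar>(\<integral>z. f z \<partial>\<rho>) - Re (\<Sum>(c, k)\<leftarrow>L. c * moment \<rho> k)\<bar> \<le> e / 3" if \<rho>: "circle_prob \<rho>" for \<rho>
    proof -
      interpret prob_space \<rho> by (rule circle_prob_space[OF \<rho>])
      have int: "integrable \<rho> f" "integrable \<rho> h" using circle_integrable[OF \<rho>] f hc hb by auto
      have "(\<integral>z. h z \<partial>\<rho>) = Re (\<integral>z. trig L z \<partial>\<rho>)"
        unfolding h_def using circle_integrable[OF \<rho> continuous_trig bounded_trig] by simp
      then have "(\<integral>z. f z \<partial>\<rho>) - Re (\<Sum>(c, k)\<leftarrow>L. c * moment \<rho> k) = (\<integral>z. f z - h z \<partial>\<rho>)"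
        using int by (simp add: integral_trig[OF \<rho>])
      also have "\<bar>\<dots>\<bar> \<le> (\<integral>z. \<bar>f z - h z\<bar> \<partial>\<rho>)" by (rule integral_abs_bound)
      also have "\<dots> \<le> (\<integral>z. e / 3 \<partial>\<rho>)"
      proof (rule integral_mono_AE)
        show "AE z in \<rho>. \<bar>f z - h z\<bar> \<le> e / 3"
          using circle_AE[OF \<rho>]
        proof eventually_elim
          fix z :: complex assume z: "norm z = 1"
          have "h z = g z" unfolding h_def L[OF z, symmetric] by simp
          then show "\<bar>f z - h z\<bar> \<le> e / 3" using g(2)[OF z] by simp
        qed
      qed (use int in auto)
      finally show ?thesis by (simp add: prob_space)
    qed
    have "(\<lambda>N. Re (\<Sum>(c, k)\<leftarrow>L. c * moment (\<nu> N) k)) \<longlonglongrightarrow> Re (\<Sum>(c, k)\<leftarrow>L. c * moment \<mu> k)"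
    proof (rule tendsto_Re)
      show "(\<lambda>N. \<Sum>(c, k)\<leftarrow>L. c * moment (\<nu> N) k) \<longlonglongrightarrow> (\<Sum>(c, k)\<leftarrow>L. c * moment \<mu> k)"
        by (induction L) (auto intro!: tendsto_intros momk)
    qed
    then have "\<forall>\<^sub>F N in sequentially. dist (Re (\<Sum>(c, k)\<leftarrow>L. c * moment (\<nu> N) k)) (Re (\<Sum>(c, k)\<leftarrow>L. c * moment \<mu> k)) < e / 3"
      by (rule tendstoD) (use e in simp)
    then show "\<forall>\<^sub>F N in sequentially. dist (\<integral>x. f x \<partial>\<nu> N) (\<integral>x. f x \<partial>\<mu>) < e"
      using ev
    proof eventually_elim
      case (elim N)
      show ?case using elim(1) approx[OF elim(2)] approx[OF \<mu>] unfolding dist_real_def by linarith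
    qed
  qed
qed

text \<open>Test functions in \<open>weakly_converges\<close> are real, so the real and imaginary
  parts of \<open>cpow\<close> are tested separately.\<close>

lemma weakly_converges_moments:
  assumes wc: "weakly_converges \<nu> \<mu>" and \<nu>: "\<And>N. N \<ge> N0 \<Longrightarrow> circle_prob (\<nu> N)" and \<mu>: "circle_prob \<mu>"
  shows "(\<lambda>N. moment (\<nu> N) k) \<longlonglongrightarrow> moment \<mu> k"
proof -
  have conv: "(\<lambda>N. \<integral>z. f z \<partial>\<nu> N) \<longlonglongrightarrow> (\<integral>z. f z \<partial>\<mu>)" if "continuous_on UNIV f" "bounded (range f)" for f :: "complex \<Rightarrow> real"
    using wc that by (auto simp: weakly_converges_def)
  have b: "bounded (range (\<lambda>z. Re (cpow k z)))" "bounded (range (\<lambda>z. Im (cpow k z)))"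
    using norm_cpow_le[of k] by (auto simp: bounded_iff intro!: exI[of _ 1] intro: order.trans[OF abs_Re_le_cmod] order.trans[OF abs_Im_le_cmod])
  have c: "continuous_on UNIV (\<lambda>z. Re (cpow k z))" "continuous_on UNIV (\<lambda>z. Im (cpow k z))"
    using continuous_cpow[of k] by (auto intro: continuous_on_Re continuous_on_Im)
  have m: "moment \<rho> k = Complex (\<integral>z. Re (cpow k z) \<partial>\<rho>) (\<integral>z. Im (cpow k z) \<partial>\<rho>)" if "circle_prob \<rho>" for \<rho>
    unfolding moment_def using integrable_cpow[OF that, of k] by (simp add: complex_eq_iff)
  have "(\<lambda>N. Complex (\<integral>z. Re (cpow k z) \<partial>\<nu> N) (\<integral>z. Im (cpow k z) \<partial>\<nu> N)) \<longlonglongrightarrow> moment \<mu> k"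
    unfolding m[OF \<mu>] by (intro tendsto_Complex conv b c)
  moreover have "\<forall>\<^sub>F N in sequentially. Complex (\<integral>z. Re (cpow k z) \<partial>\<nu> N) (\<integral>z. Im (cpow k z) \<partial>\<nu> N) = moment (\<nu> N) k"
    unfolding eventually_sequentially using \<nu> m by (intro exI[of _ N0] allI impI) simp
  ultimately show ?thesis by (rule Lim_transform_eventually)
qed

lemma integral_bind_real:
  fixes f :: "'b \<Rightarrow> real"
  assumes f: "f \<in> borel_measurable K" "\<And>x. \<bar>f x\<bar> \<le> B"
    and \<kappa>: "\<kappa> \<in> M \<rightarrow>\<^sub>M subprob_algebra K" and M: "prob_space M"
  shows "(\<integral>y. f y \<partial>(M \<bind> \<kappa>)) = (\<integral>x. \<integral>y. f y \<partial>\<kappa> x \<partial>M)"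
proof -
  interpret prob_space M by fact
  let ?D = "distr M (subprob_algebra K) \<kappa>"
  interpret D: prob_space ?D by (rule prob_space_distr[OF \<kappa>])
  have "(\<integral>y. f y \<partial>(M \<bind> \<kappa>)) = (\<integral>y. f y \<partial>join ?D)"
    by (simp add: bind_nonempty''[OF \<kappa> not_empty])
  also have "\<dots> = (\<integral>\<rho>. \<integral>y. f y \<partial>\<rho> \<partial>?D)"
  proof (rule integral_join[OF f(1), where B = B and B' = 1])
    show "AE \<rho> in ?D. emeasure \<rho> (space \<rho>) \<le> ennreal 1"
      by (rule AE_I2) (auto simp: space_subprob_algebra subprob_space.emeasure_space_le_1)
  qed (use f D.finite_measure_axioms in auto)
  also have "\<dots> = (\<integral>x. \<integral>y. f y \<partial>\<kappa> x \<partial>M)"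
    by (rule integral_distr[OF \<kappa> integral_measurable_subprob_algebra[OF f(1)]])
  finally show ?thesis .
qed

text \<open>The complex moment of a Giry bind is reduced to \<open>integral_bind_real\<close> by
  applying the bounded linear functionals \<open>Re\<close> and \<open>Im\<close>.\<close>

lemma circle_prob_bind:
  assumes M: "prob_space M" and \<kappa>: "\<kappa> \<in> M \<rightarrow>\<^sub>M subprob_algebra borel"
    and circ: "\<And>x. x \<in> space M \<Longrightarrow> circle_prob (\<kappa> x)"
  shows "circle_prob (M \<bind> \<kappa>)" and "moment (M \<bind> \<kappa>) k = (\<integral>x. moment (\<kappa> x) k \<partial>M)"
proof -
  interpret prob_space M by fact
  have "prob_space (M \<bind> \<kappa>)"
    by (rule prob_space_bind[OF AE_I2 \<kappa>]) (rule circle_prob_space[OF circ])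
  moreover have "sets (M \<bind> \<kappa>) = sets borel"
    by (rule sets_bind) (use circle_sets[OF circ] not_empty in auto)
  moreover have "emeasure (M \<bind> \<kappa>) (sphere 0 1) = 1"
  proof -
    have "emeasure (M \<bind> \<kappa>) (sphere 0 1) = (\<integral>\<^sup>+x. emeasure (\<kappa> x) (sphere 0 1) \<partial>M)"
      by (rule emeasure_bind[OF not_empty \<kappa>]) auto
    also have "\<dots> = (\<integral>\<^sup>+x. 1 \<partial>M)"
      by (rule nn_integral_cong) (use circ in \<open>auto simp: circle_prob_def\<close>)
    finally show ?thesis by (simp add: emeasure_space_1)
  qed
  ultimately show cp: "circle_prob (M \<bind> \<kappa>)" by (simp add: circle_prob_def)
  have meas: "cpow k \<in> borel_measurable borel" by (rule borel_measurable_continuous_onI[OF continuous_cpow])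
  have mm: "(\<lambda>x. moment (\<kappa> x) k) \<in> borel_measurable M"
    unfolding moment_def
    by (rule measurable_compose[OF \<kappa> integral_measurable_subprob_algebra[OF meas]])
  have int: "integrable M (\<lambda>x. moment (\<kappa> x) k)"
    by (rule integrable_const_bound[of _ 1]) (use mm norm_moment_le[OF circ] in auto)
  have part: "h (moment (M \<bind> \<kappa>) k) = h (\<integral>x. moment (\<kappa> x) k \<partial>M)"
    if h: "bounded_linear h" and h1: "\<And>z. \<bar>h z\<bar> \<le> norm z" for h :: "complex \<Rightarrow> real"
  proof -
    note hm = integral_bounded_linear[OF h]
    have "h (moment (M \<bind> \<kappa>) k) = (\<integral>z. h (cpow k z) \<partial>(M \<bind> \<kappa>))"
      unfolding moment_def by (rule hm[OF integrable_cpow[OF cp], symmetric])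
    also have "\<dots> = (\<integral>x. \<integral>z. h (cpow k z) \<partial>\<kappa> x \<partial>M)"
      by (rule integral_bind_real[where K = borel and B = 1, OF _ order.trans[OF h1 norm_cpow_le] \<kappa> M])
         (rule measurable_compose[OF meas borel_measurable_continuous_onI[OF linear_continuous_on[OF h]]])
    also have "\<dots> = (\<integral>x. h (moment (\<kappa> x) k) \<partial>M)"
      unfolding moment_def by (intro Bochner_Integration.integral_cong refl hm integrable_cpow circ)
    finally show ?thesis by (simp only: hm[OF int])
  qed
  show "moment (M \<bind> \<kappa>) k = (\<integral>x. moment (\<kappa> x) k \<partial>M)"
    by (intro complex_eqI part bounded_linear_Re bounded_linear_Im abs_Re_le_cmod abs_Im_le_cmod)
qed

section \<open>The limiting eigenvalue distribution\<close>

lemma sum_mset_image_eq_sum_count: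
  fixes f :: "'a \<Rightarrow> complex"
  assumes "finite A" "set_mset R \<subseteq> A"
  shows "\<Sum>\<^sub># (image_mset f R) = (\<Sum>z\<in>A. of_nat (count R z) * f z)"
  using assms(2)
proof (induction R)
  case (add x R)
  have "(\<Sum>z\<in>A. of_nat (count (add_mset x R) z) * f z)
      = (\<Sum>z\<in>A. (if z = x then f z else 0) + of_nat (count R z) * f z)"
    by (intro sum.cong) (auto simp: algebra_simps)
  also have "\<dots> = f x + (\<Sum>z\<in>A. of_nat (count R z) * f z)"
    using assms(1) add.prems by (simp add: sum.distrib sum.delta)
  finally show ?case using add by simp
qed simp

lemma circle_prob_distr_pmf:
  assumes "\<And>z. z \<in> set_pmf P \<Longrightarrow> norm z = 1"
  shows "circle_prob (distr (measure_pmf P) borel (\<lambda>z. z))"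
proof -
  have "prob_space (distr (measure_pmf P) borel (\<lambda>z. z))"
    by (rule measure_pmf.prob_space_distr) simp
  moreover have "emeasure (distr (measure_pmf P) borel (\<lambda>z. z)) (sphere 0 1) = emeasure (measure_pmf P) (sphere 0 1)"
    by (subst emeasure_distr) (auto simp: borel_closed)
  moreover have "emeasure (measure_pmf P) (sphere 0 1) = 1"
    using assms by (intro measure_pmf.emeasure_eq_1_AE) (auto simp: AE_measure_pmf_iff)
  ultimately show ?thesis by (simp add: circle_prob_def)
qed

lemma moment_distr_pmf:
  assumes "\<And>z. z \<in> set_pmf P \<Longrightarrow> norm z = 1" and "finite (set_pmf P)"
  shows "moment (distr (measure_pmf P) borel (\<lambda>z. z)) (int n) = (\<Sum>z\<in>set_pmf P. of_real (pmf P z) * z ^ n)"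
proof -
  have "moment (distr (measure_pmf P) borel (\<lambda>z. z)) (int n) = (\<integral>z. cpow (int n) z \<partial>measure_pmf P)"
    unfolding moment_def
    by (rule integral_distr) (auto intro: borel_measurable_continuous_onI[OF continuous_cpow])
  also have "\<dots> = (\<Sum>z\<in>set_pmf P. pmf P z *\<^sub>R cpow (int n) z)"
    using assms(2) by (intro integral_measure_pmf) auto
  also have "\<dots> = (\<Sum>z\<in>set_pmf P. of_real (pmf P z) * z ^ n)"
    using assms(1) by (intro sum.cong) (auto simp: scaleR_conv_of_real cpow_circle)
  finally show ?thesis .
qed

text \<open>The moment is \<open>1 / N\<close> times the power sum of the eigenvalues, that is, the
  proportion of points fixed by \<open>p ^^ n\<close>.\<close>

lemma empirical_eigenvalue_dist:
  assumes p: "p permutes {1..N}" and N: "1 \<le> N"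
  shows "circle_prob (empirical_eigenvalue_dist N p)"
    and "1 \<le> n \<Longrightarrow> moment (empirical_eigenvalue_dist N p) (int n) = of_real (\<Sum>d | d dvd n. period_density N d p)"
proof -
  define R where "R = proots (char_poly (perm_matrix N p))"
  note pr = proots_perm_matrix[OF p, folded R_def]
  have ne: "R \<noteq> {#}" using pr(1) N by auto
  have set: "set_pmf (pmf_of_multiset R) = set_mset R" by (rule set_pmf_of_multiset[OF ne])
  show "circle_prob (empirical_eigenvalue_dist N p)"
    unfolding empirical_eigenvalue_dist_def R_def [symmetric]
    by (rule circle_prob_distr_pmf) (use pr(2) set in auto)
  assume n: "1 \<le> n"
  have "moment (empirical_eigenvalue_dist N p) (int n) = (\<Sum>z\<in>set_mset R. of_real (pmf (pmf_of_multiset R) z) * z ^ n)"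
    unfolding empirical_eigenvalue_dist_def R_def [symmetric] set [symmetric]
    by (rule moment_distr_pmf) (use pr(2) set in auto)
  also have "\<dots> = (\<Sum>z\<in>set_mset R. of_nat (count R z) * z ^ n) / of_nat N"
    by (simp add: pmf_of_multiset[OF ne] pr(1) sum_divide_distrib)
  also have "(\<Sum>z\<in>set_mset R. of_nat (count R z) * z ^ n) = \<Sum>\<^sub># (image_mset (\<lambda>z. z ^ n) R)"
    by (rule sum_mset_image_eq_sum_count [symmetric]) auto
  also have "\<dots> = of_nat (\<Sum>d | d dvd n. num_period N p d)"
    unfolding pr(3) card_fixed_funpow[OF p n] ..
  also have "\<dots> / of_nat N = of_real (\<Sum>d | d dvd n. period_density N d p)"
    by (simp add: period_density_def sum_divide_distrib)
  finally show "moment (empirical_eigenvalue_dist N p) (int n) = of_real (\<Sum>d | d dvd n. period_density N d p)" .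
qed

lemma integrable_period_density:
  assumes "prob_space M" and X: "X \<in> M \<rightarrow>\<^sub>M count_space E"
  shows "integrable M (\<lambda>\<omega>. period_density N d (X \<omega>))"
proof -
  interpret prob_space M by fact
  have "(\<lambda>\<omega>. period_density N d (X \<omega>)) \<in> borel_measurable M"
    by (rule measurable_compose[OF X]) simp
  then show ?thesis
    by (rule integrable_const_bound[rotated, of _ 1]) (use period_density_bounds in auto)
qed

lemma mean_eigenvalue_dist:
  assumes M: "prob_space M" and X: "X \<in> M \<rightarrow>\<^sub>M count_space (carrier (sym_group N))" and N: "1 \<le> N"
  shows "circle_prob (mean_eigenvalue_dist N M X)"
    and "1 \<le> n \<Longrightarrow> moment (mean_eigenvalue_dist N M X) (int n)
       = of_real (\<Sum>d | d dvd n. \<integral>\<omega>. period_density N d (X \<omega>) \<partial>M)"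
proof -
  interpret prob_space M by fact
  let ?\<kappa> = "\<lambda>\<omega>. empirical_eigenvalue_dist N (X \<omega>)"
  have Xp: "X \<omega> permutes {1..N}" if "\<omega> \<in> space M" for \<omega>
    using measurable_space[OF X that] by (simp add: sym_group_carrier)
  have "empirical_eigenvalue_dist N \<in> count_space (carrier (sym_group N)) \<rightarrow>\<^sub>M subprob_algebra borel"
  proof (rule measurable_count_space_eq1[THEN iffD2], rule Pi_I)
    fix p assume "p \<in> carrier (sym_group N)"
    then have "circle_prob (empirical_eigenvalue_dist N p)"
      using empirical_eigenvalue_dist(1)[OF _ N] by (simp add: sym_group_carrier)
    then show "empirical_eigenvalue_dist N p \<in> space (subprob_algebra borel)"
      by (auto simp: space_subprob_algebra circle_prob_def prob_space_imp_subprob_space)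
  qed
  from measurable_compose[OF X this] have \<kappa>: "?\<kappa> \<in> M \<rightarrow>\<^sub>M subprob_algebra borel" .
  have circ: "circle_prob (?\<kappa> \<omega>)" if "\<omega> \<in> space M" for \<omega>
    by (rule empirical_eigenvalue_dist(1)[OF Xp[OF that] N])
  show "circle_prob (mean_eigenvalue_dist N M X)"
    unfolding mean_eigenvalue_dist_def by (rule circle_prob_bind[OF M \<kappa> circ])
  assume n: "1 \<le> n"
  have "moment (mean_eigenvalue_dist N M X) (int n) = (\<integral>\<omega>. moment (?\<kappa> \<omega>) (int n) \<partial>M)"
    unfolding mean_eigenvalue_dist_def by (rule circle_prob_bind[OF M \<kappa> circ])
  also have "\<dots> = (\<integral>\<omega>. complex_of_real (\<Sum>d | d dvd n. period_density N d (X \<omega>)) \<partial>M)"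
    by (intro Bochner_Integration.integral_cong refl empirical_eigenvalue_dist(2)[OF Xp N n])
  also have "\<dots> = of_real (\<integral>\<omega>. (\<Sum>d | d dvd n. period_density N d (X \<omega>)) \<partial>M)"
    by (rule integral_complex_of_real)
  also have "(\<integral>\<omega>. (\<Sum>d | d dvd n. period_density N d (X \<omega>)) \<partial>M) = (\<Sum>d | d dvd n. \<integral>\<omega>. period_density N d (X \<omega>) \<partial>M)"
    by (rule Bochner_Integration.integral_sum) (rule integrable_period_density[OF M X])
  finally show "moment (mean_eigenvalue_dist N M X) (int n)
       = of_real (\<Sum>d | d dvd n. \<integral>\<omega>. period_density N d (X \<omega>) \<partial>M)" .
qed

definition roots_dist :: "nat \<Rightarrow> complex measure" where
  "roots_dist d = distr (measure_pmf (pmf_of_set {z. z ^ d = 1})) borel (\<lambda>z. z)"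

text \<open>Multiplication by a primitive root \<open>w\<close> permutes the roots and multiplies
  the sum by \<open>w ^ n\<close>, which differs from 1 unless \<open>d\<close> divides
  \<open>n\<close>.\<close>

lemma sum_roots_unity_power:
  assumes d: "1 \<le> d"
  shows "(\<Sum>z | z ^ d = 1. z ^ n) = (if d dvd n then of_nat d else (0 :: complex))"
proof (cases "d dvd n")
  case True
  then obtain k where k: "n = d * k" by (auto elim: dvdE)
  have "(\<Sum>z::complex | z ^ d = 1. z ^ n) = (\<Sum>z::complex | z ^ d = 1. 1)"
    by (intro sum.cong) (auto simp: k power_mult)
  then show ?thesis using True card_complex_roots_unity[OF d] by simp
next
  case False
  define w where "w = exp (2 * of_real pi * \<i> * of_nat 1 / of_nat d)"
  have "w ^ m = exp (2 * of_real pi * \<i> * of_nat m / of_nat d)" for m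
    by (simp add: w_def exp_of_nat_mult [symmetric] mult_ac)
  then have wm: "w ^ m = 1 \<longleftrightarrow> d dvd m" for m
    using complex_root_unity_eq_1[OF d, of m] by simp
  have w: "w ^ d = 1" and wn: "w ^ n \<noteq> 1" using False by (simp_all add: wm)
  have w0: "w \<noteq> 0" by (simp add: w_def)
  have bij: "bij_betw ((*) w) {z. z ^ d = 1} {z. z ^ d = 1}"
    by (rule bij_betw_byWitness[where f' = "\<lambda>z. z / w"])
       (auto simp: w w0 power_mult_distrib power_divide)
  have "(\<Sum>z | z ^ d = 1. (w * z) ^ n) = (\<Sum>z | z ^ d = 1. z ^ n)"
    by (rule sum.reindex_bij_betw[OF bij])
  then have "w ^ n * (\<Sum>z | z ^ d = 1. z ^ n) = (\<Sum>z | z ^ d = 1. z ^ n)"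
    by (simp add: power_mult_distrib sum_distrib_left)
  then show ?thesis using wn False by simp
qed

lemma roots_dist:
  assumes d: "1 \<le> d"
  shows "circle_prob (roots_dist d)" and "moment (roots_dist d) (int n) = of_bool (d dvd n)"
proof -
  let ?R = "{z :: complex. z ^ d = 1}"
  have fin: "finite ?R" using card_complex_roots_unity[OF d] d by (intro card_ge_0_finite) simp
  have ne: "?R \<noteq> {}" by (auto intro: exI[of _ 1])
  have norm: "norm z = 1" if "z ^ d = 1" for z :: complex
  proof -
    have "norm z ^ d = 1" using that by (simp flip: norm_power)
    then show ?thesis using d power_eq_imp_eq_base[of "norm z" d 1] by simp
  qed
  show "circle_prob (roots_dist d)"
    unfolding roots_dist_def by (rule circle_prob_distr_pmf) (use norm fin ne in auto)
  have "moment (roots_dist d) (int n) = (\<Sum>z\<in>set_pmf (pmf_of_set ?R). of_real (pmf (pmf_of_set ?R) z) * z ^ n)"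
    unfolding roots_dist_def by (rule moment_distr_pmf) (use norm fin ne in auto)
  also have "\<dots> = (\<Sum>z\<in>?R. z ^ n) / of_nat d"
    using fin ne by (simp add: card_complex_roots_unity[OF d] sum_divide_distrib)
  finally show "moment (roots_dist d) (int n) = of_bool (d dvd n)"
    using d by (simp add: sum_roots_unity_power)
qed

text \<open>The uniform distribution on the circle; its moments of positive order vanish, so it can
  carry the mass that no finite period accounts for in the limit.\<close>

definition circle_haar :: "complex measure" where
  "circle_haar = distr (restrict_space lborel {0..1}) borel (\<lambda>x. cis (2 * pi * x))"

lemma circle_haar:
  shows "circle_prob circle_haar" and "1 \<le> n \<Longrightarrow> moment circle_haar (int n) = 0"
proof -
  let ?I = "restrict_space lborel {0..1::real}"
  have meas: "(\<lambda>x. cis (2 * pi * x)) \<in> ?I \<rightarrow>\<^sub>M borel"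
    by (intro measurable_restrict_space1) (auto intro!: borel_measurable_continuous_onI continuous_intros)
  interpret I: prob_space ?I
    by (rule prob_spaceI) (simp add: space_restrict_space emeasure_restrict_space)
  have "prob_space circle_haar" unfolding circle_haar_def by (rule I.prob_space_distr[OF meas])
  moreover have "emeasure circle_haar (sphere 0 1) = emeasure ?I (space ?I)"
    unfolding circle_haar_def using meas by (subst emeasure_distr) (auto simp: borel_closed intro!: arg_cong[of _ _ "emeasure ?I"])
  moreover have "sets circle_haar = sets borel" by (simp add: circle_haar_def)
  ultimately show "circle_prob circle_haar"
    by (simp only: circle_prob_def I.emeasure_space_1 simp_thms)
  assume n: "1 \<le> n"
  define c where "c = 2 * of_real pi * of_nat n * \<i>"
  have c: "c \<noteq> 0" using n by (simp add: c_def)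
  have cpw: "cpow (int n) (cis (2 * pi * x)) = exp (c * of_real x)" for x
  proof -
    have "cpow (int n) (cis (2 * pi * x)) = cis (2 * pi * x) ^ n" by (simp add: cpow_circle)
    also have "\<dots> = cis (real n * (2 * pi * x))" by (rule Complex.DeMoivre)
    also have "\<dots> = exp (c * of_real x)" by (simp add: cis_conv_exp c_def mult_ac)
    finally show ?thesis .
  qed
  have "moment circle_haar (int n) = (\<integral>x. cpow (int n) (cis (2 * pi * x)) \<partial>?I)"
    unfolding moment_def circle_haar_def
    by (rule integral_distr[OF meas]) (rule borel_measurable_continuous_onI[OF continuous_cpow])
  also have "\<dots> = (\<integral>x. exp (c * of_real x) \<partial>?I)" unfolding cpw ..
  also have "\<dots> = (\<integral>x. indicator {0..1} x *\<^sub>R exp (c * of_real x) \<partial>lborel)"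
    by (rule integral_restrict_space) simp
  also have "\<dots> = exp (c * of_real 1) / c - exp (c * of_real 0) / c"
  proof (rule integral_FTC_atLeastAtMost)
    fix x :: real
    have "((\<lambda>z. exp (c * z) / c) has_field_derivative exp (c * of_real x)) (at (of_real x))"
      using c by (auto intro!: derivative_eq_intros)
    then show "((\<lambda>x. exp (c * of_real x) / c) has_vector_derivative exp (c * of_real x)) (at x within {0..1})"
      by (rule has_vector_derivative_real_field)
  qed (auto intro!: continuous_intros)
  also have "exp c = 1"
  proof -
    have "exp c = cis (2 * pi * real n)" by (simp add: cis_conv_exp c_def mult_ac)
    also have "\<dots> = 1" by (rule cis_multiple_2pi) simp
    finally show ?thesis .
  qed
  then have "exp (c * of_real 1) / c - exp (c * of_real 0) / c = 0" by simp
  finally show "moment circle_haar (int n) = 0" .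
qed

text \<open>The \<open>n\<close>-th moment of \<open>roots_dist d\<close> is 1 or 0 according to
  whether \<open>d\<close> divides \<open>n\<close>, so mixing with weights \<open>w d\<close>
  produces the divisor sum; Haar measure supplies the missing mass without changing a moment of
  positive order.\<close>

lemma circle_prob_with_moments:
  fixes w :: "nat \<Rightarrow> real"
  assumes w0: "\<And>d. 1 \<le> d \<Longrightarrow> 0 \<le> w d" and w1: "\<And>m. (\<Sum>d=1..m. w d) \<le> 1"
  obtains \<mu> where "circle_prob \<mu>" "\<And>n. 1 \<le> n \<Longrightarrow> moment \<mu> (int n) = of_real (\<Sum>d | d dvd n. w d)"
proof -
  have part: "(\<Sum>d<m. w (Suc d)) \<le> 1" for m
  proof -
    have "(\<Sum>d<m. w (Suc d)) = (\<Sum>d=1..m. w d)"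
      by (rule sum.reindex_bij_witness[where i = "\<lambda>d. d - 1" and j = Suc]) auto
    then show ?thesis using w1[of m] by simp
  qed
  have sum: "summable (\<lambda>d. w (Suc d))"
    by (rule summableI_nonneg_bounded[OF _ part]) (simp add: w0)
  \<comment> \<open>Index 0 is free, as periods start at 1; it is given to Haar measure, with the
    defect of mass as weight.\<close>
  define v where "v d = (if d = 0 then 1 - (\<Sum>d. w (Suc d)) else w d)" for d
  have "(\<Sum>d. w (Suc d)) \<le> 1" by (rule suminf_le_const[OF sum part])
  then have v0: "0 \<le> v d" for d using w0[of d] by (simp add: v_def)
  have vsum: "summable v" using sum summable_Suc_iff[of v] by (simp add: v_def)
  have "(\<Sum>d. v (Suc d)) = (\<Sum>d. w (Suc d))" "v 0 = 1 - (\<Sum>d. w (Suc d))"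
    by (simp_all add: v_def)
  with suminf_split_head[OF vsum] have "(\<Sum>d. v d) = 1" by linarith
  then have v1: "(\<integral>\<^sup>+d. ennreal (v d) \<partial>count_space UNIV) = 1"
    by (simp add: nn_integral_count_space_nat suminf_ennreal2[OF v0 vsum])
  define Q where "Q = embed_pmf v"
  have pmfQ: "pmf Q d = v d" for d unfolding Q_def by (rule pmf_embed_pmf[OF v0 v1])
  define \<kappa> where "\<kappa> d = (if d = 0 then circle_haar else roots_dist d)" for d :: nat
  have circ: "circle_prob (\<kappa> d)" for d
    using circle_haar(1) roots_dist(1)[of d] by (simp add: \<kappa>_def)
  have meas: "\<kappa> \<in> measure_pmf Q \<rightarrow>\<^sub>M subprob_algebra borel"
    using circ by (auto simp: measurable_def space_subprob_algebra circle_prob_def prob_space_imp_subprob_space)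
  show ?thesis
  proof (rule that)
    show "circle_prob (measure_pmf Q \<bind> \<kappa>)"
      by (rule circle_prob_bind[OF prob_space_measure_pmf meas circ])
    fix n :: nat assume n: "1 \<le> n"
    have fin: "finite {d. d dvd n}" using n by simp
    have mk: "moment (\<kappa> d) (int n) = of_bool (d dvd n)" for d
      using circle_haar(2)[OF n] roots_dist(2)[of d n] n by (auto simp: \<kappa>_def)
    have "moment (measure_pmf Q \<bind> \<kappa>) (int n) = (\<integral>d. moment (\<kappa> d) (int n) \<partial>measure_pmf Q)"
      by (rule circle_prob_bind[OF prob_space_measure_pmf meas circ])
    also have "\<dots> = (\<Sum>d | d dvd n. pmf Q d *\<^sub>R moment (\<kappa> d) (int n))"
      by (rule integral_measure_pmf[OF fin]) (simp add: mk)
    also have "\<dots> = (\<Sum>d | d dvd n. of_real (w d))"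
    proof (intro sum.cong refl)
      fix d assume d: "d \<in> {d. d dvd n}"
      then have "d \<noteq> 0" using n by auto
      then show "pmf Q d *\<^sub>R moment (\<kappa> d) (int n) = of_real (w d)"
        using d by (simp add: mk pmfQ v_def scaleR_conv_of_real)
    qed
    finally show "moment (measure_pmf Q \<bind> \<kappa>) (int n) = of_real (\<Sum>d | d dvd n. w d)" by simp
  qed
qed

lemma sum_period_density_le: "(\<Sum>d=1..m. period_density N d p) \<le> 1"
proof -
  have "(\<Sum>d=1..m. num_period N p d) = card (\<Union>d\<in>{1..m}. {j\<in>{1..N}. least_power p j = d})"
    unfolding num_period_def by (rule card_UN_disjoint [symmetric]) auto
  also have "\<dots> \<le> card {1..N}" by (rule card_mono) auto
  finally have "(\<Sum>d=1..m. num_period N p d) \<le> N" by simp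
  then have "(\<Sum>d=1..m. real (num_period N p d)) \<le> real N"
    by (simp only: of_nat_sum [symmetric] of_nat_le_iff)
  then have "(\<Sum>d=1..m. real (num_period N p d)) / real N \<le> 1" by (simp add: divide_le_eq)
  then show ?thesis by (simp add: period_density_def sum_divide_distrib)
qed

text \<open>Existence of a weak limit is asserted beside the formula for every weak limit, so that
  the formula is not vacuous.\<close>

theorem theorem2p7:
  fixes C :: "nat \<Rightarrow> (nat \<Rightarrow> nat) set"
    and lam :: "nat \<Rightarrow> real"
    and \<alpha> :: real
    and M :: "nat \<Rightarrow> 'w measure"
    and S :: "nat \<Rightarrow> real \<Rightarrow> 'w \<Rightarrow> nat \<Rightarrow> nat"
  assumes "\<And>N. N \<ge> 2 \<Longrightarrow> conj_class (sym_group N) (C N)"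
    and "\<And>N. N \<ge> 2 \<Longrightarrow> C N \<noteq> {id}"
    and "class_seq_converges C lam \<alpha>"
    and "\<alpha> = 0"
    and "\<And>N. N \<ge> 2 \<Longrightarrow> random_walk N (C N) (M N) (S N)"
  shows "(\<forall>n\<ge>1. \<forall>t\<ge>0.
            (\<lambda>N. \<integral>\<omega>. period_density N n (S N t \<omega>) \<partial>M N) \<longlonglongrightarrow> limit_density lam n t) \<and>
         (\<forall>t\<ge>0.
            (\<exists>\<mu>. circle_prob \<mu> \<and>
               weakly_converges (\<lambda>N. mean_eigenvalue_dist N (M N) (S N t)) \<mu>) \<and>
            (\<forall>\<mu>. circle_prob \<mu> \<and>
               weakly_converges (\<lambda>N. mean_eigenvalue_dist N (M N) (S N t)) \<mu> \<longrightarrow>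
               (\<forall>n\<ge>1. (LINT z:sphere 0 1|\<mu>. z ^ n)
                  = complex_of_real (\<Sum>d | d dvd n. limit_density lam d t))))"
proof -
  have nc: "nontrivial_class N (C N)" if "N \<ge> 2" for N
    using assms(1,2)[OF that] that by (intro nontrivial_class.intro)
  have conv: "class_seq_converges C lam 0" using assms(3,4) by simp
  have lim: "(\<lambda>N. \<integral>\<omega>. period_density N n (S N t \<omega>) \<partial>M N) \<longlonglongrightarrow> limit_density lam n t"
    if "1 \<le> n" "0 \<le> t" for n t
    by (rule expected_period_density_tendsto[OF nc conv assms(5) that])
  show ?thesis
  proof (intro conjI allI impI lim)
    fix t :: real assume t: "0 \<le> t"
    define \<nu> where "\<nu> N = mean_eigenvalue_dist N (M N) (S N t)" for N
    have prob: "prob_space (M N)" and meas: "S N t \<in> M N \<rightarrow>\<^sub>M count_space (carrier (sym_group N))"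
      if "N \<ge> 2" for N
      using assms(5)[OF that] t by (auto simp: random_walk_def markov_process_def)
    have circ: "circle_prob (\<nu> N)" if "N \<ge> 2" for N
      unfolding \<nu>_def using mean_eigenvalue_dist(1)[OF prob[OF that] meas[OF that]] that by simp
    have mom: "(\<lambda>N. moment (\<nu> N) (int n)) \<longlonglongrightarrow> of_real (\<Sum>d | d dvd n. limit_density lam d t)" if n: "1 \<le> n" for n
    proof -
      have "(\<lambda>N. \<Sum>d | d dvd n. \<integral>\<omega>. period_density N d (S N t \<omega>) \<partial>M N) \<longlonglongrightarrow> (\<Sum>d | d dvd n. limit_density lam d t)"
      proof (rule tendsto_sum)
        fix d assume "d \<in> {d. d dvd n}"
        then have "1 \<le> d" using n by (cases "d = 0") auto
        then show "(\<lambda>N. \<integral>\<omega>. period_density N d (S N t \<omega>) \<partial>M N) \<longlonglongrightarrow> limit_density lam d t"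
          by (rule lim[OF _ t])
      qed
      from tendsto_of_real[OF this, where 'a = complex]
      show ?thesis
      proof (rule Lim_transform_eventually)
        show "\<forall>\<^sub>F N in sequentially. of_real (\<Sum>d | d dvd n. \<integral>\<omega>. period_density N d (S N t \<omega>) \<partial>M N) = moment (\<nu> N) (int n)"
          using eventually_ge_at_top[of 2]
        proof eventually_elim
          case (elim N)
          show ?case unfolding \<nu>_def
            by (rule mean_eigenvalue_dist(2)[OF prob[OF elim] meas[OF elim] _ n, symmetric]) (use elim in simp)
        qed
      qed
    qed
    \<comment> \<open>Sign and total mass at most 1 pass from the expectations at finite
      \<open>N\<close> to the limit densities and make them admissible weights for the
      mixture.\<close>
    have nonneg: "0 \<le> limit_density lam d t" if "1 \<le> d" for d
      by (rule LIMSEQ_le_const[OF lim[OF that t]])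
         (auto intro!: Bochner_Integration.integral_nonneg period_density_bounds)
    have le1: "(\<Sum>d=1..m. limit_density lam d t) \<le> 1" for m
    proof (rule LIMSEQ_le_const2)
      show "(\<lambda>N. \<Sum>d=1..m. \<integral>\<omega>. period_density N d (S N t \<omega>) \<partial>M N) \<longlonglongrightarrow> (\<Sum>d=1..m. limit_density lam d t)"
        by (intro tendsto_sum lim[OF _ t]) auto
      show "\<exists>N0. \<forall>N\<ge>N0. (\<Sum>d=1..m. \<integral>\<omega>. period_density N d (S N t \<omega>) \<partial>M N) \<le> 1"
      proof (intro exI[of _ 2] allI impI)
        fix N :: nat assume N: "2 \<le> N"
        interpret prob_space "M N" by (rule prob[OF N])
        note int = integrable_period_density[OF prob[OF N] meas[OF N]]
        have "(\<Sum>d=1..m. \<integral>\<omega>. period_density N d (S N t \<omega>) \<partial>M N) = (\<integral>\<omega>. (\<Sum>d=1..m. period_density N d (S N t \<omega>)) \<partial>M N)"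
          by (rule Bochner_Integration.integral_sum [symmetric]) (rule int)
        also have "\<dots> \<le> (\<integral>\<omega>. 1 \<partial>M N)"
          by (intro integral_mono Bochner_Integration.integrable_sum int sum_period_density_le) simp
        finally show "(\<Sum>d=1..m. \<integral>\<omega>. period_density N d (S N t \<omega>) \<partial>M N) \<le> 1" by (simp add: prob_space)
      qed
    qed
    obtain \<mu> where \<mu>: "circle_prob \<mu>"
      and \<mu>m: "\<And>n. 1 \<le> n \<Longrightarrow> moment \<mu> (int n) = of_real (\<Sum>d | d dvd n. limit_density lam d t)"
      using circle_prob_with_moments[of "\<lambda>d. limit_density lam d t", OF nonneg le1] by blast
    have "weakly_converges \<nu> \<mu>"
      by (rule weakly_convergesI_moments[OF circ \<mu>]) (use mom \<mu>m in auto)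
    with \<mu> show "\<exists>\<mu>. circle_prob \<mu> \<and> weakly_converges (\<lambda>N. mean_eigenvalue_dist N (M N) (S N t)) \<mu>"
      unfolding \<nu>_def by blast
    fix \<mu> and n :: nat
    assume "circle_prob \<mu> \<and> weakly_converges (\<lambda>N. mean_eigenvalue_dist N (M N) (S N t)) \<mu>" and n: "1 \<le> n"
    then have \<mu>: "circle_prob \<mu>" "weakly_converges \<nu> \<mu>" unfolding \<nu>_def by auto
    show "(LINT z:sphere 0 1|\<mu>. z ^ n) = complex_of_real (\<Sum>d | d dvd n. limit_density lam d t)"
      unfolding moment_eq_set_integral[OF \<mu>(1)]
      by (rule LIMSEQ_unique[OF weakly_converges_moments[OF \<mu>(2) circ \<mu>(1)] mom[OF n]])
  qed
qed

end
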